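(* Let $g$ and $\mathfrak i$ be arbitrary, and let $\sigma_1,\sigma_2\in\mathfrak D_{\mathfrak i}\subset S(g,\mathfrak i)^{open}$. If $g-\mathfrak i$ is odd, then $\sigma_1$ and $\sigma_2$ are D-equivalent. If $g-\mathfrak i$ is even, then $\sigma_1$ is D-equivalent to $\sigma_2$ if and only if the ratio $\det\tilde G_{22}(\sigma_1)/\det\tilde G_{22}(\sigma_2)$ is a square in $\mathbb F_p^*$.
   Context: Let $p$ be an odd prime and $K=\mathbb Q(\sqrt{-\Delta})$ ($\Delta>0$ a squarefree integer) an imaginary quadratic field in which $p$ is inert. Put $\mathbb Z_{p^2}=\mathbb Z_p[\sqrt{-\Delta}]$, $\mathbb F_{p^2}=\mathbb F_p[\sqrt{-\Delta}]$; bar denotes the nontrivial automorphism, tilde denotes reduction modulo $p$; for $x=a+b\sqrt{-\Delta}$ put $\operatorname{im}x=b$ (entrywise for matrices). Let $0\le\mathfrak i\le g$, $E=\mathrm{diag}(1_{\mathfrak i},-1_{g-\mathfrak i})$ (i.e. signature $(\mathfrak r,\mathfrak s)=(\mathfrak i,g-\mathfrak i)$). $G_V(\mathbb Z_p)$ is the group of $\mathfrak g=h+k\sqrt{-\Delta}$, $h,k\in M_g(\mathbb Z_p)$, with $\mathfrak gE\bar{\mathfrak g}^t=\lambda E$, $\lambda\in\mathbb Z_p^*$; $\alpha(\mathfrak g)=\begin{pmatrix} h& kE\\ -\Delta Ek& EhE\end{pmatrix}\in GSp_{2g}(\mathbb Z_p)$. $S(g,\mathfrak i)^{open}$ is the set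 of matrices (diagonal blocks of sizes $\mathfrak i,g-\mathfrak i,\mathfrak i,g-\mathfrak i$) $$\sigma=\begin{pmatrix} p&0&0&pC^t\\ -A&1&C&U\\ 0&0&p&pA^t\\ 0&0&0&p^2\end{pmatrix},$$ where $A,C$ are integer $(g-\mathfrak i)\times\mathfrak i$ matrices with entries in a fixed system of residues modulo $p$, and $U$ is an integer $(g-\mathfrak i)\times(g-\mathfrak i)$ matrix with diagonal and upper-triangular entries in a fixed system of residues modulo $p^2$ and $CA^t-AC^t=U-U^t$. For such $\sigma$ put $$\mu_1=\begin{pmatrix}-1&-C^t\sqrt{-\Delta}\\ A+C\sqrt{-\Delta}&-1-U\sqrt{-\Delta}\end{pmatrix},\quad \mu_2=\begin{pmatrix}\sqrt{-\Delta}&-A^t\sqrt{-\Delta}\\ A+C\sqrt{-\Delta}&-1-U\sqrt{-\Delta}\end{pmatrix},$$ and $G=\mu_1E\bar\mu_1^t$, with blocks $G_{jk}$ for the block sizes $\mathfrak i,g-\mathfrak i$; thus $G_{22}=G_{22}(\sigma)$ is the lower right $(g-\mathfrak i)\times(g-\mathfrak i)$ block (it has entries in $\mathbb Z_p$). If $\det\tilde\mu_1\ne0$, define $X_1,X_2$ by $\mu_2=\begin{pmatrix}X_1&X_2\\0&1\end{pmatrix}\mu_1$; then $\sigma\in\mathfrak D_j$ iff $\operatorname{rank}\operatorname{im}\tilde X_1=j$ ($0\le j\le\mathfrak i$). If $\det\tilde\mu_1=0$ and $\det\tilde\mu_2\ne0$, $\mathfrak D_j$ is defined in the same way with the roles of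 $\mu_1,\mu_2$ interchanged. If $\det\tilde\mu_1=\det\tilde\mu_2=0$, then $\sigma\in\mathfrak D_*$. Two elements $\sigma_1,\sigma_2$ are D-equivalent if there exists $\mathfrak g\in G_V(\mathbb Z_p)$ such that $\sigma_1\alpha(\mathfrak g)\sigma_2^{-1}$ has entries in $\mathbb Z_p$ (equivalently lies in $GSp_{2g}(\mathbb Z_p)$). *)

theory Defs
  imports
    Complex_Main
    "HOL-Algebra.Ideal"
    "HOL-Computational_Algebra.Normalized_Fraction"
    "HOL-Computational_Algebra.Squarefree"
    "Jordan_Normal_Form.Determinant"
    "Jordan_Normal_Form.DL_Rank"
    "Jordan_Normal_Form.Gauss_Jordan_Elimination"
    "Berlekamp_Zassenhaus.Finite_Field"
begin

text \<open>
  The prime \<open>p\<close> and the squarefree integer \<open>\<Delta>\<close> enter as cardinalities of two type variables,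
  \<open>p = CARD('p)\<close> and \<open>\<Delta> = CARD('d)\<close>, so that \<open>\<int>\<^sub>p\<close>, \<open>\<rat>\<^sub>p\<close>, \<open>\<int>\<^sub>p[\<surd>-\<Delta>]\<close> and \<open>\<bbbF>\<^sub>p[\<surd>-\<Delta>]\<close> are types
  and matrices over them are covered by the library.  \<open>\<bbbF>\<^sub>p\<close> is \<open>'p mod_ring\<close>.
\<close>

section \<open>The \<open>p\<close>-adic integers\<close>

text \<open>
  \<open>\<int>\<^sub>p\<close> is the inverse limit of the rings \<open>\<int>/p\<^sup>n\<close>; the component \<open>x n\<close> is the representative of
  \<open>x mod p\<^sup>n\<close> in \<open>{0..<p\<^sup>n}\<close> (the condition below forces this range).
\<close>

typedef (overloaded) 'p padic_int =
  "{x :: nat \<Rightarrow> int. \<forall>n. x n = x (Suc n) mod int CARD('p) ^ n}"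
  by (rule exI[of _ "\<lambda>_. 0"]) simp

setup_lifting type_definition_padic_int

lemma padic_mod_Suc: "(a mod (q::int) ^ Suc n) mod q ^ n = a mod q ^ n"
  by (rule mod_mod_cancel) (simp add: le_imp_power_dvd)

lemma padic_component_mod:
  "Rep_padic_int (x :: 'p padic_int) n = Rep_padic_int x (n + m) mod int CARD('p) ^ n"
proof (induction m)
  case 0
  have "Rep_padic_int x n = Rep_padic_int x (Suc n) mod int CARD('p) ^ n"
    using Rep_padic_int[of x] by blast
  then show ?case
    by (metis add_0_right mod_mod_trivial)
next
  case (Suc m)
  have "Rep_padic_int x (n + m) = Rep_padic_int x (Suc (n + m)) mod int CARD('p) ^ (n + m)"
    using Rep_padic_int[of x] by blast
  then have "Rep_padic_int x (n + m) mod int CARD('p) ^ n =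
      Rep_padic_int x (Suc (n + m)) mod int CARD('p) ^ n"
    by (metis le_add1 le_imp_power_dvd mod_mod_cancel)
  then show ?case
    using Suc by simp
qed

instantiation padic_int :: (prime_card) comm_ring_1
begin

lift_definition zero_padic_int :: "'a padic_int" is "\<lambda>_. 0"
  by simp

lift_definition one_padic_int :: "'a padic_int" is "\<lambda>n. 1 mod int CARD('a) ^ n"
  by (simp only: padic_mod_Suc)

lift_definition plus_padic_int :: "'a padic_int \<Rightarrow> 'a padic_int \<Rightarrow> 'a padic_int"
  is "\<lambda>x y n. (x n + y n) mod int CARD('a) ^ n"
proof -
  fix x y :: "nat \<Rightarrow> int" and n
  assume *: "\<And>n. x n = x (Suc n) mod int CARD('a) ^ n" "\<And>n. y n = y (Suc n) mod int CARD('a) ^ n"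
  show "(x n + y n) mod int CARD('a) ^ n =
      (x (Suc n) + y (Suc n)) mod int CARD('a) ^ Suc n mod int CARD('a) ^ n"
    by (metis * mod_add_eq padic_mod_Suc)
qed

lift_definition uminus_padic_int :: "'a padic_int \<Rightarrow> 'a padic_int"
  is "\<lambda>x n. (- x n) mod int CARD('a) ^ n"
proof -
  fix x :: "nat \<Rightarrow> int" and n
  assume *: "\<And>n. x n = x (Suc n) mod int CARD('a) ^ n"
  show "(- x n) mod int CARD('a) ^ n =
      (- x (Suc n)) mod int CARD('a) ^ Suc n mod int CARD('a) ^ n"
    by (metis * mod_minus_eq padic_mod_Suc)
qed

lift_definition minus_padic_int :: "'a padic_int \<Rightarrow> 'a padic_int \<Rightarrow> 'a padic_int"
  is "\<lambda>x y n. (x n - y n) mod int CARD('a) ^ n"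
proof -
  fix x y :: "nat \<Rightarrow> int" and n
  assume *: "\<And>n. x n = x (Suc n) mod int CARD('a) ^ n" "\<And>n. y n = y (Suc n) mod int CARD('a) ^ n"
  show "(x n - y n) mod int CARD('a) ^ n =
      (x (Suc n) - y (Suc n)) mod int CARD('a) ^ Suc n mod int CARD('a) ^ n"
    by (metis * mod_diff_eq padic_mod_Suc)
qed

lift_definition times_padic_int :: "'a padic_int \<Rightarrow> 'a padic_int \<Rightarrow> 'a padic_int"
  is "\<lambda>x y n. (x n * y n) mod int CARD('a) ^ n"
proof -
  fix x y :: "nat \<Rightarrow> int" and n
  assume *: "\<And>n. x n = x (Suc n) mod int CARD('a) ^ n" "\<And>n. y n = y (Suc n) mod int CARD('a) ^ n"
  show "(x n * y n) mod int CARD('a) ^ n =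
      (x (Suc n) * y (Suc n)) mod int CARD('a) ^ Suc n mod int CARD('a) ^ n"
    by (metis * mod_mult_eq padic_mod_Suc)
qed

instance
proof
  fix a b c :: "'a padic_int"
  have comp: "Rep_padic_int a n mod int CARD('a) ^ n = Rep_padic_int a n" for n
    using padic_component_mod[of a n 0] by simp
  have eqI: "x = y" if "\<And>n. Rep_padic_int x n = Rep_padic_int y n" for x y :: "'a padic_int"
    using that by (metis Rep_padic_int_inject ext)
  note rep = zero_padic_int.rep_eq one_padic_int.rep_eq plus_padic_int.rep_eq
    uminus_padic_int.rep_eq minus_padic_int.rep_eq times_padic_int.rep_eq
  show "a * b * c = a * (b * c)"
    by (rule eqI) (simp only: rep mod_mult_left_eq mod_mult_right_eq mult.assoc)
  show "a * b = b * a"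
    by (rule eqI) (simp only: rep mult.commute)
  show "1 * a = a"
    by (rule eqI) (simp only: rep mod_mult_left_eq mult_1 comp)
  show "a + b + c = a + (b + c)"
    by (rule eqI) (simp only: rep mod_add_left_eq mod_add_right_eq add.assoc)
  show "a + b = b + a"
    by (rule eqI) (simp only: rep add.commute)
  show "0 + a = a"
    by (rule eqI) (simp only: rep add_0 comp)
  show "- a + a = 0"
    by (rule eqI) (simp only: rep mod_add_left_eq left_minus mod_0)
  show "a - b = a + - b"
    by (rule eqI) (simp only: rep mod_add_right_eq diff_conv_add_uminus)
  show "(a + b) * c = a * c + b * c"
    by (rule eqI) (simp only: rep mod_mult_left_eq mod_add_eq distrib_right)
  show "(0 :: 'a padic_int) \<noteq> 1"
  proof
    assume "(0 :: 'a padic_int) = 1"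
    then have "Rep_padic_int (0 :: 'a padic_int) 1 = Rep_padic_int (1 :: 'a padic_int) 1"
      by simp
    then show False
      by (simp add: rep)
  qed
qed

end

instance padic_int :: (prime_card) idom
proof
  fix a b :: "'a padic_int"
  let ?p = "int CARD('a)"
  assume a: "a \<noteq> 0" and b: "b \<noteq> 0"
  have ex: "\<exists>n. Rep_padic_int x n \<noteq> 0" if "x \<noteq> 0" for x :: "'a padic_int"
    using that by (metis Rep_padic_int_inject ext zero_padic_int.rep_eq)
  obtain m n where m: "Rep_padic_int a m \<noteq> 0" and n: "Rep_padic_int b n \<noteq> 0"
    using ex a b by meson
  define s where "s = Rep_padic_int a (m + n)"
  define t where "t = Rep_padic_int b (m + n)"
  have s: "\<not> ?p ^ m dvd s"
    using m padic_component_mod[of a m n] by (auto simp: s_def)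
  have t: "\<not> ?p ^ n dvd t"
    using n padic_component_mod[of b n m] by (auto simp: t_def add.commute)
  have p: "prime ?p"
    by (rule prime_card_int)
  show "a * b \<noteq> 0"
  proof
    assume "a * b = 0"
    then have "(s * t) mod ?p ^ (m + n) = 0"
      by (metis s_def t_def times_padic_int.rep_eq zero_padic_int.rep_eq)
    then have d: "?p ^ (m + n) dvd s * t"
      by auto
    have s0: "s \<noteq> 0" and t0: "t \<noteq> 0"
      using s t by auto
    have "multiplicity ?p s < m" "multiplicity ?p t < n"
      using s t multiplicity_dvd'[of m ?p s] multiplicity_dvd'[of n ?p t] by linarith+
    moreover have "m + n \<le> multiplicity ?p (s * t)"
      using d p s0 t0 by (intro multiplicity_geI) auto
    moreover have "multiplicity ?p (s * t) = multiplicity ?p s + multiplicity ?p t"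
      using p s0 t0 by (intro prime_elem_multiplicity_mult_distrib) auto
    ultimately show False
      by linarith
  qed
qed

definition padic_red :: "'p::prime_card padic_int \<Rightarrow> 'p mod_ring" where
  "padic_red x = of_int (Rep_padic_int x 1)"

section \<open>Adjoining \<open>\<surd>-\<Delta>\<close>\<close>

text \<open>\<open>Quad a b\<close> stands for \<open>a + b \<surd>-\<Delta>\<close>, where \<open>\<Delta> = CARD('d)\<close>.\<close>

datatype ('a, 'd) quad = Quad (qre: 'a) (qim: 'a)

lemma quad_eqI: "qre x = qre y \<Longrightarrow> qim x = qim y \<Longrightarrow> x = y"
  by (rule quad.expand) simp

instantiation quad :: (comm_ring_1, type) comm_ring_1
begin

definition zero_quad :: "('a, 'b) quad" where
  "zero_quad = Quad 0 0"

definition one_quad :: "('a, 'b) quad" where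
  "one_quad = Quad 1 0"

definition plus_quad :: "('a, 'b) quad \<Rightarrow> ('a, 'b) quad \<Rightarrow> ('a, 'b) quad" where
  "plus_quad x y = Quad (qre x + qre y) (qim x + qim y)"

definition uminus_quad :: "('a, 'b) quad \<Rightarrow> ('a, 'b) quad" where
  "uminus_quad x = Quad (- qre x) (- qim x)"

definition minus_quad :: "('a, 'b) quad \<Rightarrow> ('a, 'b) quad \<Rightarrow> ('a, 'b) quad" where
  "minus_quad x y = Quad (qre x - qre y) (qim x - qim y)"

definition times_quad :: "('a, 'b) quad \<Rightarrow> ('a, 'b) quad \<Rightarrow> ('a, 'b) quad" where
  "times_quad x y =
     Quad (qre x * qre y - of_nat CARD('b) * (qim x * qim y)) (qre x * qim y + qim x * qre y)"

instance
  by standard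
    (auto simp: zero_quad_def one_quad_def plus_quad_def uminus_quad_def minus_quad_def
       times_quad_def algebra_simps intro!: quad_eqI)

end

definition qbase :: "'a::zero \<Rightarrow> ('a, 'd) quad" where
  "qbase a = Quad a 0"

definition qroot :: "('a::zero_neq_one, 'd) quad" where
  "qroot = Quad 0 1"

definition qconj :: "('a::uminus, 'd) quad \<Rightarrow> ('a, 'd) quad" where
  "qconj x = Quad (qre x) (- qim x)"

definition qred :: "('p::prime_card padic_int, 'd) quad \<Rightarrow> ('p mod_ring, 'd) quad" where
  "qred x = Quad (padic_red (qre x)) (padic_red (qim x))"

lemma qroot_square: "(qroot :: ('a::comm_ring_1, 'd) quad) * qroot = - of_nat CARD('d)"
proof -
  have "(of_nat n :: ('a, 'd) quad) = Quad (of_nat n) 0" for n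
    by (induction n) (simp_all add: zero_quad_def one_quad_def plus_quad_def)
  then show ?thesis
    by (simp add: qroot_def times_quad_def uminus_quad_def)
qed

section \<open>Inert primes\<close>

definition imag_quadratic_field :: "nat \<Rightarrow> complex set" where
  "imag_quadratic_field D = {of_rat a + of_rat b * csqrt (- of_nat D) | a b. True}"

definition quadratic_integer_ring :: "nat \<Rightarrow> complex ring" where
  "quadratic_integer_ring D =
     \<lparr> carrier = {x \<in> imag_quadratic_field D. algebraic_int x},
       mult = (*), one = 1, zero = 0, add = (+) \<rparr>"

definition inert_prime :: "nat \<Rightarrow> nat \<Rightarrow> bool" where
  "inert_prime p D \<longleftrightarrow>
     primeideal (PIdl\<^bsub>quadratic_integer_ring D\<^esub> (of_nat p)) (quadratic_integer_ring D)"

section \<open>The unitary similitude group and D-equivalence\<close>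

definition sig_mat :: "nat \<Rightarrow> nat \<Rightarrow> 'a::comm_ring_1 mat" where
  "sig_mat g i =
     four_block_mat (1\<^sub>m i) (0\<^sub>m i (g - i)) (0\<^sub>m (g - i) i) (- 1\<^sub>m (g - i))"

definition unitary_form ::
  "nat \<Rightarrow> nat \<Rightarrow> ('a::comm_ring_1, 'd) quad mat \<Rightarrow> ('a, 'd) quad mat" where
  "unitary_form g i M = M * sig_mat g i * transpose_mat (map_mat qconj M)"

definition unitary_similitudes ::
  "nat \<Rightarrow> nat \<Rightarrow> ('p::prime_card padic_int, 'd) quad mat set" where
  "unitary_similitudes g i =
     {M \<in> carrier_mat g g. \<exists>l. l dvd 1 \<and> unitary_form g i M = qbase l \<cdot>\<^sub>m sig_mat g i}"

definition alpha :: "nat \<Rightarrow> nat \<Rightarrow> ('a::comm_ring_1, 'd) quad mat \<Rightarrow> 'a mat" where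
  "alpha g i M =
     (let h = map_mat qre M; k = map_mat qim M; E = sig_mat g i
      in four_block_mat h (k * E) (- of_nat CARD('d) \<cdot>\<^sub>m (E * k)) (E * h * E))"

definition D_equivalent ::
  "'p::prime_card itself \<Rightarrow> 'd itself \<Rightarrow> nat \<Rightarrow> nat \<Rightarrow> int mat \<Rightarrow> int mat \<Rightarrow> bool" where
  "D_equivalent p d g i S1 S2 \<longleftrightarrow>
     (\<exists>M :: ('p padic_int, 'd) quad mat. M \<in> unitary_similitudes g i \<and>
        elements_mat (map_mat of_int S1 * map_mat to_fract (alpha g i M)
            * the (mat_inverse (map_mat of_int S2)))
          \<subseteq> range (to_fract :: 'p padic_int \<Rightarrow> 'p padic_int fract))"

section \<open>The set of representatives\<close>

definition residue_system :: "nat \<Rightarrow> int set \<Rightarrow> bool" where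
  "residue_system m R \<longleftrightarrow> (\<forall>a. \<exists>!r. r \<in> R \<and> [r = a] (mod int m))"

definition S_mat :: "nat \<Rightarrow> nat \<Rightarrow> nat \<Rightarrow> int mat \<Rightarrow> int mat \<Rightarrow> int mat \<Rightarrow> int mat" where
  "S_mat p g i A C U =
     four_block_mat
       (four_block_mat (int p \<cdot>\<^sub>m 1\<^sub>m i) (0\<^sub>m i (g - i)) (- A) (1\<^sub>m (g - i)))
       (four_block_mat (0\<^sub>m i i) (int p \<cdot>\<^sub>m transpose_mat C) C U)
       (0\<^sub>m g g)
       (four_block_mat (int p \<cdot>\<^sub>m 1\<^sub>m i) (int p \<cdot>\<^sub>m transpose_mat A)
          (0\<^sub>m (g - i) i) (int (p\<^sup>2) \<cdot>\<^sub>m 1\<^sub>m (g - i)))"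

text \<open>\<open>R1\<close> and \<open>R2\<close> are the fixed systems of residues modulo \<open>p\<close> and \<open>p\<^sup>2\<close>.\<close>

definition S_open :: "nat \<Rightarrow> int set \<Rightarrow> int set \<Rightarrow> nat \<Rightarrow> nat \<Rightarrow> int mat set" where
  "S_open p R1 R2 g i =
     {S_mat p g i A C U | A C U.
        A \<in> carrier_mat (g - i) i \<and> C \<in> carrier_mat (g - i) i \<and>
        U \<in> carrier_mat (g - i) (g - i) \<and>
        elements_mat A \<subseteq> R1 \<and> elements_mat C \<subseteq> R1 \<and>
        (\<forall>r < g - i. \<forall>c < g - i. r \<le> c \<longrightarrow> U $$ (r, c) \<in> R2) \<and>
        C * transpose_mat A - A * transpose_mat C = U - transpose_mat U}"

text \<open>The blocks \<open>A\<close>, \<open>C\<close>, \<open>U\<close> are read off from the second block row of the matrix.\<close>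

definition A_block :: "nat \<Rightarrow> nat \<Rightarrow> int mat \<Rightarrow> int mat" where
  "A_block g i S = mat (g - i) i (\<lambda>(r, c). - S $$ (i + r, c))"

definition C_block :: "nat \<Rightarrow> nat \<Rightarrow> int mat \<Rightarrow> int mat" where
  "C_block g i S = mat (g - i) i (\<lambda>(r, c). S $$ (i + r, g + c))"

definition U_block :: "nat \<Rightarrow> nat \<Rightarrow> int mat \<Rightarrow> int mat" where
  "U_block g i S = mat (g - i) (g - i) (\<lambda>(r, c). S $$ (i + r, g + i + c))"

lemma blocks_S_mat:
  assumes "i \<le> g" "A \<in> carrier_mat (g - i) i" "C \<in> carrier_mat (g - i) i"
    "U \<in> carrier_mat (g - i) (g - i)"
  shows "A_block g i (S_mat p g i A C U) = A"
    and "C_block g i (S_mat p g i A C U) = C"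
    and "U_block g i (S_mat p g i A C U) = U"
  using assms
  by (auto intro!: eq_matI simp: A_block_def C_block_def U_block_def S_mat_def)

section \<open>The decomposition into the sets \<open>D j\<close>\<close>

definition mu1 :: "nat \<Rightarrow> nat \<Rightarrow> int mat \<Rightarrow> ('a::comm_ring_1, 'd) quad mat" where
  "mu1 g i S =
     (let A = map_mat of_int (A_block g i S); C = map_mat of_int (C_block g i S);
          U = map_mat of_int (U_block g i S)
      in four_block_mat (- 1\<^sub>m i) (- (qroot \<cdot>\<^sub>m transpose_mat C))
           (A + qroot \<cdot>\<^sub>m C) (- 1\<^sub>m (g - i) - qroot \<cdot>\<^sub>m U))"

definition mu2 :: "nat \<Rightarrow> nat \<Rightarrow> int mat \<Rightarrow> ('a::comm_ring_1, 'd) quad mat" where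
  "mu2 g i S =
     (let A = map_mat of_int (A_block g i S); C = map_mat of_int (C_block g i S);
          U = map_mat of_int (U_block g i S)
      in four_block_mat (qroot \<cdot>\<^sub>m 1\<^sub>m i) (- (qroot \<cdot>\<^sub>m transpose_mat A))
           (A + qroot \<cdot>\<^sub>m C) (- 1\<^sub>m (g - i) - qroot \<cdot>\<^sub>m U))"

text \<open>
  \<open>X1_im_rank g i M N j\<close>: in \<open>N = (X\<^sub>1 X\<^sub>2; 0 1) M\<close> the imaginary part of \<open>X\<^sub>1 mod p\<close> has rank \<open>j\<close>.
  It is only used when \<open>M\<close> is invertible, and then \<open>X\<^sub>1\<close> and \<open>X\<^sub>2\<close> are unique.
\<close>

definition X1_im_rank ::
  "nat \<Rightarrow> nat \<Rightarrow> ('p::prime_card padic_int, 'd) quad mat \<Rightarrow> ('p padic_int, 'd) quad mat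
     \<Rightarrow> nat \<Rightarrow> bool" where
  "X1_im_rank g i M N j \<longleftrightarrow>
     (\<exists>X1 X2. X1 \<in> carrier_mat i i \<and> X2 \<in> carrier_mat i (g - i) \<and>
        N = four_block_mat X1 X2 (0\<^sub>m (g - i) i) (1\<^sub>m (g - i)) * M \<and>
        vec_space.rank i (map_mat qim (map_mat qred X1)) = j)"

definition D_set ::
  "'p::prime_card itself \<Rightarrow> 'd itself \<Rightarrow> int set \<Rightarrow> int set \<Rightarrow> nat \<Rightarrow> nat \<Rightarrow> nat \<Rightarrow> int mat set" where
  "D_set p d R1 R2 g i j =
     {S \<in> S_open CARD('p) R1 R2 g i.
        let m1 = mu1 g i S :: ('p padic_int, 'd) quad mat; m2 = mu2 g i S
        in (det (map_mat qred m1) \<noteq> 0 \<and> X1_im_rank g i m1 m2 j) \<or>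
           (det (map_mat qred m1) = 0 \<and> det (map_mat qred m2) \<noteq> 0 \<and> X1_im_rank g i m2 m1 j)}"

definition G22_quad :: "nat \<Rightarrow> nat \<Rightarrow> int mat \<Rightarrow> ('a::comm_ring_1, 'd) quad mat" where
  "G22_quad g i S =
     (let G = unitary_form g i (mu1 g i S)
      in mat (g - i) (g - i) (\<lambda>(r, c). G $$ (i + r, i + c)))"

text \<open>
  On \<open>S_open\<close> the block \<open>G\<^sub>2\<^sub>2\<close> has entries in \<open>\<int>\<^sub>p\<close> (lemma \<open>G22_base\<close> below), so taking \<open>qre\<close>
  only changes its type.
\<close>

definition G22 ::
  "'p::prime_card itself \<Rightarrow> 'd itself \<Rightarrow> nat \<Rightarrow> nat \<Rightarrow> int mat \<Rightarrow> 'p padic_int mat" where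
  "G22 p d g i S = map_mat qre (G22_quad g i S :: ('p padic_int, 'd) quad mat)"

lemma quad_sel [simp]:
  "qre (0 :: ('a::comm_ring_1, 'd) quad) = 0" "qim (0 :: ('a, 'd) quad) = 0"
  "qre (1 :: ('a, 'd) quad) = 1" "qim (1 :: ('a, 'd) quad) = 0"
  "qre (x + y :: ('a, 'd) quad) = qre x + qre y" "qim (x + y) = qim x + qim y"
  "qre (x - y :: ('a, 'd) quad) = qre x - qre y" "qim (x - y) = qim x - qim y"
  "qre (- x :: ('a, 'd) quad) = - qre x" "qim (- x) = - qim x"
  "qre (x * y :: ('a, 'd) quad) = qre x * qre y - of_nat CARD('d) * (qim x * qim y)"
  "qim (x * y) = qre x * qim y + qim x * qre y"
  "qre (qconj x) = qre x" "qim (qconj x) = - qim x"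
  "qre (qroot :: ('a, 'd) quad) = 0" "qim (qroot :: ('a, 'd) quad) = 1"
  by (simp_all add: zero_quad_def one_quad_def plus_quad_def minus_quad_def uminus_quad_def
      times_quad_def qconj_def qroot_def)

lemma quad_sel_of_nat [simp]:
  "qre (of_nat n :: ('a::comm_ring_1, 'd) quad) = of_nat n"
  "qim (of_nat n :: ('a::comm_ring_1, 'd) quad) = 0"
  by (induction n) simp_all

lemma quad_sel_of_int [simp]:
  "qre (of_int n :: ('a::comm_ring_1, 'd) quad) = of_int n"
  "qim (of_int n :: ('a::comm_ring_1, 'd) quad) = 0"
  by (cases n rule: int_cases2; simp)+

lemma qim_sum: "qim (\<Sum>k\<in>K. f k :: ('a::comm_ring_1, 'd) quad) = (\<Sum>k\<in>K. qim (f k))"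
  by (induction K rule: infinite_finite_induct) simp_all

lemma qim_mult_transpose:
  fixes X Y :: "('a::comm_ring_1, 'd) quad mat"
  assumes "X \<in> carrier_mat n m" "Y \<in> carrier_mat n m" "r < n" "c < n"
  shows "qim ((X * transpose_mat Y) $$ (r, c)) = (\<Sum>k<m. qim (X $$ (r, k) * Y $$ (c, k)))"
  using assms by (simp add: scalar_prod_def qim_sum atLeast0LessThan del: quad_sel)

lemma G22_base:
  assumes "i \<le> g" and "S \<in> S_open p R1 R2 g i"
  shows "map_mat qim (G22_quad g i S :: ('a::comm_ring_1, 'd) quad mat) = 0\<^sub>m (g - i) (g - i)"
proof (rule eq_matI)
  fix r c
  assume "r < dim_row (0\<^sub>m (g - i) (g - i))" "c < dim_col (0\<^sub>m (g - i) (g - i))"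
  then have r: "r < g - i" and c: "c < g - i"
    by simp_all
  obtain A C U where S: "S = S_mat p g i A C U"
    and A: "A \<in> carrier_mat (g - i) i" and C: "C \<in> carrier_mat (g - i) i"
    and U: "U \<in> carrier_mat (g - i) (g - i)"
    and rel: "C * transpose_mat A - A * transpose_mat C = U - transpose_mat U"
    using assms(2) unfolding S_open_def by (elim CollectE exE conjE) (rule that)
  let ?E = "sig_mat g i :: ('a, 'd) quad mat"
  let ?K = "map_mat of_int :: int mat \<Rightarrow> ('a, 'd) quad mat"
  let ?M11 = "- 1\<^sub>m i :: ('a, 'd) quad mat"
  let ?M12 = "- (qroot \<cdot>\<^sub>m transpose_mat (?K C))"
  let ?M21 = "?K A + qroot \<cdot>\<^sub>m ?K C"
  let ?M22 = "- 1\<^sub>m (g - i) - qroot \<cdot>\<^sub>m ?K U"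
  let ?M = "four_block_mat ?M11 ?M12 ?M21 ?M22"
  have M: "mu1 g i S = ?M"
    unfolding mu1_def Let_def S blocks_S_mat[OF assms(1) A C U] by (rule refl)
  have car: "?M11 \<in> carrier_mat i i" "?M12 \<in> carrier_mat i (g - i)"
    "?M21 \<in> carrier_mat (g - i) i" "?M22 \<in> carrier_mat (g - i) (g - i)"
    using A C U by auto
  have ME: "?M * ?E = four_block_mat ?M11 (- ?M12) ?M21 (- ?M22)"
    unfolding sig_mat_def using A C U
    by (subst mult_four_block_mat[OF car]) auto
  have T: "transpose_mat (map_mat qconj ?M) =
      four_block_mat (transpose_mat (map_mat qconj ?M11)) (transpose_mat (map_mat qconj ?M21))
        (transpose_mat (map_mat qconj ?M12)) (transpose_mat (map_mat qconj ?M22))"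
    using A C U by (intro eq_matI) auto
  have delta: "(\<Sum>k<g - i. (if k = r then U $$ (c, k) else 0) - (if k = c then U $$ (r, k) else 0)) =
      U $$ (c, r) - U $$ (r, c)"
    using r c by (simp add: sum_subtractf)
  have P1: "qim ((?M21 * transpose_mat (map_mat qconj ?M21)) $$ (r, c)) =
      (\<Sum>k<i. of_int (C $$ (r, k) * A $$ (c, k) - A $$ (r, k) * C $$ (c, k)))"
    using A C r c
    by (simp add: scalar_prod_def qim_sum atLeast0LessThan)
  have carN: "- ?M22 \<in> carrier_mat (g - i) (g - i)"
    and carN': "map_mat qconj ?M22 \<in> carrier_mat (g - i) (g - i)"
    using U by auto
  have P2: "qim (((- ?M22) * transpose_mat (map_mat qconj ?M22)) $$ (r, c)) =
      (\<Sum>k<g - i. of_int ((if k = r then U $$ (c, k) else 0) - (if k = c then U $$ (r, k) else 0)))"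
    unfolding qim_mult_transpose[OF carN carN' r c]
    using U r c by (intro sum.cong) auto
  have "unitary_form g i ?M $$ (i + r, i + c) =
      (?M21 * transpose_mat (map_mat qconj ?M21)
        + (- ?M22) * transpose_mat (map_mat qconj ?M22)) $$ (r, c)"
    unfolding unitary_form_def ME T using A C U r c
    by (subst mult_four_block_mat[of _ i i _ "g - i" _ "g - i" _ _ i _ "g - i"]) auto
  also have "qim \<dots> =
      (\<Sum>k<i. of_int (C $$ (r, k) * A $$ (c, k) - A $$ (r, k) * C $$ (c, k)))
      + (\<Sum>k<g - i. of_int ((if k = r then U $$ (c, k) else 0) - (if k = c then U $$ (r, k) else 0)))"
    unfolding P1[symmetric] P2[symmetric]
    by (subst index_add_mat) (use A C U r c in auto)
  also have "\<dots> = of_int ((\<Sum>k<i. C $$ (r, k) * A $$ (c, k) - A $$ (r, k) * C $$ (c, k))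
      + (U $$ (c, r) - U $$ (r, c)))"
    unfolding of_int_sum[symmetric] of_int_add[symmetric] delta ..
  also have "(\<Sum>k<i. C $$ (r, k) * A $$ (c, k) - A $$ (r, k) * C $$ (c, k)) =
      (C * transpose_mat A - A * transpose_mat C) $$ (r, c)"
    using A C r c by (simp add: scalar_prod_def atLeast0LessThan sum_subtractf)
  also have "\<dots> = U $$ (r, c) - U $$ (c, r)"
    unfolding rel using U r c by simp
  finally have "qim (unitary_form g i ?M $$ (i + r, i + c)) = 0"
    by simp
  then show "map_mat qim (G22_quad g i S :: ('a, 'd) quad mat) $$ (r, c) = 0\<^sub>m (g - i) (g - i) $$ (r, c)"
    using r c by (simp add: G22_quad_def Let_def M)
qed (simp_all add: G22_quad_def Let_def)

end

theory Submission
  imports Defs "HOL-Number_Theory.Cong"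
begin

text \<open>
  Write \<open>\<omega> = \<surd>-\<Delta>\<close>.  A row \<open>(x, y)\<close> over \<open>\<int>\<^sub>p\<close> of length \<open>2g\<close> is read as the vector \<open>x + \<omega> y E\<close> of
  length \<open>g\<close> over \<open>\<int>\<^sub>p[\<omega>]\<close>.  Then right multiplication by \<open>\<alpha>(M)\<close> becomes right multiplication by
  \<open>M\<close>, and the standard symplectic form becomes, up to sign, the imaginary part of the hermitian
  form defined by \<open>E\<close>.  For a representative \<open>\<sigma>\<close> one has \<open>\<sigma> J \<sigma>\<^sup>t = p\<^sup>2 J\<close> with \<open>J\<close> the symplectic
  matrix, so \<open>\<sigma>\<^sub>1 \<alpha>(M) \<sigma>\<^sub>2\<^sup>-\<^sup>1\<close> is integral iff all imaginary parts \<open>Im \<langle>r M, s\<rangle>\<close>, for \<open>r\<close> a row of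
  \<open>\<sigma>\<^sub>1\<close> and \<open>s\<close> a row of \<open>\<sigma>\<^sub>2\<close>, are divisible by \<open>p\<^sup>2\<close>.

  All rows of \<open>\<sigma>\<close> outside the second block row are divisible by \<open>p\<close>.  The rows of the second block
  row form a matrix \<open>B\<close> whose hermitian Gram matrix is the real symmetric matrix \<open>G\<^sub>2\<^sub>2(\<sigma>)\<close>.  On the
  stratum considered here \<open>G\<^sub>2\<^sub>2\<close> is invertible modulo \<open>p\<close>: the relation \<open>\<mu>\<^sub>2 = (X\<^sub>1 X\<^sub>2; 0 1) \<mu>\<^sub>1\<close>
  gives \<open>Im X\<^sub>1 G\<^sub>1\<^sub>2 + Im X\<^sub>2 G\<^sub>2\<^sub>2 = 0\<close>, so that, \<open>Im X\<^sub>1\<close> being invertible, a kernel vector of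
  \<open>G\<^sub>2\<^sub>2\<close> would be one of the invertible matrix \<open>G\<close> (\<open>D_set_nondegenerate\<close>).

  If \<open>\<sigma>\<^sub>1\<close> and \<open>\<sigma>\<^sub>2\<close> are D-equivalent through \<open>M\<close> with multiplier \<open>\<lambda>\<close>, then modulo \<open>p\<close> only the
  second block rows survive, hence \<open>B\<^sub>1 M \<equiv> T B\<^sub>2\<close> with \<open>T\<close> over \<open>\<bbbF>\<^sub>p\<close>, and comparing Gram matrices
  gives \<open>\<lambda> G\<^sub>2\<^sub>2(\<sigma>\<^sub>1) = T G\<^sub>2\<^sub>2(\<sigma>\<^sub>2) T\<^sup>t\<close> modulo \<open>p\<close> (\<open>similar_G22_of_D_equivalent\<close>).  Determinants
  yield the condition for even \<open>g - \<ii>\<close>.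

  Conversely, unimodular quadratic forms over \<open>\<int>\<^sub>p\<close> are classified by rank and determinant modulo
  squares (\<open>padic_symmetric_forms_equivalent\<close>), which provides \<open>T\<close> with
  \<open>\<lambda> G\<^sub>2\<^sub>2(\<sigma>\<^sub>1) = T G\<^sub>2\<^sub>2(\<sigma>\<^sub>2) T\<^sup>t\<close>, where \<open>\<lambda> = 1\<close> does for even rank, and for odd rank \<open>\<lambda>\<close> is chosen
  so as to repair the determinant.  Since all unimodular hermitian forms over \<open>\<int>\<^sub>p[\<omega>]\<close> of the same
  rank are isometric, norms being surjective on units, Witt's argument extends \<open>B\<^sub>1 \<mapsto> T B\<^sub>2\<close> to a
  similitude \<open>M\<close> (\<open>similitude_carrying\<close>).  Its imaginary parts satisfy the divisibility above
  because \<open>T\<close> is real (\<open>D_equivalent_of_similar_G22\<close>).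
\<close>

section \<open>The ring of p-adic integers\<close>

lemma padic_eqI:
  "(\<And>n. Rep_padic_int x n = Rep_padic_int y n) \<Longrightarrow> (x :: 'p padic_int) = y"
  by (metis Rep_padic_int_inject ext)

lemmas padic_rep = zero_padic_int.rep_eq one_padic_int.rep_eq plus_padic_int.rep_eq
    uminus_padic_int.rep_eq minus_padic_int.rep_eq times_padic_int.rep_eq

lemma padic_rep_mod_self:
  "Rep_padic_int (x :: 'p padic_int) n mod int CARD('p) ^ n = Rep_padic_int x n"
  using padic_component_mod[of x n 0] by simp

lemma padic_rep_cong:
  "m \<le> n \<Longrightarrow> [Rep_padic_int (x :: 'p padic_int) n = Rep_padic_int x m] (mod int CARD('p) ^ m)"
  using padic_component_mod[of x m "n - m"] by (simp add: cong_def)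

text \<open>
  Inverses and square roots are obtained below as limits of integers that solve the equation modulo
  \<open>p\<^sup>n\<close>.
\<close>

lemma padic_of_coherent_sequence:
  assumes "\<And>n. [a (Suc n) = a n] (mod int CARD('p) ^ n)"
  obtains x :: "'p padic_int" where "\<And>n. [Rep_padic_int x n = a n] (mod int CARD('p) ^ n)"
proof -
  let ?f = "\<lambda>n. a n mod int CARD('p) ^ n"
  have "?f \<in> {x. \<forall>n. x n = x (Suc n) mod int CARD('p) ^ n}"
    using assms by (simp only: cong_def padic_mod_Suc mem_Collect_eq) simp
  then have "Rep_padic_int (Abs_padic_int ?f :: 'p padic_int) = ?f"
    by (rule Abs_padic_int_inverse)
  then show thesis
    by (intro that[of "Abs_padic_int ?f"]) simp
qed

lemma of_int_mod_ring_eq_iff: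
  "(of_int a :: 'p::prime_card mod_ring) = of_int b \<longleftrightarrow> [a = b] (mod int CARD('p))"
  by (simp add: of_int_eq_iff_cong_CHAR)

lemma of_int_mod_ring_mod [simp]:
  "(of_int (a mod int CARD('p)) :: 'p::prime_card mod_ring) = of_int a"
  by (simp add: of_int_mod_ring_eq_iff)

lemma padic_red_hom:
  "padic_red (0 :: 'p::prime_card padic_int) = 0" "padic_red (1 :: 'p padic_int) = 1"
  "padic_red (x + y :: 'p padic_int) = padic_red x + padic_red y"
  "padic_red (x * y) = padic_red x * padic_red y"
  by (simp_all add: padic_red_def padic_rep)

interpretation padic_red: comm_ring_hom "padic_red :: 'p::prime_card padic_int \<Rightarrow> 'p mod_ring"
  by unfold_locales (simp_all add: padic_red_hom)

lemma padic_red_of_coherent: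
  assumes "[Rep_padic_int (x :: 'p::prime_card padic_int) 1 = a] (mod int CARD('p))"
  shows "padic_red x = of_int a"
  using assms by (simp add: padic_red_def of_int_mod_ring_eq_iff)

lemma padic_rep_coprime:
  assumes "padic_red (x :: 'p::prime_card padic_int) \<noteq> 0" "0 < n"
  shows "coprime (Rep_padic_int x n) (int CARD('p))"
proof -
  have "\<not> [Rep_padic_int x 1 = 0] (mod int CARD('p))"
    using assms(1) of_int_mod_ring_eq_iff[of "Rep_padic_int x 1" 0, where 'p='p]
    by (simp add: padic_red_def)
  moreover have "[Rep_padic_int x n = Rep_padic_int x 1] (mod int CARD('p))"
    using padic_rep_cong[of 1 n x] assms(2) by simp
  ultimately have "\<not> int CARD('p) dvd Rep_padic_int x n"
    by (metis cong_0_iff cong_sym cong_trans)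
  then show ?thesis
    using prime_imp_coprime[OF prime_card_int] coprime_commute by blast
qed

text \<open>
  An inverse modulo \<open>p\<^sup>n\<close> exists for every \<open>n\<close>, and its uniqueness makes these inverses coherent.
\<close>

lemma padic_unit_iff: "(x :: 'p::prime_card padic_int) dvd 1 \<longleftrightarrow> padic_red x \<noteq> 0"
proof
  assume "x dvd 1"
  then obtain y where "1 = x * y" ..
  then have "padic_red x * padic_red y = 1"
    by (metis padic_red.hom_mult padic_red.hom_one)
  then show "padic_red x \<noteq> 0"
    by auto
next
  assume x: "padic_red x \<noteq> 0"
  let ?p = "int CARD('p)"
  have "\<exists>b. [Rep_padic_int x n * b = 1] (mod ?p ^ n)" for n
  proof (cases "n = 0")
    case False
    then show ?thesis
      using padic_rep_coprime[OF x] by (intro cong_solve_coprime_int) simp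
  qed simp
  then obtain b where b: "\<And>n. [Rep_padic_int x n * b n = 1] (mod ?p ^ n)"
    by metis
  have "[b (Suc n) = b n] (mod ?p ^ n)" for n
  proof -
    have "[Rep_padic_int x (Suc n) * b (Suc n) = 1] (mod ?p ^ n)"
      using b[of "Suc n"] by (rule cong_dvd_modulus) (simp add: le_imp_power_dvd)
    moreover have "[Rep_padic_int x (Suc n) * b (Suc n) = Rep_padic_int x n * b (Suc n)] (mod ?p ^ n)"
      by (intro cong_mult padic_rep_cong) auto
    ultimately have 1: "[Rep_padic_int x n * b (Suc n) = 1] (mod ?p ^ n)"
      by (metis cong_sym cong_trans)
    have "[b n * (Rep_padic_int x n * b (Suc n)) = b n * 1] (mod ?p ^ n)"
      by (intro cong_mult 1) auto
    moreover have "[b (Suc n) * (Rep_padic_int x n * b n) = b (Suc n) * 1] (mod ?p ^ n)"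
      by (intro cong_mult b) auto
    ultimately show ?thesis
      by (simp add: cong_def mult.left_commute mult.commute)
  qed
  then obtain y :: "'p padic_int" where y: "\<And>n. [Rep_padic_int y n = b n] (mod ?p ^ n)"
    using padic_of_coherent_sequence by metis
  have "x * y = 1"
  proof (rule padic_eqI)
    fix n
    have "[Rep_padic_int x n * Rep_padic_int y n = Rep_padic_int x n * b n] (mod ?p ^ n)"
      by (intro cong_mult y) auto
    then have "[Rep_padic_int x n * Rep_padic_int y n = 1] (mod ?p ^ n)"
      using b cong_trans by blast
    then show "Rep_padic_int (x * y) n = Rep_padic_int (1 :: 'p padic_int) n"
      by (simp add: padic_rep cong_def)
  qed
  then show "x dvd 1"
    by (metis dvd_triv_left)
qed

text \<open>
  Newton's correction: with \<open>t\<close> an inverse of \<open>2 a\<close>, the term linear in the correction cancels the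
  error of \<open>a\<close>, while the quadratic one is divisible by \<open>p\<^sup>2\<^sup>n\<close>.
\<close>

lemma Hensel_square_step:
  fixes p u a :: int
  assumes "prime p" "odd p" "\<not> p dvd a" "[a\<^sup>2 = u] (mod p ^ n)" "0 < n"
  shows "\<exists>b. [b\<^sup>2 = u] (mod p ^ Suc n) \<and> [b = a] (mod p ^ n)"
proof -
  obtain c where c: "u - a\<^sup>2 = p ^ n * c"
    using assms(4) by (metis cong_iff_dvd_diff cong_sym dvdE)
  have "coprime (2 * a) p"
    using assms(1-3) by (metis coprime_commute dvd_refl even_mult_iff prime_dvd_mult_iff prime_imp_coprime
        primes_dvd_imp_eq two_is_prime_nat prime_int_numeral_eq)
  then obtain t where t: "[2 * a * t = 1] (mod p)"
    using cong_solve_coprime_int by blast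
  define b where "b = a + p ^ n * (c * t)"
  obtain e where e: "2 * a * t = 1 + p * e"
    using t by (metis cong_iff_lin cong_sym mult.commute)
  have "p ^ Suc n dvd p ^ n * p ^ n"
    using assms(5) by (subst power_add[symmetric], intro le_imp_power_dvd) simp
  then obtain f where f: "p ^ n * p ^ n = p ^ Suc n * f"
    by (rule dvdE)
  have "b\<^sup>2 = a\<^sup>2 + p ^ n * c * (2 * a * t) + p ^ n * p ^ n * (c * t)\<^sup>2"
    by (simp add: b_def power2_eq_square algebra_simps)
  also have "\<dots> = u + p ^ Suc n * (c * e + f * (c * t)\<^sup>2)"
    unfolding e f using c by (simp add: algebra_simps)
  finally have "[b\<^sup>2 = u] (mod p ^ Suc n)"
    by (simp add: cong_iff_dvd_diff)
  moreover have "[b = a] (mod p ^ n)"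
    by (simp add: b_def cong_iff_dvd_diff)
  ultimately show ?thesis
    by blast
qed

lemma padic_square_root:
  fixes u :: "'p::prime_card padic_int"
  assumes "odd CARD('p)" "padic_red u = c\<^sup>2" "c \<noteq> 0"
  obtains x where "x\<^sup>2 = u" "padic_red x = c"
proof -
  let ?p = "int CARD('p)"
  let ?P = "\<lambda>n a. [a\<^sup>2 = Rep_padic_int u (Suc n)] (mod ?p ^ Suc n) \<and> \<not> ?p dvd a \<and> of_int a = c"
  obtain a where a: "of_int a = c"
    by (metis of_int_of_nat_eq surj_of_nat_mod_ring)
  have na: "\<not> ?p dvd b" if "of_int b = c" for b
    using that assms(3) of_int_mod_ring_eq_iff[of b 0, where 'p='p] by (auto simp: cong_0_iff)
  have "of_int (a\<^sup>2) = (of_int (Rep_padic_int u 1) :: 'p mod_ring)"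
    using a assms(2) by (simp add: padic_red_def)
  then have P0: "?P 0 a"
    using a na[OF a] unfolding of_int_mod_ring_eq_iff by simp
  have "\<exists>b. ?P (Suc n) b \<and> [b = a] (mod ?p ^ Suc n)" if a: "?P n a" for n a
  proof -
    have "[a\<^sup>2 = Rep_padic_int u (Suc (Suc n))] (mod ?p ^ Suc n)"
      using a padic_rep_cong[of "Suc n" "Suc (Suc n)" u] by (meson cong_sym cong_trans le_Suc_eq)
    then obtain b where b: "[b\<^sup>2 = Rep_padic_int u (Suc (Suc n))] (mod ?p ^ Suc (Suc n))"
      "[b = a] (mod ?p ^ Suc n)"
      using Hensel_square_step[of ?p a "Rep_padic_int u (Suc (Suc n))" "Suc n"] a
        prime_card_int[where 'a='p] assms(1) by auto
    from b(2) have "[b = a] (mod ?p)"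
      by (rule cong_dvd_modulus) simp
    then have "of_int b = c"
      using that of_int_mod_ring_eq_iff[of b a, where 'p='p] by simp
    then show ?thesis
      using b na by blast
  qed
  then obtain s where s: "\<And>n. ?P n (s n)" "\<And>n. [s (Suc n) = s n] (mod ?p ^ Suc n)"
    using dependent_nat_choice[of ?P "\<lambda>n a b. [b = a] (mod ?p ^ Suc n)"] P0 by metis
  \<comment> \<open>\<open>s n\<close> solves the equation modulo \<open>p\<close> to the power \<open>n + 1\<close>, whereas component \<open>n\<close> lives modulo \<open>p\<^sup>n\<close>.\<close>
  define b where "b n = (if n = 0 then s 0 else s (n - 1))" for n
  have "[b (Suc n) = b n] (mod ?p ^ n)" for n
    by (cases n) (use s(2) in \<open>auto simp: b_def\<close>)
  then obtain x :: "'p padic_int" where x: "\<And>n. [Rep_padic_int x n = b n] (mod ?p ^ n)"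
    using padic_of_coherent_sequence by metis
  have "x\<^sup>2 = u"
  proof (rule padic_eqI)
    fix n
    have "[(Rep_padic_int x n)\<^sup>2 = (b n)\<^sup>2] (mod ?p ^ n)"
      by (intro cong_pow x)
    moreover have "[(b n)\<^sup>2 = Rep_padic_int u n] (mod ?p ^ n)"
      by (cases n) (use s(1) in \<open>auto simp: b_def\<close>)
    ultimately have "[(Rep_padic_int x n)\<^sup>2 = Rep_padic_int u n] (mod ?p ^ n)"
      by (rule cong_trans)
    then show "Rep_padic_int (x\<^sup>2) n = Rep_padic_int u n"
      by (simp add: power2_eq_square padic_rep cong_def padic_rep_mod_self)
  qed
  moreover have "padic_red x = c"
    using x[of 1] s(1)[of 0] padic_red_of_coherent[of x "b 1"] by (simp add: b_def)
  ultimately show thesis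
    by (rule that)
qed

lemma mod_ring_two_neq_0:
  assumes "odd CARD('p::prime_card)"
  shows "(2 :: 'p mod_ring) \<noteq> 0"
proof
  assume "(2 :: 'p mod_ring) = 0"
  then have "CARD('p) dvd 2"
    by (intro of_nat_0_mod_ring_dvd) simp
  then have "CARD('p) = 2"
    by (rule primes_dvd_imp_eq[OF prime_card two_is_prime_nat])
  then show False
    using assms by simp
qed

text \<open>
  Counting: there are \<open>(p + 1) / 2\<close> squares, so the sets of values of \<open>\<alpha> x\<^sup>2\<close> and of \<open>\<gamma> - \<beta> y\<^sup>2\<close> must
  meet.
\<close>

lemma mod_ring_binary_form_universal:
  fixes \<alpha> \<beta> \<gamma> :: "'p::prime_card mod_ring"
  assumes "odd CARD('p)" "\<alpha> \<noteq> 0" "\<beta> \<noteq> 0"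
  obtains x y where "\<alpha> * x\<^sup>2 + \<beta> * y\<^sup>2 = \<gamma>"
proof -
  let ?p = "int CARD('p)"
  \<comment> \<open>One representative of each pair \<open>\<plusminus>k\<close>, so that squaring is injective.\<close>
  let ?I = "{0 .. (?p - 1) div 2}"
  let ?sq = "\<lambda>k. (of_int k :: 'p mod_ring)\<^sup>2"
  have inj: "inj_on ?sq ?I"
  proof (rule inj_onI)
    fix k l
    assume k: "k \<in> ?I" and l: "l \<in> ?I" and "?sq k = ?sq l"
    then have "(of_int k - of_int l :: 'p mod_ring) * (of_int k + of_int l) = 0"
      by (simp add: power2_eq_square algebra_simps)
    then have "of_int (k - l) = (of_int 0 :: 'p mod_ring) \<or> of_int (k + l) = (of_int 0 :: 'p mod_ring)"
      by simp
    then have "?p dvd k - l \<or> ?p dvd k + l"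
      unfolding of_int_mod_ring_eq_iff cong_0_iff .
    moreover have "\<bar>k - l\<bar> < ?p" "\<bar>k + l\<bar> < ?p"
      using k l by auto
    ultimately have "k - l = 0 \<or> k + l = 0"
      by (metis dvd_imp_le_int linorder_not_less abs_of_nat)
    then show "k = l"
      using k l by auto
  qed
  define V where "V = (\<lambda>k. \<alpha> * ?sq k) ` ?I"
  define W where "W = (\<lambda>k. \<gamma> - \<beta> * ?sq k) ` ?I"
  have "inj_on (\<lambda>k. \<alpha> * ?sq k) ?I" "inj_on (\<lambda>k. \<gamma> - \<beta> * ?sq k) ?I"
    using assms inj unfolding inj_on_def by simp_all
  then have "card V = card ?I" "card W = card ?I"
    unfolding V_def W_def by (simp_all only: card_image)
  moreover have "card V + card W \<le> CARD('p)" if "V \<inter> W = {}"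
    using card_Un_disjoint[OF _ _ that] card_mono[of UNIV "V \<union> W"] by (simp add: V_def W_def)
  moreover have "2 * card ?I = CARD('p) + 1"
    using assms(1) by (auto elim!: oddE)
  ultimately have "V \<inter> W \<noteq> {}"
    by linarith
  then obtain k l where "\<alpha> * ?sq k = \<gamma> - \<beta> * ?sq l"
    unfolding V_def W_def by auto
  then show thesis
    by (intro that[of "of_int k" "of_int l"]) simp
qed

lemma padic_red_surj: "\<exists>x :: 'p::prime_card padic_int. padic_red x = c"
proof -
  obtain n where "c = of_nat n"
    using surj_of_nat_mod_ring by blast
  then show ?thesis
    by (metis padic_red.hom_of_nat)
qed

text \<open>
  A solution modulo \<open>p\<close> has a nonzero coordinate; the other one is lifted arbitrarily, and then the
  nonzero one is a square root given by Hensel's lemma.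
\<close>

lemma padic_binary_form_universal:
  fixes \<alpha> \<beta> \<gamma> :: "'p::prime_card padic_int"
  assumes odd: "odd CARD('p)" and "\<alpha> dvd 1" "\<beta> dvd 1" "\<gamma> dvd 1"
  obtains x y where "\<alpha> * x\<^sup>2 + \<beta> * y\<^sup>2 = \<gamma>"
proof -
  have lift: "\<exists>x y. \<alpha> * x\<^sup>2 + \<beta> * y\<^sup>2 = \<gamma>"
    if \<alpha>: "\<alpha> dvd 1" and xy: "padic_red \<alpha> * x\<^sup>2 + padic_red \<beta> * y\<^sup>2 = padic_red \<gamma>" and x: "x \<noteq> 0"
    for \<alpha> \<beta> :: "'p padic_int" and x y
  proof -
    obtain y' where y': "padic_red y' = y"
      using padic_red_surj by blast
    from \<alpha> obtain \<alpha>' where "1 = \<alpha> * \<alpha>'" ..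
    then have \<alpha>': "\<alpha> * \<alpha>' = 1"
      by (rule sym)
    then have "padic_red \<alpha> * padic_red \<alpha>' = 1"
      by (metis padic_red.hom_mult padic_red.hom_one)
    then have "padic_red (\<alpha>' * (\<gamma> - \<beta> * y'\<^sup>2)) = x\<^sup>2"
      using y' by (simp add: padic_red.hom_mult padic_red.hom_minus padic_red.hom_power
          flip: xy) (simp add: mult.assoc[symmetric] mult.commute)
    then obtain x' where "x'\<^sup>2 = \<alpha>' * (\<gamma> - \<beta> * y'\<^sup>2)"
      using padic_square_root[OF odd _ x] by metis
    then have "\<alpha> * x'\<^sup>2 = \<gamma> - \<beta> * y'\<^sup>2"
      using \<alpha>' by (simp add: mult.assoc[symmetric])
    then show ?thesis
      by (intro exI[of _ x'] exI[of _ y']) simp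
  qed
  obtain x y where xy: "padic_red \<alpha> * x\<^sup>2 + padic_red \<beta> * y\<^sup>2 = padic_red \<gamma>"
    using mod_ring_binary_form_universal[OF odd] assms by (metis padic_unit_iff)
  have "x \<noteq> 0 \<or> y \<noteq> 0"
    using xy assms(4) by (auto simp: padic_unit_iff)
  then show thesis
    using lift[OF assms(2) xy] lift[OF assms(3), of y \<alpha> x] xy that by (metis add.commute)
qed

lemma padic_rep_of_nat: "Rep_padic_int (of_nat k :: 'p::prime_card padic_int) n = int k mod int CARD('p) ^ n"
  by (induction k) (simp_all add: padic_rep mod_add_right_eq add.commute)

lemma padic_prime_neq_0: "(of_nat CARD('p) :: 'p::prime_card padic_int) \<noteq> 0"
proof
  assume "(of_nat CARD('p) :: 'p padic_int) = 0"
  then have "int CARD('p) mod int CARD('p) ^ 2 = 0"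
    using padic_rep_of_nat[of "CARD('p)" 2, where 'p='p] by (simp add: padic_rep)
  moreover have "1 < CARD('p)"
    using prime_card[where 'a='p] by (rule prime_gt_1_nat)
  ultimately show False
    by (simp add: power2_eq_square)
qed

lemma padic_red_prime_dvd:
  assumes "(of_nat CARD('p) :: 'p::prime_card padic_int) dvd x"
  shows "padic_red x = 0"
  using assms by (auto simp: hom_distribs elim!: dvdE)

section \<open>Inertness and the quadratic extension\<close>

lemma algebraic_int_int_quotient:
  assumes "algebraic_int (of_int a / of_int b :: complex)" "b \<noteq> 0"
  shows "b dvd a"
proof -
  have "(of_int a / of_int b :: complex) \<in> \<rat>"
    by simp
  then have "(of_int a / of_int b :: complex) \<in> \<int>"
    using assms(1) by (rule rational_algebraic_int_is_int[rotated])
  then obtain k where "(of_int a / of_int b :: complex) = of_int k"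
    by (elim Ints_cases)
  then have "(of_int a :: complex) = of_int (b * k)"
    using assms(2) by (simp add: field_simps)
  then have "a = b * k"
    unfolding of_int_eq_iff .
  then show ?thesis
    by simp
qed

text \<open>
  If \<open>x\<^sup>2 + \<Delta>\<close> were divisible by \<open>p\<close>, primality of \<open>(p)\<close> would make \<open>y = (x \<plusminus> \<omega>) / p\<close> an algebraic
  integer.  Its trace \<open>2x / p\<close> shows \<open>p dvd x\<close>, its norm \<open>(x\<^sup>2 + \<Delta>) / p\<^sup>2\<close> then shows that \<open>p\<^sup>2\<close> divides
  the squarefree number \<open>\<Delta>\<close>.  That trace and norm are algebraic integers follows from the ring
  structure of the set of integers, which is part of the notion of a prime ideal.
\<close>

lemma inert_prime_imp_nonresidue:
  assumes "inert_prime p D" "squarefree D" "prime p" "odd p"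
  shows "\<not> [x\<^sup>2 = - int D] (mod int p)"
proof
  assume x: "[x\<^sup>2 = - int D] (mod int p)"
  define w where "w = csqrt (- of_nat D)"
  let ?R = "quadratic_integer_ring D"
  interpret primeideal "PIdl\<^bsub>?R\<^esub> (of_nat p)" ?R
    using assms(1) by (simp add: inert_prime_def)
  have R: "carrier ?R = {x \<in> imag_quadratic_field D. algebraic_int x}" "mult ?R = (*)" "add ?R = (+)"
    by (simp_all add: quadratic_integer_ring_def)
  have add: "a + b \<in> carrier ?R" if "a \<in> carrier ?R" "b \<in> carrier ?R" for a b
    using add.m_closed[OF that] by (simp add: R)
  have mult: "a * b \<in> carrier ?R" if "a \<in> carrier ?R" "b \<in> carrier ?R" for a b
    using m_closed[OF that] by (simp add: R)
  have fieldI: "of_rat a + of_rat b * w \<in> imag_quadratic_field D" for a b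
    by (auto simp: imag_quadratic_field_def w_def)
  have w2: "w * w = - of_nat D"
    using power2_csqrt[of "- of_nat D"] by (simp add: w_def power2_eq_square)
  have cw: "cnj w = - w"
    unfolding w_def by (subst (1 2) csqrt_of_real_nonpos) auto
  have "w \<in> carrier ?R" "- w \<in> carrier ?R"
    using fieldI[of 0 1] fieldI[of 0 "-1"] algebraic_int_csqrt[of "- of_nat D"]
    by (auto simp: R w_def intro: int_imp_algebraic_int simp del: csqrt_of_real_nonpos)
  moreover have int: "of_int a \<in> carrier ?R" for a
    using fieldI[of "of_int a" 0] by (auto simp: R intro!: int_imp_algebraic_int)
  ultimately have mem: "of_int x + w \<in> carrier ?R" "of_int x + - w \<in> carrier ?R"
    using add by blast+
  obtain k where k: "x\<^sup>2 + int D = int p * k"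
    using x by (metis cong_iff_dvd_diff diff_minus_eq_add dvdE)
  have prod: "(of_int x + w) * (of_int x + - w) = of_int (x\<^sup>2 + int D)"
    using w2 by (simp add: algebra_simps power2_eq_square)
  also have "\<dots> = of_int k * of_nat p"
    unfolding k by simp
  finally have "(of_int x + w) * (of_int x + - w) = of_int k * of_nat p" .
  then have "(of_int x + w) * (of_int x + - w) \<in> PIdl\<^bsub>?R\<^esub> (of_nat p)"
    unfolding cgenideal_def R(2) using int[of k] by blast
  then have "of_int x + w \<in> PIdl\<^bsub>?R\<^esub> (of_nat p) \<or> of_int x + - w \<in> PIdl\<^bsub>?R\<^esub> (of_nat p)"
    using I_prime[OF mem] by (simp add: R(2))
  then obtain s y where s: "s = w \<or> s = - w" and y: "y \<in> carrier ?R" "of_int x + s = y * of_nat p"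
    unfolding cgenideal_def R(2) by blast
  have p0: "(of_nat p :: complex) \<noteq> 0" "int p \<noteq> 0"
    using assms(3) by auto
  from y(2) have y': "y = (of_int x + s) / of_nat p"
    using p0 by (simp add: field_simps)
  have cy: "cnj y = (of_int x + - s) / of_nat p"
    using s cw by (auto simp: y')
  have "cnj y \<in> imag_quadratic_field D"
    using s fieldI[of "of_int x / of_nat p" "1 / of_nat p"] fieldI[of "of_int x / of_nat p" "- 1 / of_nat p"]
    unfolding cy by (auto simp: of_rat_divide of_rat_minus add_divide_distrib diff_divide_distrib)
  then have cy': "cnj y \<in> carrier ?R"
    using y(1) by (simp add: R(1))
  have "y + cnj y = of_int (2 * x) / of_int (int p)"
    using s unfolding y' cw by (auto simp: cw add_divide_distrib[symmetric])
  then have "int p dvd 2 * x"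
    using add[OF y(1) cy'] p0 by (intro algebraic_int_int_quotient) (auto simp: R(1))
  moreover have "prime (int p)" "\<not> int p dvd 2"
    using assms(3,4) primes_dvd_imp_eq[of p 2] by (auto dest: int_dvd_int_iff[of p 2, THEN iffD1, simplified])
  ultimately have "int p dvd x"
    by (metis prime_dvd_mult_iff)
  then have px: "(int p)\<^sup>2 dvd x\<^sup>2"
    by (rule dvd_power_same)
  have "y * cnj y = (of_int x + w) * (of_int x + - w) / of_int ((int p)\<^sup>2)"
    using s cw p0 unfolding y' by (auto simp: power2_eq_square field_simps)
  also have "\<dots> = of_int (x\<^sup>2 + int D) / of_int ((int p)\<^sup>2)"
    unfolding prod ..
  finally have "algebraic_int (of_int (x\<^sup>2 + int D) / of_int ((int p)\<^sup>2) :: complex)"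
    using mult[OF y(1) cy'] by (simp add: R(1))
  then have "(int p)\<^sup>2 dvd x\<^sup>2 + int D"
    using p0 by (intro algebraic_int_int_quotient) auto
  then have "(int p)\<^sup>2 dvd int D"
    using px by (simp add: dvd_add_right_iff)
  then have "p\<^sup>2 dvd D"
    by (metis of_nat_dvd_iff of_nat_power)
  then have "is_unit p"
    using assms(2) by (auto simp: squarefree_def)
  then show False
    using assms(3) by auto
qed

text \<open>
  What the local rings see of the hypotheses on \<open>p\<close> and \<open>\<Delta>\<close>: \<open>2\<close> is invertible and
  \<open>\<bbbF>\<^sub>p[\<surd>-\<Delta>]\<close> is a field.
\<close>

definition inert_types :: "'p::prime_card itself \<Rightarrow> 'd itself \<Rightarrow> bool" where
  "inert_types _ _ \<longleftrightarrow> odd CARD('p) \<and> (\<forall>x :: 'p mod_ring. x\<^sup>2 \<noteq> - of_nat CARD('d))"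

lemma inert_types_of_inert_prime:
  assumes "inert_prime CARD('p::prime_card) CARD('d)" "squarefree CARD('d)" "odd CARD('p)"
  shows "inert_types TYPE('p) TYPE('d)"
  unfolding inert_types_def
proof (intro conjI allI notI)
  fix x :: "'p mod_ring"
  assume "x\<^sup>2 = - of_nat CARD('d)"
  moreover obtain a where "x = of_int a"
    by (metis of_int_of_nat_eq surj_of_nat_mod_ring)
  ultimately have "(of_int (a\<^sup>2) :: 'p mod_ring) = of_int (- int CARD('d))"
    by simp
  then show False
    using inert_prime_imp_nonresidue[OF assms(1,2) prime_card assms(3)]
    unfolding of_int_mod_ring_eq_iff by blast
qed (use assms in simp)

definition qnorm :: "('a::comm_ring_1, 'd) quad \<Rightarrow> 'a" where
  "qnorm x = (qre x)\<^sup>2 + of_nat CARD('d) * (qim x)\<^sup>2"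

lemma quad_mult_qconj: "x * qconj x = (qbase (qnorm x) :: ('a::comm_ring_1, 'd) quad)"
  by (rule quad_eqI) (simp_all add: qbase_def qnorm_def power2_eq_square)

lemma qbase_sel [simp]: "qre (qbase a) = a" "qim (qbase a) = 0"
  by (simp_all add: qbase_def)

interpretation qbase: inj_comm_ring_hom "qbase :: 'a::comm_ring_1 \<Rightarrow> ('a, 'd) quad"
  by unfold_locales (auto intro!: quad_eqI dest: arg_cong[of _ _ qre])

interpretation qconj: comm_ring_hom "qconj :: ('a::comm_ring_1, 'd) quad \<Rightarrow> ('a, 'd) quad"
  by unfold_locales (auto intro!: quad_eqI)

interpretation qred: comm_ring_hom "qred :: ('p::prime_card padic_int, 'd) quad \<Rightarrow> ('p mod_ring, 'd) quad"
  by unfold_locales (auto intro!: quad_eqI simp: qred_def hom_distribs)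

lemma qred_sel [simp]: "qre (qred x) = padic_red (qre x)" "qim (qred x) = padic_red (qim x)"
  by (simp_all add: qred_def)

lemma qnorm_eq_0_iff:
  fixes x :: "('p::prime_card mod_ring, 'd) quad"
  assumes "inert_types TYPE('p) TYPE('d)"
  shows "qnorm x = 0 \<longleftrightarrow> x = 0"
proof
  assume n: "qnorm x = 0"
  have "qim x = 0"
  proof (rule ccontr)
    assume q: "qim x \<noteq> 0"
    have "(qre x)\<^sup>2 = - of_nat CARD('d) * (qim x)\<^sup>2"
      using n by (simp add: qnorm_def eq_neg_iff_add_eq_0)
    then have "(qre x / qim x)\<^sup>2 = - of_nat CARD('d)"
      using q by (simp add: power_divide)
    then show False
      using assms by (auto simp: inert_types_def)
  qed
  moreover from this have "qre x = 0"
    using n by (simp add: qnorm_def)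
  ultimately show "x = 0"
    by (intro quad_eqI) simp_all
qed (simp add: qnorm_def)

lemma quad_unit_iff_qnorm: "(x :: ('a::comm_ring_1, 'd) quad) dvd 1 \<longleftrightarrow> qnorm x dvd 1"
proof
  assume "x dvd 1"
  then obtain y where "1 = x * y" ..
  then have "(qbase 1 :: ('a, 'd) quad) = (x * y) * qconj (x * y)"
    by simp
  also have "\<dots> = (x * qconj x) * (y * qconj y)"
    by (simp add: qconj.hom_mult ac_simps)
  also have "\<dots> = qbase (qnorm x * qnorm y)"
    by (simp add: quad_mult_qconj qbase.hom_mult)
  finally show "qnorm x dvd 1"
    unfolding qbase.eq_iff by (metis dvd_triv_left)
next
  assume "qnorm x dvd 1"
  then obtain n where "1 = qnorm x * n" ..
  then have "(1 :: ('a, 'd) quad) = qbase (qnorm x) * qbase n"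
    by (metis qbase.hom_mult qbase.hom_one)
  then have "1 = x * (qconj x * qbase n)"
    by (simp add: quad_mult_qconj[symmetric] mult.assoc)
  then show "x dvd 1"
    by (metis dvd_triv_left)
qed

lemma qred_qnorm: "qnorm (qred x) = padic_red (qnorm x)"
  by (simp add: qnorm_def hom_distribs)

text \<open>
  \<open>\<int>\<^sub>p[\<surd>-\<Delta>]\<close> is a local ring with maximal ideal generated by \<open>p\<close>, because the norm form is
  anisotropic modulo \<open>p\<close>.
\<close>

lemma quad_unit_iff:
  fixes x :: "('p::prime_card padic_int, 'd) quad"
  assumes "inert_types TYPE('p) TYPE('d)"
  shows "x dvd 1 \<longleftrightarrow> qred x \<noteq> 0"
  using qnorm_eq_0_iff[OF assms, of "qred x"]
  by (simp add: quad_unit_iff_qnorm padic_unit_iff qred_qnorm)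

lemma quad_field_mult_eq_0:
  fixes x y :: "('p::prime_card mod_ring, 'd) quad"
  assumes "inert_types TYPE('p) TYPE('d)" "x * y = 0" "x \<noteq> 0"
  shows "y = 0"
proof -
  have "qnorm x \<noteq> 0"
    using assms qnorm_eq_0_iff by blast
  have "qbase (qnorm x) * y = qconj x * (x * y)"
    unfolding quad_mult_qconj[symmetric] by (simp only: ac_simps)
  then have *: "qbase (qnorm x) * y = 0"
    using assms(2) by simp
  have "qnorm x * qre y = 0" "qnorm x * qim y = 0"
    using arg_cong[OF *, of qre] arg_cong[OF *, of qim] by simp_all
  then show ?thesis
    using \<open>qnorm x \<noteq> 0\<close> by (intro quad_eqI) simp_all
qed

lemma inert_types_Delta_unit:
  assumes "inert_types TYPE('p::prime_card) TYPE('d)"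
  shows "(of_nat CARD('d) :: 'p padic_int) dvd 1"
proof -
  have "(of_nat CARD('d) :: 'p mod_ring) \<noteq> 0"
    using assms unfolding inert_types_def by (metis neg_equal_0_iff_equal power_zero_numeral)
  then show ?thesis
    by (simp add: padic_unit_iff padic_red.hom_of_nat)
qed

text \<open>
  The norm \<open>a\<^sup>2 + \<Delta> b\<^sup>2\<close> is a binary form with unit coefficients.
\<close>

lemma qnorm_surj_units:
  fixes u :: "'p::prime_card padic_int"
  assumes "inert_types TYPE('p) TYPE('d)" "u dvd 1"
  obtains x :: "('p padic_int, 'd) quad" where "qnorm x = u"
proof -
  obtain a b where "1 * a\<^sup>2 + of_nat CARD('d) * b\<^sup>2 = u"
    using padic_binary_form_universal[of 1 "of_nat CARD('d)" u] assms inert_types_Delta_unit[OF assms(1)]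
    by (auto simp: inert_types_def)
  then show thesis
    by (intro that[of "Quad a b"]) (simp add: qnorm_def)
qed

section \<open>Hermitian forms over a local ring with involution\<close>

(* Associativity and the unfolding of the number 1 are applied by hand: as rewrite rules they would
   destroy the shape A * H * star B and the dimension 1 of a single row. *)
declare assoc_mult_mat [simp del] One_nat_def [simp del]

text \<open>
  Padding both factors with zeros to square matrices leaves the product unchanged.
\<close>

lemma det_mult_narrow_eq_0:
  fixes A :: "'a::comm_ring_1 mat"
  assumes "A \<in> carrier_mat n k" "B \<in> carrier_mat k n" "k < n"
  shows "det (A * B) = 0"
proof -
  let ?A = "mat n n (\<lambda>(i, j). if j < k then A $$ (i, j) else 0)"
  let ?B = "mat n n (\<lambda>(i, j). if i < k then B $$ (i, j) else 0)"
  have AB: "A * B = ?A * ?B"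
  proof (rule eq_matI)
    fix i j
    assume "i < dim_row (?A * ?B)" "j < dim_col (?A * ?B)"
    then have ij: "i < n" "j < n"
      by auto
    have "(?A * ?B) $$ (i, j) =
        (\<Sum>l = 0..<n. (if l < k then A $$ (i, l) else 0) * (if l < k then B $$ (l, j) else 0))"
      using ij by (simp add: scalar_prod_def)
    also have "\<dots> = (\<Sum>l = 0..<k. A $$ (i, l) * B $$ (l, j))"
      using assms(3) by (intro sum.mono_neutral_cong_right) auto
    finally show "(A * B) $$ (i, j) = (?A * ?B) $$ (i, j)"
      using ij assms by (simp add: scalar_prod_def)
  qed (use assms in auto)
  have "det ?B = (\<Sum>j<n. ?B $$ (n - 1, j) * cofactor ?B (n - 1) j)"
    using assms(3) by (intro laplace_expansion_row) auto
  also have "\<dots> = 0"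
    using assms(3) by (intro sum.neutral) auto
  finally have "det ?B = 0" .
  then show ?thesis
    unfolding AB by (subst det_mult[of _ n]) auto
qed

lemma unit_det_imp_inverse:
  fixes A :: "'a::comm_ring_1 mat"
  assumes "A \<in> carrier_mat n n" "det A dvd 1"
  obtains B where "B \<in> carrier_mat n n" "A * B = 1\<^sub>m n" "B * A = 1\<^sub>m n"
proof -
  obtain e where e: "1 = det A * e"
    using assms(2) ..
  note adj = adj_mat[OF assms(1)]
  have "A * (e \<cdot>\<^sub>m adj_mat A) = e \<cdot>\<^sub>m (det A \<cdot>\<^sub>m 1\<^sub>m n)"
    using adj assms(1) by (subst mult_smult_distrib[of _ n n _ n]) auto
  moreover have "(e \<cdot>\<^sub>m adj_mat A) * A = e \<cdot>\<^sub>m (det A \<cdot>\<^sub>m 1\<^sub>m n)"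
    using adj assms(1) by (subst mult_smult_assoc_mat[of _ n n _ n]) auto
  moreover have "e \<cdot>\<^sub>m (det A \<cdot>\<^sub>m 1\<^sub>m n) = 1\<^sub>m n"
    using e by (intro eq_matI) (auto simp: mult.commute)
  ultimately show thesis
    using adj(1) by (intro that[of "e \<cdot>\<^sub>m adj_mat A"]) auto
qed

lemma right_inverse_imp_unit_det:
  fixes A :: "'a::comm_ring_1 mat"
  assumes "A \<in> carrier_mat n n" "B \<in> carrier_mat n n" "A * B = 1\<^sub>m n"
  shows "det A dvd 1"
  using det_mult[OF assms(1,2)] assms(3) by (metis det_one dvd_triv_left)

lemma append_rows_mult:
  assumes "A \<in> carrier_mat k n" "B \<in> carrier_mat l n" "X \<in> carrier_mat n m"
  shows "(A @\<^sub>r B) * X = (A * X) @\<^sub>r (B * X)"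
  using assms by (intro eq_matI) (auto simp: append_rows_def scalar_prod_def)

lemma append_rows_zero:
  "0\<^sub>m k n @\<^sub>r 0\<^sub>m l n = 0\<^sub>m (k + l) n"
  by (intro eq_matI) (auto simp: append_rows_def)

lemma append_rows_eq_zeroD:
  assumes "A @\<^sub>r B = 0\<^sub>m (k + l) n" "A \<in> carrier_mat k n" "B \<in> carrier_mat l n"
  shows "A = 0\<^sub>m k n" "B = 0\<^sub>m l n"
proof -
  have *: "(A @\<^sub>r B) $$ (i, j) = 0" if "i < k + l" "j < n" for i j
    using that by (simp add: assms(1))
  show "A = 0\<^sub>m k n"
  proof (rule eq_matI)
    fix i j
    assume "i < dim_row (0\<^sub>m k n)" "j < dim_col (0\<^sub>m k n)"
    then show "A $$ (i, j) = 0\<^sub>m k n $$ (i, j)"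
      using *[of i j] assms(2,3) by (simp add: append_rows_def)
  qed (use assms in auto)
  show "B = 0\<^sub>m l n"
  proof (rule eq_matI)
    fix i j
    assume "i < dim_row (0\<^sub>m l n)" "j < dim_col (0\<^sub>m l n)"
    then show "B $$ (i, j) = 0\<^sub>m l n $$ (i, j)"
      using *[of "k + i" j] assms(2,3) by (simp add: append_rows_def)
  qed (use assms in auto)
qed

lemma block_diag_inverse:
  fixes A B :: "'a::comm_ring_1 mat"
  assumes "A \<in> carrier_mat k k" "A' \<in> carrier_mat k k" "B \<in> carrier_mat l l" "B' \<in> carrier_mat l l"
    and "A * A' = 1\<^sub>m k" "B * B' = 1\<^sub>m l"
  shows "four_block_mat A (0\<^sub>m k l) (0\<^sub>m l k) B * four_block_mat A' (0\<^sub>m k l) (0\<^sub>m l k) B' = 1\<^sub>m (k + l)"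
  using assms by (subst mult_four_block_mat[of _ k k _ l _ l _ _ k _ l]) auto

lemma smult_one_inverse:
  fixes a b :: "'a::comm_ring_1"
  assumes "a * b = 1"
  shows "(a \<cdot>\<^sub>m 1\<^sub>m k) * (b \<cdot>\<^sub>m 1\<^sub>m k) = 1\<^sub>m k"
proof -
  have "(a \<cdot>\<^sub>m 1\<^sub>m k) * (b \<cdot>\<^sub>m 1\<^sub>m k) = a \<cdot>\<^sub>m (1\<^sub>m k * (b \<cdot>\<^sub>m 1\<^sub>m k))"
    by (rule mult_smult_assoc_mat[of _ k k _ k]) auto
  also have "\<dots> = 1\<^sub>m k"
    using assms by (intro eq_matI) auto
  finally show ?thesis .
qed

text \<open>
  The bar of the ring is \<open>cj\<close>, and \<open>star\<close> is the conjugate transpose; \<open>A * H * star A\<close> is the Gram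
  matrix of the rows of \<open>A\<close> for the form \<open>H\<close>.
\<close>

locale ring_with_involution = cj: comm_ring_hom cj
  for cj :: "'a::comm_ring_1 \<Rightarrow> 'a" +
  assumes cj_cj [simp]: "cj (cj x) = x"
begin

abbreviation star :: "'a mat \<Rightarrow> 'a mat" where
  "star A \<equiv> transpose_mat (map_mat cj A)"

lemma one_smult_mat: "1 \<cdot>\<^sub>m A = (A :: 'a mat)"
  by (intro eq_matI) auto

lemma star_star [simp]: "star (star A) = A"
  by (intro eq_matI) auto

lemma star_mult:
  assumes "A \<in> carrier_mat n m" "B \<in> carrier_mat m k"
  shows "star (A * B) = star B * star A"
  unfolding cj.mat_hom_mult[OF assms]
  by (rule transpose_mult[of _ n m _ k]) (use assms in auto)

lemma star_mult3:
  assumes "A \<in> carrier_mat n m" "B \<in> carrier_mat m k" "C \<in> carrier_mat k l"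
  shows "star (A * B * C) = star C * star B * star A"
  using assms by (simp add: star_mult[of _ n k _ l] star_mult[of _ n m _ k]
      assoc_mult_mat[of "star C" l k "star B" m "star A" n])

lemma star_minus:
  assumes "A \<in> carrier_mat n m" "B \<in> carrier_mat n m"
  shows "star (A - B) = star A - star B"
  using assms by (intro eq_matI) (auto simp: cj.hom_minus)

lemma star_one [simp]: "star (1\<^sub>m n) = 1\<^sub>m n"
  by (intro eq_matI) auto

lemma star_zero [simp]: "star (0\<^sub>m n m) = 0\<^sub>m m n"
  by (intro eq_matI) auto

lemma star_smult: "star (c \<cdot>\<^sub>m A) = cj c \<cdot>\<^sub>m star A"
  by (intro eq_matI) (auto simp: cj.hom_mult)

lemma gram_star:
  assumes "H \<in> carrier_mat n n" "star H = H" "A \<in> carrier_mat k n" "B \<in> carrier_mat l n"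
  shows "star (A * H * star B) = B * H * star A"
  using assms by (subst star_mult3[of _ k n _ n _ l]) auto

lemma gram_index:
  assumes "X \<in> carrier_mat a n" "H \<in> carrier_mat n n" "Y \<in> carrier_mat b n" "i < a" "j < b"
  shows "(X * H * star Y) $$ (i, j) =
    (\<Sum>t = 0..<n. (\<Sum>s = 0..<n. X $$ (i, s) * H $$ (s, t)) * cj (Y $$ (j, t)))"
  using assms by (auto simp: scalar_prod_def intro!: sum.cong)

lemma gram_append:
  assumes "H \<in> carrier_mat n n" "A \<in> carrier_mat k n" "B \<in> carrier_mat l n"
  shows "(A @\<^sub>r B) * H * star (A @\<^sub>r B) =
    four_block_mat (A * H * star A) (A * H * star B) (B * H * star A) (B * H * star B)"
proof (rule eq_matI)
  fix i j
  assume "i < dim_row (four_block_mat (A * H * star A) (A * H * star B) (B * H * star A) (B * H * star B))"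
    "j < dim_col (four_block_mat (A * H * star A) (A * H * star B) (B * H * star A) (B * H * star B))"
  then have ij: "i < k + l" "j < k + l"
    using assms by auto
  have AB: "A @\<^sub>r B \<in> carrier_mat (k + l) n"
    using assms by auto
  have ix: "(A @\<^sub>r B) $$ (i, s) = (if i < k then A $$ (i, s) else B $$ (i - k, s))"
    if "i < k + l" "s < n" for i s
    using that assms by (auto simp: append_rows_def)
  show "((A @\<^sub>r B) * H * star (A @\<^sub>r B)) $$ (i, j) =
      four_block_mat (A * H * star A) (A * H * star B) (B * H * star A) (B * H * star B) $$ (i, j)"
    unfolding gram_index[OF AB assms(1) AB ij]
    using ij assms
    by (auto simp: ix gram_index[OF assms(2,1,2)] gram_index[OF assms(2,1,3)]
        gram_index[OF assms(3,1,2)] gram_index[OF assms(3,1,3)] simp del: index_mult_mat(1)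
        intro!: sum.cong)
qed (use assms in \<open>auto simp: append_rows_def\<close>)

lemma unit_cj: "x dvd 1 \<Longrightarrow> cj x dvd 1"
  by (metis cj.hom_mult cj.hom_one dvd_def)

lemma sum_two_deltas:
  fixes c :: 'a
  assumes "i < n" "j < (n::nat)"
  shows "(\<Sum>s = 0..<n. ((if s = i then 1 else 0) + (if s = j then c else 0)) * f s) = f i + c * f j"
proof -
  have "(\<Sum>s = 0..<n. ((if s = i then 1 else 0) + (if s = j then c else 0)) * f s) =
      (\<Sum>s = 0..<n. (if s = i then f s else 0) + (if s = j then c * f s else 0))"
    by (intro sum.cong) (auto simp: distrib_right)
  then show ?thesis
    using assms by (simp add: sum.distrib)
qed

lemma mat_1_1_eq: "(A :: 'a mat) \<in> carrier_mat 1 1 \<Longrightarrow> A = (A $$ (0, 0)) \<cdot>\<^sub>m 1\<^sub>m 1"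
  by (intro eq_matI) (auto simp: less_Suc_eq One_nat_def)

lemma gram_entry_real:
  assumes "H \<in> carrier_mat n n" "star H = H" "w \<in> carrier_mat 1 n"
  shows "cj ((w * H * star w) $$ (0, 0)) = (w * H * star w) $$ (0, 0)"
proof -
  have "(star (w * H * star w)) $$ (0, 0) = cj ((w * H * star w) $$ (0, 0))"
    using assms by auto
  then show ?thesis
    using gram_star[OF assms(1,2,3,3)] by simp
qed

lemma smult_gram:
  assumes "H \<in> carrier_mat n n" "A \<in> carrier_mat k n" "B \<in> carrier_mat l n"
  shows "(a \<cdot>\<^sub>m A) * H * star (b \<cdot>\<^sub>m B) = (a * cj b) \<cdot>\<^sub>m (A * H * star B)"
proof -
  have "(a \<cdot>\<^sub>m A) * H * star (b \<cdot>\<^sub>m B) = (a \<cdot>\<^sub>m (A * H)) * (cj b \<cdot>\<^sub>m star B)"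
    using assms by (simp add: star_smult mult_smult_assoc_mat[of A k n H n])
  also have "\<dots> = a \<cdot>\<^sub>m (cj b \<cdot>\<^sub>m (A * H * star B))"
    using assms by (simp add: mult_smult_assoc_mat[of "A * H" k n _ l] mult_smult_distrib[of "A * H" k n _ l])
  finally show ?thesis
    by (intro eq_matI) (auto simp: mult.assoc)
qed

end

text \<open>
  The kernel of \<open>red\<close> consists of the non-units, so the ring is local.  The two instances are
  \<open>\<int>\<^sub>p\<close> with the trivial involution, where \<open>H\<close> is a symmetric form, and \<open>\<int>\<^sub>p[\<surd>-\<Delta>]\<close> with
  conjugation.
\<close>

locale hermitian_local_ring = ring_with_involution cj + red: comm_ring_hom red
  for cj :: "'a::comm_ring_1 \<Rightarrow> 'a" and red :: "'a \<Rightarrow> 'k::comm_ring_1" +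
  assumes unit_iff: "x dvd 1 \<longleftrightarrow> red x \<noteq> 0"
    and two_unit: "(2 :: 'a) dvd 1"
begin

text \<open>
  Polarization: if both diagonal values are non-units, the vector \<open>e\<^sub>i + c e\<^sub>j\<close> with \<open>c = Q\<^sub>i\<^sub>j\<close> has
  the value \<open>2 c cj(c)\<close> up to non-units.
\<close>

lemma hermitian_unit_value:
  assumes Q: "Q \<in> carrier_mat n n" "star Q = Q" and ij: "i < n" "j < n" "Q $$ (i, j) dvd 1"
  obtains x where "x \<in> carrier_mat 1 n" "(x * Q * star x) $$ (0, 0) dvd 1"
proof -
  let ?x = "\<lambda>i j c. mat 1 n (\<lambda>(_, s). (if s = i then 1 else 0) + (if s = j then c else 0)) :: 'a mat"
  have val: "(?x i j c * Q * star (?x i j c)) $$ (0, 0) =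
      Q $$ (i, i) + c * Q $$ (j, i) + cj c * (Q $$ (i, j) + c * Q $$ (j, j))"
    if "i < n" "j < n" for i j c
  proof -
    have "(?x i j c * Q * star (?x i j c)) $$ (0, 0) =
        (\<Sum>t = 0..<n. (Q $$ (i, t) + c * Q $$ (j, t)) * cj (?x i j c $$ (0, t)))"
      using that Q by (subst gram_index[of _ 1 n _ _ 1]) (auto simp: sum_two_deltas)
    also have "\<dots> = (\<Sum>t = 0..<n. ((if t = i then 1 else 0) + (if t = j then cj c else 0)) *
        (Q $$ (i, t) + c * Q $$ (j, t)))"
      by (intro sum.cong) (auto simp: cj.hom_add mult.commute)
    finally show ?thesis
      using that by (simp add: sum_two_deltas)
  qed
  show thesis
  proof (cases "\<exists>l<n. Q $$ (l, l) dvd 1")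
    case True
    then obtain l where "l < n" "Q $$ (l, l) dvd 1"
      by blast
    then show thesis
      using val[of l l 0] by (intro that[of "?x l l 0"]) auto
  next
    case False
    define c where "c = Q $$ (i, j)"
    have "Q $$ (j, i) = cj (Q $$ (i, j))"
      using ij(1,2) Q(1) arg_cong[OF Q(2), of "\<lambda>A. A $$ (j, i)"] by simp
    then have "red ((?x i j c * Q * star (?x i j c)) $$ (0, 0)) = red (2 * (c * cj c))"
      using val[OF ij(1,2), of c] False ij
      by (simp add: unit_iff hom_distribs c_def algebra_simps)
    moreover have "2 * (c * cj c) dvd 1"
      using two_unit ij(3) unit_cj[of c] by (simp add: c_def is_unit_mult_iff)
    ultimately show thesis
      using that[of "?x i j c"] by (simp add: unit_iff)
  qed
qed

text \<open>
  Projecting the standard basis onto the orthogonal complement of the rows of \<open>B\<close> gives the Gram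
  matrix \<open>Q = H - (H B\<^sup>*) (Ki B H)\<close>.  It cannot vanish modulo the maximal ideal, since there the
  subtracted term has rank at most \<open>k < n\<close> while \<open>H\<close> is invertible.
\<close>

lemma orthogonal_unit_vector:
  assumes H: "H \<in> carrier_mat n n" "star H = H" "det H dvd 1"
    and B: "B \<in> carrier_mat k n" "k < n"
    and Ki: "Ki \<in> carrier_mat k k" "Ki * (B * H * star B) = 1\<^sub>m k"
  obtains w where "w \<in> carrier_mat 1 n" "w * H * star B = 0\<^sub>m 1 k"
    "(w * H * star w) $$ (0, 0) dvd 1"
proof -
  define L where "L = H * star B"
  define R where "R = Ki * B"
  \<comment> \<open>The rows of \<open>P\<close> are the projections of the standard basis vectors \<open>e\<close>, that is \<open>e - e H B\<^sup>* Ki B\<close>.\<close>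
  define P where "P = 1\<^sub>m n - L * R"
  have car: "L \<in> carrier_mat n k" "R \<in> carrier_mat k n" "P \<in> carrier_mat n n"
    "star R \<in> carrier_mat n k" "star L \<in> carrier_mat k n" "star B \<in> carrier_mat n k"
    using H B Ki by (auto simp: L_def R_def P_def)
  have PH: "P * H = H - L * (R * H)"
    unfolding P_def using H car
    by (subst minus_mult_distrib_mat[of _ n n _ _ n]) (auto simp: assoc_mult_mat[of L n k R n H n])
  have RL: "R * L = 1\<^sub>m k"
    using Ki H B car by (simp add: R_def L_def assoc_mult_mat[of B k n H n "star B" k]
        assoc_mult_mat[of Ki k k B n "H * star B" k])
  have PL: "P * L = 0\<^sub>m n k"
    unfolding P_def using RL car
    by (subst minus_mult_distrib_mat[of _ n n _ _ k]) (auto simp: assoc_mult_mat[of L n k R n L k])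
  have PHB: "P * H * star B = 0\<^sub>m n k"
    using PL H B car by (simp add: L_def assoc_mult_mat[of P n n H n "star B" k])
  define Q where "Q = P * H * star P"
  have Q: "Q \<in> carrier_mat n n" "star Q = Q"
    unfolding Q_def using H car by (auto simp: gram_star[of _ n _ n _ n])
  have starP: "star P = 1\<^sub>m n - star R * star L"
    unfolding P_def using car by (simp add: star_minus[of _ n n] star_mult[of _ n k _ n])
  have "Q = P * H - P * H * (star R * star L)"
    unfolding Q_def starP using H car by (subst mult_minus_distrib_mat[of _ n n _ n]) auto
  also have "P * H * (star R * star L) = 0\<^sub>m n n"
  proof -
    have sR: "star R = star B * star Ki"
      unfolding R_def by (rule star_mult) (use Ki B in auto)
    have "P * H * (star R * star L) = (P * H * star R) * star L"
      using H car by (subst assoc_mult_mat[of _ n n _ k _ n]) auto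
    also have "P * H * star R = (P * H * star B) * star Ki"
      unfolding sR using H B Ki car by (subst assoc_mult_mat[of _ n n _ k _ k]) auto
    finally show ?thesis
      using Ki car by (simp add: PHB)
  qed
  also have "P * H - 0\<^sub>m n n = H - L * (R * H)"
    unfolding PH using H car by (intro eq_matI) auto
  finally have QH: "Q = H - L * (R * H)" .
  have "\<exists>i<n. \<exists>j<n. Q $$ (i, j) dvd 1"
  proof (rule ccontr)
    assume "\<not> ?thesis"
    then have z: "red (Q $$ (i, j)) = 0" if "i < n" "j < n" for i j
      using that by (auto simp: unit_iff)
    have "map_mat red H = map_mat red (L * (R * H))"
    proof (rule eq_matI)
      fix i j
      assume "i < dim_row (map_mat red (L * (R * H)))" "j < dim_col (map_mat red (L * (R * H)))"
      then have ij: "i < n" "j < n"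
        using H car by auto
      have "Q $$ (i, j) = H $$ (i, j) - (L * (R * H)) $$ (i, j)"
        unfolding QH using ij H car by simp
      then show "map_mat red H $$ (i, j) = map_mat red (L * (R * H)) $$ (i, j)"
        using z[OF ij] ij H car by (simp add: red.hom_minus)
    qed (use H car in auto)
    then have "red (det H) = red (det (L * (R * H)))"
      by (metis red.hom_det)
    also have "det (L * (R * H)) = 0"
      using B(2) H car by (intro det_mult_narrow_eq_0[of _ n k]) auto
    finally show False
      using H(3) by (simp add: unit_iff)
  qed
  then obtain x where x: "x \<in> carrier_mat 1 n" "(x * Q * star x) $$ (0, 0) dvd 1"
    using hermitian_unit_value[OF Q] by metis
  have carx: "x * P \<in> carrier_mat 1 n" "star x \<in> carrier_mat n 1" "x \<in> carrier_mat 1 n"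
    "P * H \<in> carrier_mat n n" "star P \<in> carrier_mat n n" "x * (P * H) \<in> carrier_mat 1 n"
    using x car H by auto
  have "x * P * H * star B = x * (P * H * star B)"
    using carx car H by (simp add: assoc_mult_mat[of x 1 n P n H n] assoc_mult_mat[of x 1 n "P * H" n "star B" k])
  then have "x * P * H * star B = 0\<^sub>m 1 k"
    using x by (simp add: PHB)
  moreover have "x * P * H * star (x * P) = x * Q * star x"
  proof -
    have "x * P * H * star (x * P) = x * (P * H) * (star P * star x)"
      using carx car H by (simp add: star_mult[of x 1 n P n] assoc_mult_mat[of x 1 n P n H n])
    also have "\<dots> = x * (P * H) * star P * star x"
      using carx by (intro assoc_mult_mat[symmetric, of _ 1 n _ n _ 1])
    also have "x * (P * H) * star P = x * Q"
      unfolding Q_def using carx by (intro assoc_mult_mat[of _ 1 n _ n _ n])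
    finally show ?thesis .
  qed
  ultimately show thesis
    using x(2) carx(1) by (intro that[of "x * P"]) simp_all
qed

text \<open>
  One more orthogonal vector is found at each step.  Its value is a unit, which the norm hypothesis on
  \<open>\<kappa>\<close> rescales to the prescribed one.
\<close>

lemma scaled_orthonormal_complement:
  assumes H: "H \<in> carrier_mat n n" "star H = H" "det H dvd 1"
    and B: "B \<in> carrier_mat k n"
    and Ki: "Ki \<in> carrier_mat k k" "Ki * (B * H * star B) = 1\<^sub>m k"
    and \<kappa>: "\<kappa> dvd 1" "\<And>d. d dvd 1 \<Longrightarrow> cj d = d \<Longrightarrow> \<exists>u. u * cj u * d = \<kappa>"
    and "j + k \<le> n"
  shows "\<exists>W \<in> carrier_mat j n. W * H * star B = 0\<^sub>m j k \<and> W * H * star W = \<kappa> \<cdot>\<^sub>m 1\<^sub>m j"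
  using \<open>j + k \<le> n\<close>
proof (induction j)
  case 0
  show ?case
    by (rule bexI[of _ "0\<^sub>m 0 n"]) (use H B in auto)
next
  case (Suc j)
  then obtain W where W: "W \<in> carrier_mat j n" "W * H * star B = 0\<^sub>m j k" "W * H * star W = \<kappa> \<cdot>\<^sub>m 1\<^sub>m j"
    by auto
  obtain \<mu> where \<mu>: "1 = \<kappa> * \<mu>"
    using \<kappa>(1) ..
  have [simp]: "W @\<^sub>r B \<in> carrier_mat (j + k) n" "B * H * star B \<in> carrier_mat k k"
    using W B H by auto
  have BW: "B * H * star W = 0\<^sub>m k j"
    using gram_star[OF H(1,2) W(1) B] W(2) by simp
  have gram: "(W @\<^sub>r B) * H * star (W @\<^sub>r B) =
      four_block_mat (\<kappa> \<cdot>\<^sub>m 1\<^sub>m j) (0\<^sub>m j k) (0\<^sub>m k j) (B * H * star B)"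
    by (simp add: gram_append[OF H(1) W(1) B] W BW)
  \<comment> \<open>The rows found so far together with \<open>B\<close> again have an invertible Gram matrix.\<close>
  have inv: "four_block_mat (\<mu> \<cdot>\<^sub>m 1\<^sub>m j) (0\<^sub>m j k) (0\<^sub>m k j) Ki *
      ((W @\<^sub>r B) * H * star (W @\<^sub>r B)) = 1\<^sub>m (j + k)"
    unfolding gram using \<mu> Ki by (intro block_diag_inverse smult_one_inverse) (auto simp: mult.commute)
  obtain w where w: "w \<in> carrier_mat 1 n" "w * H * star (W @\<^sub>r B) = 0\<^sub>m 1 (j + k)"
    "(w * H * star w) $$ (0, 0) dvd 1"
    using orthogonal_unit_vector[OF H _ _ _ inv] Suc.prems Ki by auto
  have "(W @\<^sub>r B) * H * star w = 0\<^sub>m (j + k) 1"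
    using gram_star[OF H(1,2) w(1), of "W @\<^sub>r B" "j + k"] w(2) by simp
  then have "(W * H * star w) @\<^sub>r (B * H * star w) = 0\<^sub>m (j + k) 1"
    using H W B w by (simp add: append_rows_mult[of _ j n _ k])
  then have 0: "W * H * star w = 0\<^sub>m j 1" "B * H * star w = 0\<^sub>m k 1"
    by (rule append_rows_eq_zeroD; use H W B w in auto)+
  then have zero': "w * H * star W = 0\<^sub>m 1 j" "w * H * star B = 0\<^sub>m 1 k"
    using gram_star[OF H(1,2) W(1) w(1)] gram_star[OF H(1,2) B w(1)] by simp_all
  obtain u where u: "u * cj u * (w * H * star w) $$ (0, 0) = \<kappa>"
    using \<kappa>(2)[OF w(3) gram_entry_real[OF H(1,2) w(1)]] by blast
  define v where "v = u \<cdot>\<^sub>m w"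
  have v: "v \<in> carrier_mat 1 n"
    using w by (simp add: v_def)
  have vW: "v * H * star W = 0\<^sub>m 1 j" "v * H * star B = 0\<^sub>m 1 k"
    using smult_gram[OF H(1) w(1) W(1), of u 1] smult_gram[OF H(1) w(1) B, of u 1] zero'
    by (simp_all add: v_def one_smult_mat)
  have Wv: "W * H * star v = 0\<^sub>m j 1"
    using gram_star[OF H(1,2) v W(1)] vW by simp
  have "v * H * star v = (u * cj u) \<cdot>\<^sub>m (w * H * star w)"
    unfolding v_def by (rule smult_gram[OF H(1) w(1) w(1)])
  also have "\<dots> = \<kappa> \<cdot>\<^sub>m 1\<^sub>m 1"
    using u w H by (subst mat_1_1_eq) auto
  finally have vv: "v * H * star v = \<kappa> \<cdot>\<^sub>m 1\<^sub>m 1" .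
  show ?case
  proof (intro bexI[of _ "W @\<^sub>r v"] conjI)
    show "(W @\<^sub>r v) * H * star (W @\<^sub>r v) = \<kappa> \<cdot>\<^sub>m 1\<^sub>m (Suc j)"
      unfolding gram_append[OF H(1) W(1) v] W vW Wv vv by (intro eq_matI) auto
    show "(W @\<^sub>r v) * H * star B = 0\<^sub>m (Suc j) k"
      using H W B v vW by (simp add: append_rows_mult[of _ j n _ 1] append_rows_zero Suc_eq_plus1)
    show "W @\<^sub>r v \<in> carrier_mat (Suc j) n"
      using carrier_append_rows[OF W(1) v] by (simp add: Suc_eq_plus1)
  qed
qed

text \<open>
  As long as two dimensions are left, the orthogonal complement contains two orthogonal vectors whose
  values \<open>d\<close> and \<open>e\<close> are units, and some combination of them has the value \<open>1\<close>.
\<close>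

lemma orthonormal_rows:
  assumes H: "H \<in> carrier_mat n n" "star H = H" "det H dvd 1"
    and univ: "\<And>d e. d dvd 1 \<Longrightarrow> e dvd 1 \<Longrightarrow> cj d = d \<Longrightarrow> cj e = e \<Longrightarrow>
      \<exists>x y. x * cj x * d + y * cj y * e = 1"
    and "j < n"
  shows "\<exists>W \<in> carrier_mat j n. W * H * star W = 1\<^sub>m j"
  using \<open>j < n\<close>
proof (induction j)
  case 0
  show ?case
    by (rule bexI[of _ "0\<^sub>m 0 n"]) (use H in auto)
next
  case (Suc j)
  then obtain W where W: "W \<in> carrier_mat j n" "W * H * star W = 1\<^sub>m j"
    by auto
  obtain w where w: "w \<in> carrier_mat 1 n" "w * H * star W = 0\<^sub>m 1 j"
    "(w * H * star w) $$ (0, 0) dvd 1"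
    using orthogonal_unit_vector[OF H W(1), of "1\<^sub>m j"] Suc.prems W by auto
  have Ww: "W * H * star w = 0\<^sub>m j 1"
    using gram_star[OF H(1,2) w(1) W(1)] w(2) by simp
  define d where "d = (w * H * star w) $$ (0, 0)"
  have ww: "w * H * star w = d \<cdot>\<^sub>m 1\<^sub>m 1"
    unfolding d_def by (rule mat_1_1_eq) (use w H in auto)
  obtain \<mu> where \<mu>: "1 = d * \<mu>"
    using w(3) unfolding d_def ..
  have inv: "four_block_mat (1\<^sub>m j) (0\<^sub>m j 1) (0\<^sub>m 1 j) (\<mu> \<cdot>\<^sub>m 1\<^sub>m 1) *
      ((W @\<^sub>r w) * H * star (W @\<^sub>r w)) = 1\<^sub>m (j + 1)"
    unfolding gram_append[OF H(1) W(1) w(1)] W w(2) Ww ww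
    using \<mu> by (intro block_diag_inverse smult_one_inverse) (auto simp: mult.commute)
  obtain v where v: "v \<in> carrier_mat 1 n" "v * H * star (W @\<^sub>r w) = 0\<^sub>m 1 (j + 1)"
    "(v * H * star v) $$ (0, 0) dvd 1"
    using orthogonal_unit_vector[OF H _ _ _ inv] Suc.prems W w by auto
  \<comment> \<open>The vectors \<open>w\<close> and \<open>v\<close> span a plane orthogonal to \<open>W\<close>, with Gram matrix \<open>diag(d, e)\<close>.\<close>
  define e where "e = (v * H * star v) $$ (0, 0)"
  have vv: "v * H * star v = e \<cdot>\<^sub>m 1\<^sub>m 1"
    unfolding e_def by (rule mat_1_1_eq) (use v H in auto)
  have "(W @\<^sub>r w) * H * star v = 0\<^sub>m (j + 1) 1"
    using gram_star[OF H(1,2) v(1), of "W @\<^sub>r w" "j + 1"] v(2) W w by simp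
  then have "(W * H * star v) @\<^sub>r (w * H * star v) = 0\<^sub>m (j + 1) 1"
    using H W v w by (simp add: append_rows_mult[of _ j n _ 1])
  then have 0: "W * H * star v = 0\<^sub>m j 1" "w * H * star v = 0\<^sub>m 1 1"
    by (rule append_rows_eq_zeroD; use H W v w in auto)+
  then have zero': "v * H * star w = 0\<^sub>m 1 1"
    using gram_star[OF H(1,2) w(1) v(1)] by simp
  obtain x y where xy: "x * cj x * d + y * cj y * e = 1"
    using univ[of d e] w(3) v(3) gram_entry_real[OF H(1,2) w(1)] gram_entry_real[OF H(1,2) v(1)]
    unfolding d_def e_def by blast
  define z where "z = x \<cdot>\<^sub>m w + y \<cdot>\<^sub>m v"
  have z: "z \<in> carrier_mat 1 n"
    using w v by (simp add: z_def)
  have expand: "A * H * star z = cj x \<cdot>\<^sub>m (A * H * star w) + cj y \<cdot>\<^sub>m (A * H * star v)"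
    if A: "A \<in> carrier_mat m n" for A m
  proof -
    have "star z = star (x \<cdot>\<^sub>m w) + star (y \<cdot>\<^sub>m v)"
      unfolding z_def using w v by (intro eq_matI) (auto simp: cj.hom_add)
    then have "A * H * star z = A * H * star (x \<cdot>\<^sub>m w) + A * H * star (y \<cdot>\<^sub>m v)"
      using A H w v by (simp add: mult_add_distrib_mat[of _ m n _ 1])
    then show ?thesis
      using smult_gram[OF H(1) A w(1), of 1 x] smult_gram[OF H(1) A v(1), of 1 y]
      by (simp add: one_smult_mat)
  qed
  have Wz: "W * H * star z = 0\<^sub>m j 1"
    using expand[OF W(1)] Ww 0 by (simp add: eq_matI)
  then have zW: "z * H * star W = 0\<^sub>m 1 j"
    using gram_star[OF H(1,2) W(1) z] by simp
  have wz: "w * H * star z = (cj x * d) \<cdot>\<^sub>m 1\<^sub>m 1"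
    unfolding expand[OF w(1)] ww 0 by (intro eq_matI) auto
  have vz: "v * H * star z = (cj y * e) \<cdot>\<^sub>m 1\<^sub>m 1"
    unfolding expand[OF v(1)] vv zero' by (intro eq_matI) auto
  have "z * H * star z = x \<cdot>\<^sub>m (w * H * star z) + y \<cdot>\<^sub>m (v * H * star z)"
  proof -
    have "z * H = (x \<cdot>\<^sub>m w) * H + (y \<cdot>\<^sub>m v) * H"
      unfolding z_def using w(1) v(1) H(1) by (intro add_mult_distrib_mat[of _ 1 n]) auto
    moreover have "((x \<cdot>\<^sub>m w) * H + (y \<cdot>\<^sub>m v) * H) * star z =
        (x \<cdot>\<^sub>m w) * H * star z + (y \<cdot>\<^sub>m v) * H * star z"
      using w(1) v(1) z H(1) by (intro add_mult_distrib_mat[of _ 1 n _ _ 1]) auto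
    ultimately have "z * H * star z = (x \<cdot>\<^sub>m w) * H * star z + (y \<cdot>\<^sub>m v) * H * star z"
      by simp
    then show ?thesis
      using smult_gram[OF H(1) w(1) z, of x 1] smult_gram[OF H(1) v(1) z, of y 1]
      by (simp add: one_smult_mat)
  qed
  also have "\<dots> = 1\<^sub>m 1"
    unfolding wz vz using xy by (intro eq_matI) (auto simp: ac_simps)
  finally have zz: "z * H * star z = 1\<^sub>m 1" .
  show ?case
  proof (intro bexI[of _ "W @\<^sub>r z"])
    show "(W @\<^sub>r z) * H * star (W @\<^sub>r z) = 1\<^sub>m (Suc j)"
      unfolding gram_append[OF H(1) W(1) z] W Wz zW zz by (intro eq_matI) auto
    show "W @\<^sub>r z \<in> carrier_mat (Suc j) n"
      using carrier_append_rows[OF W(1) z] by (simp add: Suc_eq_plus1)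
  qed
qed

text \<open>
  In the last dimension there is no second vector to combine with, so the value \<open>d\<close> remains.
\<close>

lemma diagonal_normal_form:
  assumes H: "H \<in> carrier_mat (Suc n) (Suc n)" "star H = H" "det H dvd 1"
    and univ: "\<And>d e. d dvd 1 \<Longrightarrow> e dvd 1 \<Longrightarrow> cj d = d \<Longrightarrow> cj e = e \<Longrightarrow>
      \<exists>x y. x * cj x * d + y * cj y * e = 1"
  obtains T d where "T \<in> carrier_mat (Suc n) (Suc n)" "d dvd 1"
    "T * H * star T = four_block_mat (1\<^sub>m n) (0\<^sub>m n 1) (0\<^sub>m 1 n) (d \<cdot>\<^sub>m 1\<^sub>m 1)"
proof -
  have "\<exists>W \<in> carrier_mat n (Suc n). W * H * star W = 1\<^sub>m n"
    by (rule orthonormal_rows[OF H univ lessI])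
  then obtain W where W: "W \<in> carrier_mat n (Suc n)" "W * H * star W = 1\<^sub>m n"
    by blast
  obtain w where w: "w \<in> carrier_mat 1 (Suc n)" "w * H * star W = 0\<^sub>m 1 n"
    "(w * H * star w) $$ (0, 0) dvd 1"
    using orthogonal_unit_vector[OF H W(1), of "1\<^sub>m n"] W by auto
  have Ww: "W * H * star w = 0\<^sub>m n 1"
    using gram_star[OF H(1,2) w(1) W(1)] w(2) by simp
  have ww: "w * H * star w = ((w * H * star w) $$ (0, 0)) \<cdot>\<^sub>m 1\<^sub>m 1"
    by (rule mat_1_1_eq) (use w H in auto)
  show thesis
  proof (rule that)
    show "W @\<^sub>r w \<in> carrier_mat (Suc n) (Suc n)"
      using carrier_append_rows[OF W(1) w(1)] by (simp add: Suc_eq_plus1)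
    show "(W @\<^sub>r w) * H * star (W @\<^sub>r w) = four_block_mat (1\<^sub>m n) (0\<^sub>m n 1) (0\<^sub>m 1 n)
        (((w * H * star w) $$ (0, 0)) \<cdot>\<^sub>m 1\<^sub>m 1)"
      unfolding gram_append[OF H(1) W(1) w(1)] W w(2) Ww using ww by simp
  qed (rule w(3))
qed

end

section \<open>Symmetric forms over the p-adic integers\<close>

lemma map_mat_ident [simp]: "map_mat id A = A"
  by (intro eq_matI) auto

lemma padic_two_unit: "odd CARD('p::prime_card) \<Longrightarrow> (2 :: 'p padic_int) dvd 1"
  using mod_ring_two_neq_0[where 'p='p] padic_red.hom_numeral[of "num.Bit0 num.One", where 'p='p]
  by (simp add: padic_unit_iff)

lemma padic_symmetric_local:
  assumes "odd CARD('p::prime_card)"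
  shows "hermitian_local_ring (id :: 'p padic_int \<Rightarrow> _) padic_red"
  by unfold_locales (simp_all add: padic_unit_iff[symmetric] padic_two_unit assms)

lemma quad_hermitian_local:
  assumes "inert_types TYPE('p::prime_card) TYPE('d)"
  shows "hermitian_local_ring (qconj :: ('p padic_int, 'd) quad \<Rightarrow> _) qred"
proof unfold_locales
  have "(2 :: ('p padic_int, 'd) quad) = qbase 2"
    by (metis numeral_One one_add_one qbase.hom_add qbase.hom_one)
  moreover obtain e where "1 = (2 :: 'p padic_int) * e"
    using padic_two_unit[where 'p='p] assms unfolding inert_types_def by (blast elim: dvdE)
  then have "1 = qbase 2 * (qbase e :: ('p padic_int, 'd) quad)"
    by (metis qbase.hom_mult qbase.hom_one)
  ultimately show "(2 :: ('p padic_int, 'd) quad) dvd 1"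
    by (metis dvd_triv_left)
qed (auto intro: quad_eqI simp: quad_unit_iff[OF assms, symmetric])

lemma det_block_diag_one:
  "det (four_block_mat (1\<^sub>m n) (0\<^sub>m n 1) (0\<^sub>m 1 n) (d \<cdot>\<^sub>m 1\<^sub>m 1)) = (d :: 'a::idom)"
  by (subst det_four_block_mat_upper_right_zero_col[of _ n]) auto

lemma congruence_det:
  fixes T :: "'a::comm_ring_1 mat"
  assumes "T \<in> carrier_mat n n" "G \<in> carrier_mat n n"
  shows "det (T * G * transpose_mat T) = (det T)\<^sup>2 * det G"
  using assms by (simp add: det_mult[of _ n] det_transpose power2_eq_square)

text \<open>
  Both forms have the normal form \<open>diag(1, \<dots>, 1, d)\<close>, where \<open>d\<close> is the determinant up to a square;
  whether two such \<open>d\<close> agree up to the square of a unit is decided modulo \<open>p\<close>.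
\<close>

lemma padic_symmetric_forms_equivalent:
  fixes G1 G2 :: "'p::prime_card padic_int mat"
  assumes odd: "odd CARD('p)"
    and G1: "G1 \<in> carrier_mat n n" "transpose_mat G1 = G1" "det G1 dvd 1"
    and G2: "G2 \<in> carrier_mat n n" "transpose_mat G2 = G2" "det G2 dvd 1"
    and c: "padic_red (det G1) = c\<^sup>2 * padic_red (det G2)"
  obtains T where "T \<in> carrier_mat n n" "det T dvd 1" "T * G2 * transpose_mat T = G1"
proof (cases n)
  case 0
  then show thesis
    using G1 G2 by (intro that[of "1\<^sub>m 0"]) auto
next
  case (Suc m)
  interpret hermitian_local_ring "id :: 'p padic_int \<Rightarrow> _" padic_red
    by (rule padic_symmetric_local[OF odd])
  have univ: "\<exists>x y. x * id x * d + y * id y * e = 1" if de: "d dvd 1" "e dvd 1" for d e :: "'p padic_int"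
  proof -
    obtain x y where "d * x\<^sup>2 + e * y\<^sup>2 = 1"
      by (rule padic_binary_form_universal[OF odd de dvd_refl])
    moreover have "x * x * d + y * y * e = d * x\<^sup>2 + e * y\<^sup>2"
      by (simp only: power2_eq_square mult.commute[of d] mult.commute[of e])
    ultimately have "x * x * d + y * y * e = 1"
      by simp
    then show ?thesis
      by (intro exI[of _ x] exI[of _ y]) simp
  qed
  let ?D = "\<lambda>d. four_block_mat (1\<^sub>m m) (0\<^sub>m m 1) (0\<^sub>m 1 m) (d \<cdot>\<^sub>m 1\<^sub>m 1) :: 'p padic_int mat"
  have D [simp]: "?D d \<in> carrier_mat n n" for d
    using Suc by auto
  have normal: "\<exists>T d. T \<in> carrier_mat n n \<and> d dvd 1 \<and> T * G * transpose_mat T = ?D d"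
    if "G \<in> carrier_mat n n" "transpose_mat G = G" "det G dvd 1" for G
  proof -
    have G: "G \<in> carrier_mat (Suc m) (Suc m)" "transpose_mat (map_mat id G) = G" "det G dvd 1"
      using that Suc by auto
    show ?thesis
    proof (rule diagonal_normal_form[OF G])
      fix d e :: "'p padic_int"
      assume "d dvd 1" "e dvd 1"
      then show "\<exists>x y. x * id x * d + y * id y * e = 1"
        by (rule univ)
    next
      fix T d
      assume "T \<in> carrier_mat (Suc m) (Suc m)" "d dvd 1" "T * G * transpose_mat (map_mat id T) = ?D d"
      then show ?thesis
        unfolding Suc map_mat_ident by (intro exI[of _ T] exI[of _ d] conjI)
    qed
  qed
  obtain T1 d1 where T1: "T1 \<in> carrier_mat n n" "d1 dvd 1" "T1 * G1 * transpose_mat T1 = ?D d1"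
    using normal[OF G1] by blast
  obtain T2 d2 where T2: "T2 \<in> carrier_mat n n" "d2 dvd 1" "T2 * G2 * transpose_mat T2 = ?D d2"
    using normal[OF G2] by blast
  have det1: "(det T1)\<^sup>2 * det G1 = d1"
    using congruence_det[OF T1(1) G1(1)] by (simp add: T1(3) det_block_diag_one)
  have det2: "(det T2)\<^sup>2 * det G2 = d2"
    using congruence_det[OF T2(1) G2(1)] by (simp add: T2(3) det_block_diag_one)
  obtain e2 where e2: "1 = d2 * e2"
    using T2(2) ..
  have r2: "padic_red d2 \<noteq> 0" "padic_red d1 \<noteq> 0"
    using T1 T2 by (simp_all add: padic_unit_iff)
  have re2: "padic_red e2 = 1 / padic_red d2"
    using r2(1) arg_cong[OF e2, of padic_red] by (simp add: padic_red.hom_mult field_simps)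
  define q where "q = padic_red (det T1) * c / padic_red (det T2)"
  have t: "padic_red (det T2) \<noteq> 0" "padic_red (det G2) \<noteq> 0"
    using r2(1) unfolding det2[symmetric] by (auto simp: hom_distribs)
  have "padic_red (d1 * e2) = q\<^sup>2"
    using t unfolding padic_red.hom_mult re2 det1[symmetric] det2[symmetric] q_def
    by (simp add: hom_distribs c power_divide power_mult_distrib field_simps)
  moreover from this have "q \<noteq> 0"
    using r2 re2 by (auto simp: padic_red.hom_mult)
  ultimately obtain s where s: "s\<^sup>2 = d1 * e2"
    using padic_square_root[OF odd] by metis
  have sd: "s * (d2 * s) = d1"
  proof -
    have "s * (d2 * s) = s\<^sup>2 * d2"
      by (simp add: power2_eq_square ac_simps)
    also have "\<dots> = d1"
      unfolding s using e2 by (simp add: ac_simps)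
    finally show ?thesis .
  qed
  have tD: "transpose_mat (?D s) = ?D s"
    by (subst transpose_four_block_mat[of _ m m _ 1 _ 1]) auto
  have SDS: "?D s * ?D d2 * transpose_mat (?D s) = ?D d1"
    unfolding tD
  proof -
    have mult: "?D a * ?D b = ?D (a * b)" for a b
      by (subst mult_four_block_mat[of _ m m _ 1 _ 1 _ _ m _ 1])
        (auto simp: mult_smult_distrib[of _ 1 1 _ 1] mult_smult_assoc_mat[of _ 1 1 _ 1] intro!: eq_matI)
    show "?D s * ?D d2 * ?D s = ?D d1"
      unfolding mult sd[symmetric] by (simp only: mult.assoc)
  qed
  have "det T1 dvd 1"
    using T1(2) unfolding det1[symmetric] by (metis dvd_mult_left dvd_trans power2_eq_square dvd_triv_left)
  then obtain V where V: "V \<in> carrier_mat n n" "T1 * V = 1\<^sub>m n" "V * T1 = 1\<^sub>m n"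
    using unit_det_imp_inverse[OF T1(1)] by metis
  have cong: "(A * B) * G * transpose_mat (A * B) = A * (B * G * transpose_mat B) * transpose_mat A"
    if "A \<in> carrier_mat n n" "B \<in> carrier_mat n n" "G \<in> carrier_mat n n" for A B G :: "'p padic_int mat"
    using that by (simp add: transpose_mult[of _ n n _ n] assoc_mult_mat[of _ n n _ n _ n])
  define T where "T = V * (?D s * T2)"
  have T: "T \<in> carrier_mat n n"
    unfolding T_def by (rule mult_carrier_mat[OF V(1) mult_carrier_mat[OF D T2(1)]])
  have "T * G2 * transpose_mat T = V * (?D s * (T2 * G2 * transpose_mat T2) * transpose_mat (?D s)) * transpose_mat V"
    unfolding T_def cong[OF V(1) mult_carrier_mat[OF D T2(1)] G2(1)] cong[OF D T2(1) G2(1)] ..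
  also have "\<dots> = V * (T1 * G1 * transpose_mat T1) * transpose_mat V"
    unfolding T2(3) SDS T1(3) ..
  also have "\<dots> = (V * T1) * G1 * transpose_mat (V * T1)"
    using cong[OF V(1) T1(1) G1(1)] by simp
  also have "\<dots> = G1"
    using V(3) G1(1) by simp
  finally have TG: "T * G2 * transpose_mat T = G1" .
  have "det T dvd det G1"
    using congruence_det[OF T G2(1)] by (simp add: TG power2_eq_square)
  then show thesis
    using G1(3) dvd_trans by (intro that[OF T _ TG]) blast
qed

section \<open>Unitary similitudes\<close>

lemma sig_mat_carrier [simp]: "i \<le> g \<Longrightarrow> sig_mat g i \<in> carrier_mat g g"
  by (auto simp: sig_mat_def)

lemma sig_mat_dim [simp]:
  "i \<le> g \<Longrightarrow> dim_row (sig_mat g i) = g" "i \<le> g \<Longrightarrow> dim_col (sig_mat g i) = g"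
  by (auto simp: sig_mat_def)

lemma sig_mat_index:
  assumes "i \<le> g" "r < g" "c < g"
  shows "sig_mat g i $$ (r, c) = (if r = c then (if r < i then 1 else - 1) else 0)"
  using assms by (auto simp: sig_mat_def)

interpretation qconj: ring_with_involution "qconj :: ('a::comm_ring_1, 'd) quad \<Rightarrow> _"
  by unfold_locales (auto intro: quad_eqI)

lemma star_sig_mat:
  "i \<le> g \<Longrightarrow> qconj.star (sig_mat g i :: ('a::comm_ring_1, 'd) quad mat) = sig_mat g i"
  by (intro eq_matI) (auto simp: sig_mat_index intro: quad_eqI)

lemma sig_mat_square:
  assumes "i \<le> g"
  shows "sig_mat g i * sig_mat g i = (1\<^sub>m g :: 'a::comm_ring_1 mat)"
proof (rule eq_matI)
  fix r c
  assume "r < dim_row (1\<^sub>m g :: 'a mat)" "c < dim_col (1\<^sub>m g :: 'a mat)"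
  then have rc: "r < g" "c < g"
    by auto
  have "(sig_mat g i * sig_mat g i :: 'a mat) $$ (r, c) =
      (\<Sum>k = 0..<g. sig_mat g i $$ (r, k) * sig_mat g i $$ (k, c))"
    using rc assms by (simp add: scalar_prod_def)
  also have "\<dots> = (\<Sum>k = 0..<g. if k = r then (if r = c then 1 else 0) else 0)"
    using rc assms by (intro sum.cong) (auto simp: sig_mat_index)
  finally show "(sig_mat g i * sig_mat g i) $$ (r, c) = (1\<^sub>m g :: 'a mat) $$ (r, c)"
    using rc by simp
qed (use assms in auto)

lemma sig_mat_det_unit:
  "i \<le> g \<Longrightarrow> det (sig_mat g i :: 'a::comm_ring_1 mat) dvd 1"
  by (rule right_inverse_imp_unit_det[OF _ _ sig_mat_square]) auto

lemma qbase_unit: "x dvd 1 \<Longrightarrow> (qbase x :: ('a::comm_ring_1, 'd) quad) dvd 1"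
  by (metis dvd_def qbase.hom_mult qbase.hom_one)

lemma star_map_qbase: "qconj.star (map_mat qbase G) = map_mat qbase (transpose_mat G)"
  by (intro eq_matI) (auto intro: quad_eqI)

lemma padic_eq_uminus_imp_0:
  assumes "odd CARD('p)" "- x = (x :: 'p::prime_card padic_int)"
  shows "x = 0"
proof -
  obtain e where "1 = (2 :: 'p padic_int) * e"
    using padic_two_unit[OF assms(1)] ..
  moreover have "2 * x = 0"
    using assms(2) by (metis add.right_inverse mult_2)
  ultimately show ?thesis
    by (metis mult.commute mult.left_commute mult_1 mult_zero_right)
qed

text \<open>
  A unit fixed by conjugation lies in \<open>\<int>\<^sub>p\<close>, because \<open>2\<close> is invertible, and all units of \<open>\<int>\<^sub>p\<close> are
  norms.
\<close>

lemma hermitian_unit_rescale: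
  fixes d :: "('p::prime_card padic_int, 'd) quad"
  assumes inert: "inert_types TYPE('p) TYPE('d)" and d: "d dvd 1" "qconj d = d" and k: "k dvd 1"
  shows "\<exists>u. u * qconj u * d = qbase k"
proof -
  have "- qim d = qim d"
    using arg_cong[OF d(2), of qim] by simp
  then have "qim d = 0"
    using padic_eq_uminus_imp_0 inert unfolding inert_types_def by blast
  then have dq: "d = qbase (qre d)"
    by (intro quad_eqI) simp_all
  have "(qre d)\<^sup>2 dvd 1"
    using d(1) \<open>qim d = 0\<close> unfolding quad_unit_iff_qnorm by (simp add: qnorm_def)
  then have "qre d dvd 1"
    unfolding power2_eq_square by (rule dvd_mult_left)
  then obtain e where e: "1 = qre d * e" ..
  then have "e dvd 1"
    by (metis dvd_triv_right)
  then have "k * e dvd 1"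
    using k by (simp add: is_unit_mult_iff)
  then obtain u :: "('p padic_int, 'd) quad" where u: "qnorm u = k * e"
    using qnorm_surj_units[OF inert] by blast
  have "u * qconj u * d = qbase (k * e * qre d)"
    by (subst dq) (simp only: quad_mult_qconj u qbase.hom_mult)
  also have "k * e * qre d = k"
    using e by (simp add: ac_simps)
  finally show ?thesis
    by blast
qed

lemma unitary_complement:
  fixes B :: "('p::prime_card padic_int, 'd) quad mat"
  assumes inert: "inert_types TYPE('p) TYPE('d)" and i: "i \<le> g" and m: "m \<le> g"
    and B: "B \<in> carrier_mat m g" and G: "G \<in> carrier_mat m m" "det G dvd 1"
    and gram: "unitary_form g i B = map_mat qbase G" and k: "k dvd 1"
  shows "\<exists>W \<in> carrier_mat (g - m) g. W * sig_mat g i * qconj.star B = 0\<^sub>m (g - m) m \<and>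
    unitary_form g i W = qbase k \<cdot>\<^sub>m 1\<^sub>m (g - m)"
proof -
  interpret L: hermitian_local_ring "qconj :: ('p padic_int, 'd) quad \<Rightarrow> _" qred
    by (rule quad_hermitian_local[OF inert])
  obtain K where K: "K \<in> carrier_mat m m" "K * G = 1\<^sub>m m"
    using unit_det_imp_inverse[OF G] by metis
  have inv: "map_mat qbase K * (B * sig_mat g i * qconj.star B) = 1\<^sub>m m"
    using gram K G unfolding unitary_form_def
    by (metis qbase.mat_hom_mult qbase.mat_hom_one)
  show ?thesis
    unfolding unitary_form_def
    by (rule L.scaled_orthonormal_complement[OF _ star_sig_mat _ B _ inv])
      (use i m k K inert in \<open>auto simp: sig_mat_det_unit qbase_unit intro!: hermitian_unit_rescale\<close>)
qed

lemma append_rows_inject: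
  assumes "A @\<^sub>r B = C @\<^sub>r D" "A \<in> carrier_mat k n" "C \<in> carrier_mat k n"
    "B \<in> carrier_mat l n" "D \<in> carrier_mat l n"
  shows "B = D"
proof (rule eq_matI)
  fix i j
  assume "i < dim_row D" "j < dim_col D"
  then show "B $$ (i, j) = D $$ (i, j)"
    using arg_cong[OF assms(1), of "\<lambda>X. X $$ (k + i, j)"] assms(2-) by (simp add: append_rows_def)
qed (use assms in auto)

lemma unitary_form_mult:
  fixes A X :: "('a::comm_ring_1, 'd) quad mat"
  assumes "i \<le> g" and AX: "A \<in> carrier_mat a b" "X \<in> carrier_mat b g"
  shows "unitary_form g i (A * X) = A * unitary_form g i X * qconj.star A"
proof -
  let ?E = "sig_mat g i :: ('a, 'd) quad mat"
  note E = sig_mat_carrier[OF assms(1), where 'a="('a, 'd) quad"]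
  have c: "A * X \<in> carrier_mat a g" "qconj.star X \<in> carrier_mat g b" "qconj.star A \<in> carrier_mat b a"
    "X * ?E \<in> carrier_mat b g" "X * ?E * qconj.star X \<in> carrier_mat b b"
    using AX E by auto
  have "A * X * ?E * (qconj.star X * qconj.star A) = A * (X * ?E) * (qconj.star X * qconj.star A)"
    using AX E by (simp add: assoc_mult_mat[of A a b X g ?E g])
  also have "\<dots> = A * (X * ?E) * qconj.star X * qconj.star A"
    using AX c by (intro assoc_mult_mat[symmetric, of _ a g _ b _ a]) auto
  also have "A * (X * ?E) * qconj.star X = A * (X * ?E * qconj.star X)"
    using AX c by (intro assoc_mult_mat[of _ a b _ g _ b]) auto
  finally show ?thesis
    unfolding unitary_form_def qconj.star_mult[OF AX] .
qed

text \<open>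
  Witt's extension: the rows of \<open>B\<^sub>1\<close> and of \<open>T B\<^sub>2\<close> are completed by orthogonal complements with Gram
  matrices \<open>1\<close> and \<open>l\<close>.  The Gram matrices of the completed bases \<open>X\<^sub>1\<close> and \<open>X\<^sub>3\<close> then differ by
  the factor \<open>l\<close>, and \<open>X\<^sub>1\<^sup>-\<^sup>1 X\<^sub>3\<close> is the similitude.
\<close>

lemma similitude_carrying:
  fixes B1 B2 :: "('p::prime_card padic_int, 'd) quad mat"
  assumes inert: "inert_types TYPE('p) TYPE('d)" and i: "i \<le> g" and m: "m \<le> g"
    and B: "B1 \<in> carrier_mat m g" "B2 \<in> carrier_mat m g"
    and G: "G1 \<in> carrier_mat m m" "det G1 dvd 1" "G2 \<in> carrier_mat m m"
    and gram: "unitary_form g i B1 = map_mat qbase G1" "unitary_form g i B2 = map_mat qbase G2"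
    and l: "l dvd 1"
    and T: "T \<in> carrier_mat m m" "T * G2 * transpose_mat T = l \<cdot>\<^sub>m G1"
  obtains M where "M \<in> unitary_similitudes g i" "unitary_form g i M = qbase l \<cdot>\<^sub>m sig_mat g i"
    "B1 * M = map_mat qbase T * B2"
proof -
  let ?E = "sig_mat g i :: ('p padic_int, 'd) quad mat"
  let ?T = "map_mat qbase T :: ('p padic_int, 'd) quad mat"
  note E = sig_mat_carrier[OF i, where 'a="('p padic_int, 'd) quad"]
  note uf = unitary_form_mult[OF i]
  define B3 where "B3 = ?T * B2"
  have B3: "B3 \<in> carrier_mat m g"
    using T B by (simp add: B3_def)
  have gram3: "unitary_form g i B3 = map_mat qbase (l \<cdot>\<^sub>m G1)"
  proof -
    have "unitary_form g i B3 = ?T * map_mat qbase G2 * map_mat qbase (transpose_mat T)"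
      unfolding B3_def using T B by (subst uf[of _ m m]) (auto simp: gram star_map_qbase)
    also have "\<dots> = map_mat qbase (T * G2 * transpose_mat T)"
      using T(1) G by (simp add: qbase.mat_hom_mult[of _ m m _ m])
    finally show ?thesis
      unfolding T(2) .
  qed
  have det3: "det (l \<cdot>\<^sub>m G1) dvd 1"
    using G l dvd_power_same[of l 1 m] by (simp add: is_unit_mult_iff)
  obtain W1 where W1: "W1 \<in> carrier_mat (g - m) g" "W1 * ?E * qconj.star B1 = 0\<^sub>m (g - m) m"
    "unitary_form g i W1 = qbase 1 \<cdot>\<^sub>m 1\<^sub>m (g - m)"
    using unitary_complement[OF inert i m B(1) G(1,2) gram(1), of 1] by auto
  obtain W3 where W3: "W3 \<in> carrier_mat (g - m) g" "W3 * ?E * qconj.star B3 = 0\<^sub>m (g - m) m"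
    "unitary_form g i W3 = qbase l \<cdot>\<^sub>m 1\<^sub>m (g - m)"
    using unitary_complement[OF inert i m B3 _ det3 gram3 l] G by auto
  note gs = qconj.gram_star[OF E star_sig_mat[OF i]]
  have BW: "B1 * ?E * qconj.star W1 = 0\<^sub>m m (g - m)" "B3 * ?E * qconj.star W3 = 0\<^sub>m m (g - m)"
    using gs[OF W1(1) B(1)] gs[OF W3(1) B3] W1(2) W3(2) by simp_all
  define X1 where "X1 = W1 @\<^sub>r B1"
  define X3 where "X3 = W3 @\<^sub>r B3"
  have X: "X1 \<in> carrier_mat g g" "X3 \<in> carrier_mat g g"
    using carrier_append_rows[OF W1(1) B(1)] carrier_append_rows[OF W3(1) B3] m
    by (simp_all add: X1_def X3_def)
  have gram_append: "unitary_form g i (W @\<^sub>r B) =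
      four_block_mat (unitary_form g i W) (W * ?E * qconj.star B) (B * ?E * qconj.star W) (unitary_form g i B)"
    if "W \<in> carrier_mat (g - m) g" "B \<in> carrier_mat m g" for W B
    unfolding unitary_form_def by (rule qconj.gram_append[OF E that])
  let ?D = "four_block_mat (1\<^sub>m (g - m)) (0\<^sub>m (g - m) m) (0\<^sub>m m (g - m)) (map_mat qbase G1)
    :: ('p padic_int, 'd) quad mat"
  have D: "?D \<in> carrier_mat g g"
    using G m by auto
  have X1D: "unitary_form g i X1 = ?D"
    unfolding X1_def gram_append[OF W1(1) B(1)] W1 BW gram qbase.hom_one qconj.one_smult_mat ..
  have X3D: "unitary_form g i X3 = qbase l \<cdot>\<^sub>m ?D"
    unfolding X3_def gram_append[OF W3(1) B3] W3 BW gram3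
    using G m by (intro eq_matI) (auto simp: qbase.hom_mult)
  obtain K where K: "K \<in> carrier_mat m m" "G1 * K = 1\<^sub>m m"
    using unit_det_imp_inverse[OF G(1,2)] by metis
  let ?K = "four_block_mat (1\<^sub>m (g - m)) (0\<^sub>m (g - m) m) (0\<^sub>m m (g - m)) (map_mat qbase K)
    :: ('p padic_int, 'd) quad mat"
  have Kc: "?K \<in> carrier_mat g g"
    using K m by auto
  have "?D * ?K = 1\<^sub>m (g - m + m)"
    using K G by (intro block_diag_inverse)
      (auto simp: qbase.mat_hom_mult[OF G(1) K(1), symmetric] qbase.mat_hom_one)
  then have DK: "?D * ?K = 1\<^sub>m g"
    using m by simp
  have sX: "qconj.star X1 \<in> carrier_mat g g"
    using X by simp
  have "X1 * (?E * qconj.star X1 * ?K) = X1 * (?E * qconj.star X1) * ?K"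
    using X(1) E sX Kc by (intro assoc_mult_mat[symmetric, of _ g g _ g _ g]) auto
  also have "X1 * (?E * qconj.star X1) = ?D"
    unfolding X1D[symmetric] unitary_form_def using X(1) E sX
    by (intro assoc_mult_mat[symmetric, of _ g g _ g _ g]) auto
  finally have "X1 * (?E * qconj.star X1 * ?K) = 1\<^sub>m g"
    by (simp only: DK)
  then have "det X1 dvd 1"
    by (rule right_inverse_imp_unit_det[OF X(1) mult_carrier_mat[OF mult_carrier_mat[OF E sX] Kc]])
  then obtain V where V: "V \<in> carrier_mat g g" "X1 * V = 1\<^sub>m g" "V * X1 = 1\<^sub>m g"
    using unit_det_imp_inverse[OF X(1)] by metis
  define M where "M = V * X3"
  have M: "M \<in> carrier_mat g g"
    using V X by (simp add: M_def)
  have "unitary_form g i M = V * (qbase l \<cdot>\<^sub>m ?D) * qconj.star V"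
    unfolding M_def using uf[OF V(1) X(2)] by (simp add: X3D)
  also have "\<dots> = qbase l \<cdot>\<^sub>m (V * ?D * qconj.star V)"
    using V D by (simp add: mult_smult_distrib[of V g g _ g] mult_smult_assoc_mat[of _ g g _ g])
  also have "V * ?D * qconj.star V = unitary_form g i (V * X1)"
    using uf[OF V(1) X(1)] by (simp add: X1D)
  also have "\<dots> = ?E"
    using E V(3) by (simp add: unitary_form_def)
  finally have ufM: "unitary_form g i M = qbase l \<cdot>\<^sub>m ?E" .
  have "X1 * M = X3"
    unfolding M_def using X V by (simp add: assoc_mult_mat[of X1 g g V g X3 g, symmetric])
  then have "(W1 * M) @\<^sub>r (B1 * M) = W3 @\<^sub>r B3"
    unfolding X1_def X3_def using append_rows_mult[OF W1(1) B(1) M] by simp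
  then have "B1 * M = B3"
    by (rule append_rows_inject[of _ _ _ _ "g - m" g m]) (use W1 W3 B B3 M in auto)
  moreover have "M \<in> unitary_similitudes g i"
    using M ufM l by (auto simp: unitary_similitudes_def)
  ultimately show thesis
    using ufM by (intro that) (simp_all add: B3_def)
qed

section \<open>Symplectic rows as hermitian vectors\<close>

definition sig_sign :: "nat \<Rightarrow> nat \<Rightarrow> 'a::comm_ring_1" where
  "sig_sign i c = (if c < i then 1 else - 1)"

lemma sig_sign_square [simp]: "sig_sign i c * sig_sign i c = 1" "sig_sign i c * (sig_sign i c * x) = x"
  by (simp_all add: sig_sign_def)

lemma sig_mat_sign:
  assumes "i \<le> g" "r < g" "c < g"
  shows "sig_mat g i $$ (r, c) = (if r = c then sig_sign i c else 0)"
  using assms by (simp add: sig_mat_index sig_sign_def)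

lemma mult_sig_mat_index:
  fixes K :: "'a::comm_ring_1 mat"
  assumes "i \<le> g" "K \<in> carrier_mat m g" "r < m" "c < g"
  shows "(K * sig_mat g i) $$ (r, c) = K $$ (r, c) * sig_sign i c"
proof -
  have "(K * sig_mat g i) $$ (r, c) = (\<Sum>t = 0..<g. K $$ (r, t) * sig_mat g i $$ (t, c))"
    using assms by (simp add: scalar_prod_def)
  also have "\<dots> = (\<Sum>t = 0..<g. if t = c then K $$ (r, c) * sig_sign i c else 0)"
    using assms by (intro sum.cong) (auto simp: sig_mat_sign)
  finally show ?thesis
    using assms by simp
qed

lemma sig_mat_mult_index:
  fixes K :: "'a::comm_ring_1 mat"
  assumes "i \<le> g" "K \<in> carrier_mat g m" "r < g" "c < m"
  shows "(sig_mat g i * K) $$ (r, c) = sig_sign i r * K $$ (r, c)"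
proof -
  have "(sig_mat g i * K) $$ (r, c) = (\<Sum>t = 0..<g. sig_mat g i $$ (r, t) * K $$ (t, c))"
    using assms by (simp add: scalar_prod_def)
  also have "\<dots> = (\<Sum>t = 0..<g. if t = r then sig_sign i r * K $$ (r, c) else 0)"
    using assms by (intro sum.cong) (auto simp: sig_mat_sign)
  finally show ?thesis
    using assms by simp
qed

lemma hermitian_form_index:
  fixes X Y :: "('a::comm_ring_1, 'd) quad mat"
  assumes "i \<le> g" "X \<in> carrier_mat a g" "Y \<in> carrier_mat b g" "r < a" "s < b"
  shows "(X * sig_mat g i * qconj.star Y) $$ (r, s) =
    (\<Sum>t = 0..<g. X $$ (r, t) * sig_sign i t * qconj (Y $$ (s, t)))"
proof -
  have "X * sig_mat g i \<in> carrier_mat a g"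
    using assms by (auto intro: mult_carrier_mat)
  then have "(X * sig_mat g i * qconj.star Y) $$ (r, s) =
      (\<Sum>t = 0..<g. (X * sig_mat g i) $$ (r, t) * qconj (Y $$ (s, t)))"
    using assms by (simp add: scalar_prod_def del: index_mult_mat(1)) (simp add: scalar_prod_def)
  also have "\<dots> = (\<Sum>t = 0..<g. X $$ (r, t) * sig_sign i t * qconj (Y $$ (s, t)))"
    using assms by (intro sum.cong) (simp_all add: mult_sig_mat_index del: index_mult_mat(1))
  finally show ?thesis .
qed

lemma sum_two_blocks:
  fixes f :: "nat \<Rightarrow> 'a::comm_monoid_add"
  shows "(\<Sum>t = 0..<m + n. f t) = (\<Sum>t = 0..<m. f t) + (\<Sum>t = 0..<n. f (m + t))"
  using sum.atLeastLessThan_concat[of 0 m "m + n" f] sum.shift_bounds_nat_ivl[of f 0 m n]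
  by (simp add: add.commute)

lemma qre_sum: "qre (\<Sum>k\<in>K. f k :: ('a::comm_ring_1, 'd) quad) = (\<Sum>k\<in>K. qre (f k))"
  by (induction K rule: infinite_finite_induct) simp_all

text \<open>
  The row \<open>(x, y)\<close> is read as \<open>x + y E \<surd>-\<Delta>\<close>.
\<close>

definition hermitian_rows :: "nat \<Rightarrow> nat \<Rightarrow> 'a::comm_ring_1 mat \<Rightarrow> ('a, 'd) quad mat" where
  "hermitian_rows g i X =
     mat (dim_row X) g (\<lambda>(r, c). Quad (X $$ (r, c)) (sig_sign i c * X $$ (r, g + c)))"

lemma hermitian_rows_carrier [simp]: "X \<in> carrier_mat m n \<Longrightarrow> hermitian_rows g i X \<in> carrier_mat m g"
  by (simp add: hermitian_rows_def)

lemma hermitian_rows_dim [simp]: "dim_row (hermitian_rows g i X) = dim_row X" "dim_col (hermitian_rows g i X) = g"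
  by (simp_all add: hermitian_rows_def)

lemma hermitian_rows_index: "r < dim_row X \<Longrightarrow> c < g \<Longrightarrow>
    hermitian_rows g i X $$ (r, c) = Quad (X $$ (r, c)) (sig_sign i c * X $$ (r, g + c))"
  by (simp add: hermitian_rows_def)

lemma alpha_carrier [simp]: "i \<le> g \<Longrightarrow> M \<in> carrier_mat g g \<Longrightarrow> alpha g i M \<in> carrier_mat (g + g) (g + g)"
  by (auto simp: alpha_def Let_def)

lemma alpha_index:
  assumes "i \<le> g" "M \<in> carrier_mat g g" "r < g" "c < g"
  shows "alpha g i M $$ (r, c) = qre (M $$ (r, c))"
    and "alpha g i M $$ (r, g + c) = qim (M $$ (r, c)) * sig_sign i c"
    and "alpha g i (M :: ('a::comm_ring_1, 'd) quad mat) $$ (g + r, c) =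
      - of_nat CARD('d) * (sig_sign i r * qim (M $$ (r, c)))"
    and "alpha g i M $$ (g + r, g + c) = sig_sign i r * qre (M $$ (r, c)) * sig_sign i c"
proof -
  have M: "map_mat qre M \<in> carrier_mat g g" "map_mat qim M \<in> carrier_mat g g"
    using assms by auto
  have E: "sig_mat g i * map_mat qre M \<in> carrier_mat g g"
    using assms by (intro mult_carrier_mat[of _ g g]) auto
  show "alpha g i M $$ (r, c) = qre (M $$ (r, c))"
    "alpha g i M $$ (r, g + c) = qim (M $$ (r, c)) * sig_sign i c"
    "alpha g i M $$ (g + r, c) = - of_nat CARD('d) * (sig_sign i r * qim (M $$ (r, c)))"
    "alpha g i M $$ (g + r, g + c) = sig_sign i r * qre (M $$ (r, c)) * sig_sign i c"
    using assms by (simp_all add: alpha_def Let_def mult_sig_mat_index[OF assms(1) M(2)]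
        sig_mat_mult_index[OF assms(1) M(2)] mult_sig_mat_index[OF assms(1) E]
        sig_mat_mult_index[OF assms(1) M(1)] del: index_mult_mat(1))
qed

lemma mat_mult_index_sum:
  assumes "A \<in> carrier_mat a b" "B \<in> carrier_mat b c" "r < a" "s < c"
  shows "(A * B) $$ (r, s) = (\<Sum>t = 0..<b. A $$ (r, t) * B $$ (t, s))"
  using assms by (simp add: scalar_prod_def)

text \<open>
  This explains the shape of \<open>\<alpha>\<close>: it is the action of \<open>M\<close> on \<open>x + y E \<surd>-\<Delta>\<close> written in real
  coordinates.
\<close>

lemma hermitian_rows_mult_alpha:
  fixes M :: "('a::comm_ring_1, 'd) quad mat"
  assumes i: "i \<le> g" and X: "X \<in> carrier_mat m (g + g)" and M: "M \<in> carrier_mat g g"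
  shows "hermitian_rows g i (X * alpha g i M) = hermitian_rows g i X * M"
proof (rule eq_matI)
  fix r c
  assume "r < dim_row (hermitian_rows g i X * M)" "c < dim_col (hermitian_rows g i X * M)"
  then have rc: "r < m" "c < g"
    using X M by auto
  have ix: "(X * alpha g i M) $$ (r, s) =
      (\<Sum>t = 0..<g. X $$ (r, t) * alpha g i M $$ (t, s)) +
      (\<Sum>t = 0..<g. X $$ (r, g + t) * alpha g i M $$ (g + t, s))" if "s < g + g" for s
    using that rc by (simp only: mat_mult_index_sum[OF X alpha_carrier[OF i M]] sum_two_blocks)
  have RHS: "(hermitian_rows g i X * M) $$ (r, c) = (\<Sum>t = 0..<g. hermitian_rows g i X $$ (r, t) * M $$ (t, c))"
    by (rule mat_mult_index_sum) (use X M rc in auto)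
  have "qre ((hermitian_rows g i X * M) $$ (r, c)) = (X * alpha g i M) $$ (r, c)"
  proof -
    have "(X * alpha g i M) $$ (r, c) = (\<Sum>t = 0..<g. X $$ (r, t) * qre (M $$ (t, c)) +
        X $$ (r, g + t) * (- of_nat CARD('d) * (sig_sign i t * qim (M $$ (t, c)))))"
      using rc by (simp add: ix alpha_index[OF i M] sum.distrib sum_subtractf sum_negf del: index_mult_mat(1))
    also have "\<dots> = (\<Sum>t = 0..<g. qre (hermitian_rows g i X $$ (r, t) * M $$ (t, c)))"
      using rc X by (intro sum.cong refl) (auto simp: hermitian_rows_index algebra_simps)
    finally show ?thesis
      unfolding RHS qre_sum by (rule sym)
  qed
  moreover have "qim ((hermitian_rows g i X * M) $$ (r, c)) = sig_sign i c * (X * alpha g i M) $$ (r, g + c)"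
  proof -
    have "(X * alpha g i M) $$ (r, g + c) = (\<Sum>t = 0..<g. X $$ (r, t) * (qim (M $$ (t, c)) * sig_sign i c) +
        X $$ (r, g + t) * (sig_sign i t * qre (M $$ (t, c)) * sig_sign i c))"
      using rc by (simp add: ix alpha_index[OF i M] sum.distrib sum_subtractf sum_negf del: index_mult_mat(1))
    then have "sig_sign i c * (X * alpha g i M) $$ (r, g + c) =
        (\<Sum>t = 0..<g. qim (hermitian_rows g i X $$ (r, t) * M $$ (t, c)))"
      unfolding sum_distrib_left using rc X
      by (simp only: sum_distrib_left) (intro sum.cong refl, auto simp: hermitian_rows_index algebra_simps)
    then show ?thesis
      unfolding RHS qim_sum by (rule sym)
  qed
  moreover have "hermitian_rows g i (X * alpha g i M) $$ (r, c) =
      Quad ((X * alpha g i M) $$ (r, c)) (sig_sign i c * (X * alpha g i M) $$ (r, g + c))"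
    using X rc by (intro hermitian_rows_index) auto
  ultimately show "hermitian_rows g i (X * alpha g i M) $$ (r, c) = (hermitian_rows g i X * M) $$ (r, c)"
    by (metis quad.collapse)
qed (use X M in auto)

lemma hermitian_rows_mult_left:
  assumes N: "N \<in> carrier_mat k m" and X: "X \<in> carrier_mat m (g + g)"
  shows "hermitian_rows g i (N * X) = map_mat qbase N * hermitian_rows g i X"
proof (rule eq_matI)
  fix r c
  assume "r < dim_row (map_mat qbase N * hermitian_rows g i X)" "c < dim_col (map_mat qbase N * hermitian_rows g i X)"
  then have rc: "r < k" "c < g"
    using N by auto
  have LHS: "hermitian_rows g i (N * X) $$ (r, c) = Quad ((N * X) $$ (r, c)) (sig_sign i c * (N * X) $$ (r, g + c))"
    using N rc by (intro hermitian_rows_index) auto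
  have RHS: "(map_mat qbase N * hermitian_rows g i X) $$ (r, c) =
      (\<Sum>t = 0..<m. qbase (N $$ (r, t)) * hermitian_rows g i X $$ (t, c))"
    using N X rc by (subst mat_mult_index_sum[of _ k m _ g]) auto
  show "hermitian_rows g i (N * X) $$ (r, c) = (map_mat qbase N * hermitian_rows g i X) $$ (r, c)"
    unfolding LHS RHS using rc X N
    by (intro quad_eqI) (simp_all add: qre_sum qim_sum hermitian_rows_index mat_mult_index_sum[OF N X]
        sum_distrib_left mult.left_commute del: index_mult_mat(1))
qed (use N X in auto)

definition symp_mat :: "nat \<Rightarrow> 'a::comm_ring_1 mat" where
  "symp_mat g = four_block_mat (0\<^sub>m g g) (1\<^sub>m g) (- 1\<^sub>m g) (0\<^sub>m g g)"

lemma symp_mat_carrier [simp]: "symp_mat g \<in> carrier_mat (g + g) (g + g)"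
  by (simp add: symp_mat_def)

lemma symp_mat_dim [simp]: "dim_row (symp_mat g) = g + g" "dim_col (symp_mat g) = g + g"
  by (simp_all add: symp_mat_def)

lemma symp_mat_index:
  "r < g + g \<Longrightarrow> s < g + g \<Longrightarrow>
    symp_mat g $$ (r, s) = (if s = r + g then 1 else if r = s + g then - 1 else 0)"
  by (auto simp: symp_mat_def)

lemma mult_symp_mat_index:
  fixes X :: "'a::comm_ring_1 mat"
  assumes "X \<in> carrier_mat m (g + g)" "r < m" "t < g"
  shows "(X * symp_mat g) $$ (r, t) = - X $$ (r, g + t)"
    and "(X * symp_mat g) $$ (r, g + t) = X $$ (r, t)"
proof -
  have "(X * symp_mat g) $$ (r, t) = (\<Sum>u = 0..<g + g. X $$ (r, u) * symp_mat g $$ (u, t))"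
    using assms by (intro mat_mult_index_sum[OF assms(1) symp_mat_carrier]) auto
  also have "\<dots> = (\<Sum>u = 0..<g + g. if u = g + t then - X $$ (r, g + t) else 0)"
    using assms by (intro sum.cong refl) (auto simp: symp_mat_index add.commute)
  finally show "(X * symp_mat g) $$ (r, t) = - X $$ (r, g + t)"
    using assms by simp
  have "(X * symp_mat g) $$ (r, g + t) = (\<Sum>u = 0..<g + g. X $$ (r, u) * symp_mat g $$ (u, g + t))"
    using assms by (intro mat_mult_index_sum[OF assms(1) symp_mat_carrier]) auto
  also have "\<dots> = (\<Sum>u = 0..<g + g. if u = t then X $$ (r, t) else 0)"
    using assms by (intro sum.cong refl) (auto simp: symp_mat_index)
  finally show "(X * symp_mat g) $$ (r, g + t) = X $$ (r, t)"
    using assms by simp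
qed

lemma symp_form_eq_qim:
  fixes X Y :: "'a::comm_ring_1 mat"
  assumes i: "i \<le> g" and X: "X \<in> carrier_mat a (g + g)" and Y: "Y \<in> carrier_mat b (g + g)"
    and rs: "r < a" "s < b"
  shows "(X * symp_mat g * transpose_mat Y) $$ (r, s) =
    - qim ((hermitian_rows g i X * sig_mat g i * qconj.star (hermitian_rows g i Y :: ('a, 'd) quad mat)) $$ (r, s))"
proof -
  have XJ: "X * symp_mat g \<in> carrier_mat a (g + g)"
    using X symp_mat_carrier by (rule mult_carrier_mat)
  have YT: "transpose_mat Y \<in> carrier_mat (g + g) b"
    using Y by simp
  have "(X * symp_mat g * transpose_mat Y) $$ (r, s) =
      (\<Sum>t = 0..<g. - X $$ (r, g + t) * Y $$ (s, t)) + (\<Sum>t = 0..<g. X $$ (r, t) * Y $$ (s, g + t))"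
    unfolding mat_mult_index_sum[OF XJ YT rs] sum_two_blocks
    using X Y rs by (simp add: mult_symp_mat_index[OF X] del: index_mult_mat(1))
  also have "\<dots> = (\<Sum>t = 0..<g. X $$ (r, t) * Y $$ (s, g + t) - X $$ (r, g + t) * Y $$ (s, t))"
    by (simp add: sum_subtractf sum_negf)
  also have "\<dots> = - qim ((hermitian_rows g i X * sig_mat g i * qconj.star (hermitian_rows g i Y :: ('a, 'd) quad mat)) $$ (r, s))"
    unfolding hermitian_form_index[OF i hermitian_rows_carrier[OF X] hermitian_rows_carrier[OF Y] rs] qim_sum sum_negf[symmetric]
    using X Y rs
    by (intro sum.cong refl) (auto simp: hermitian_rows_index sig_sign_def algebra_simps)
  finally show ?thesis .
qed

lemma symp_mat_square: "symp_mat g * symp_mat g = (- 1\<^sub>m (g + g) :: 'a::comm_ring_1 mat)"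
proof (rule eq_matI)
  fix r c
  assume "r < dim_row (- 1\<^sub>m (g + g) :: 'a mat)" "c < dim_col (- 1\<^sub>m (g + g) :: 'a mat)"
  then have rc: "r < g + g" "c < g + g"
    by auto
  show "(symp_mat g * symp_mat g) $$ (r, c) = (- 1\<^sub>m (g + g) :: 'a mat) $$ (r, c)"
  proof (cases "c < g")
    case True
    then show ?thesis
      using mult_symp_mat_index(1)[OF symp_mat_carrier rc(1) True] rc
      by (auto simp: symp_mat_index simp del: index_mult_mat(1))
  next
    case False
    then have "c - g < g"
      using rc(2) by linarith
    then show ?thesis
      using False mult_symp_mat_index(2)[OF symp_mat_carrier rc(1), of "c - g"] rc
      by (auto simp: symp_mat_index simp del: index_mult_mat(1))
  qed
qed (auto simp: symp_mat_def)

section \<open>The representatives\<close>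

lemma S_mat_carrier:
  assumes "i \<le> g" "A \<in> carrier_mat (g - i) i" "C \<in> carrier_mat (g - i) i" "U \<in> carrier_mat (g - i) (g - i)"
  shows "S_mat p g i A C U \<in> carrier_mat (g + g) (g + g)"
  using assms by (auto simp: S_mat_def)

text \<open>
  The condition \<open>C A\<^sup>t - A C\<^sup>t = U - U\<^sup>t\<close> on the blocks says that the product of the two upper blocks
  is symmetric.
\<close>

lemma S_mat_symplectic:
  fixes p :: nat
  assumes i: "i \<le> g" and A: "A \<in> carrier_mat (g - i) i" and C: "C \<in> carrier_mat (g - i) i"
    and U: "U \<in> carrier_mat (g - i) (g - i)"
    and rel: "C * transpose_mat A - A * transpose_mat C = U - transpose_mat U"
  defines "S \<equiv> S_mat p g i A C U"
  shows "S * symp_mat g * transpose_mat S = (int p)\<^sup>2 \<cdot>\<^sub>m symp_mat g"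
proof -
  define n where "n = g - i"
  have g: "g = i + n"
    using i by (simp add: n_def)
  note ACU = A[folded n_def] C[folded n_def] U[folded n_def]
  let ?p = "int p"
  define P where "P = four_block_mat (?p \<cdot>\<^sub>m 1\<^sub>m i) (0\<^sub>m i n) (- A) (1\<^sub>m n)"
  define Q where "Q = four_block_mat (0\<^sub>m i i) (?p \<cdot>\<^sub>m transpose_mat C) C U"
  define R where "R = four_block_mat (?p \<cdot>\<^sub>m 1\<^sub>m i) (?p \<cdot>\<^sub>m transpose_mat A) (0\<^sub>m n i) (?p\<^sup>2 \<cdot>\<^sub>m 1\<^sub>m n)"
  have PQR: "P \<in> carrier_mat g g" "Q \<in> carrier_mat g g" "R \<in> carrier_mat g g"
    using ACU by (auto simp: P_def Q_def R_def g)
  have S: "S = four_block_mat P Q (0\<^sub>m g g) R"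
    by (simp add: S_def S_mat_def P_def Q_def R_def n_def)
  have PT: "transpose_mat P = four_block_mat (?p \<cdot>\<^sub>m 1\<^sub>m i) (- transpose_mat A) (0\<^sub>m n i) (1\<^sub>m n)"
    unfolding P_def using ACU by (intro eq_matI) auto
  have QT: "transpose_mat Q = four_block_mat (0\<^sub>m i i) (transpose_mat C) (?p \<cdot>\<^sub>m C) (transpose_mat U)"
    unfolding Q_def using ACU by (intro eq_matI) auto
  have RT: "transpose_mat R = four_block_mat (?p \<cdot>\<^sub>m 1\<^sub>m i) (0\<^sub>m i n) (?p \<cdot>\<^sub>m A) (?p\<^sup>2 \<cdot>\<^sub>m 1\<^sub>m n)"
    unfolding R_def using ACU by (intro eq_matI) auto
  have T: "transpose_mat A \<in> carrier_mat i n" "transpose_mat C \<in> carrier_mat i n" "transpose_mat U \<in> carrier_mat n n"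
    using ACU by auto
  have QPT: "Q * transpose_mat P = four_block_mat (0\<^sub>m i i) (?p \<cdot>\<^sub>m transpose_mat C) (?p \<cdot>\<^sub>m C) (- (C * transpose_mat A) + U)"
    unfolding Q_def PT using ACU T
    by (subst mult_four_block_mat[of _ i i _ n _ n _ _ i _ n])
      (auto simp: mult_smult_distrib[of C n i _ i] mult_smult_assoc_mat[of _ i n _ n])
  have PQT: "P * transpose_mat Q = four_block_mat (0\<^sub>m i i) (?p \<cdot>\<^sub>m transpose_mat C) (?p \<cdot>\<^sub>m C) (- (A * transpose_mat C) + transpose_mat U)"
    unfolding P_def QT using ACU T
    by (subst mult_four_block_mat[of _ i i _ n _ n _ _ i _ n])
      (auto simp: mult_smult_assoc_mat[of _ i i _ n])
  have "- (C * transpose_mat A) + U = - (A * transpose_mat C) + transpose_mat U"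
  proof (rule eq_matI)
    fix r c
    assume "r < dim_row (- (A * transpose_mat C) + transpose_mat U)"
      "c < dim_col (- (A * transpose_mat C) + transpose_mat U)"
    then have rc: "r < n" "c < n"
      using ACU by auto
    then have "(C * transpose_mat A) $$ (r, c) - (A * transpose_mat C) $$ (r, c) = U $$ (r, c) - U $$ (c, r)"
      using ACU arg_cong[OF rel, of "\<lambda>X. X $$ (r, c)"] by (simp del: index_mult_mat(1))
    then show "(- (C * transpose_mat A) + U) $$ (r, c) = (- (A * transpose_mat C) + transpose_mat U) $$ (r, c)"
      using ACU rc by (simp del: index_mult_mat(1))
  qed (use ACU in auto)
  then have sym: "P * transpose_mat Q = Q * transpose_mat P"
    unfolding QPT PQT by simp
  have PRT: "P * transpose_mat R = ?p\<^sup>2 \<cdot>\<^sub>m 1\<^sub>m g"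
    unfolding P_def RT using ACU T
    by (subst mult_four_block_mat[of _ i i _ n _ n _ _ i _ n])
      (auto simp: mult_smult_distrib[of _ n i _ i] mult_smult_assoc_mat[of _ i i _ i] power2_eq_square g
        intro!: eq_matI)
  have RPT: "R * transpose_mat P = ?p\<^sup>2 \<cdot>\<^sub>m 1\<^sub>m g"
  proof -
    have "transpose_mat (P * transpose_mat R) = R * transpose_mat P"
      using PQR by (subst transpose_mult[of _ g g _ g]) auto
    moreover have "transpose_mat (?p\<^sup>2 \<cdot>\<^sub>m 1\<^sub>m g) = ?p\<^sup>2 \<cdot>\<^sub>m 1\<^sub>m g"
      by (intro eq_matI) auto
    ultimately show ?thesis
      unfolding PRT by simp
  qed
  have SJ: "S * symp_mat g = four_block_mat (- Q) P (- R) (0\<^sub>m g g)"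
    unfolding S symp_mat_def using PQR
    by (subst mult_four_block_mat[of _ g g _ g _ g _ _ g _ g]) auto
  have ST: "transpose_mat S = four_block_mat (transpose_mat P) (0\<^sub>m g g) (transpose_mat Q) (transpose_mat R)"
    unfolding S using PQR by (subst transpose_four_block_mat[of _ g g _ g _ g]) auto
  have T2: "transpose_mat P \<in> carrier_mat g g" "transpose_mat Q \<in> carrier_mat g g" "transpose_mat R \<in> carrier_mat g g"
    using PQR by auto
  have c: "Q * transpose_mat P \<in> carrier_mat g g"
    using PQR T2 by (intro mult_carrier_mat[of _ g g]) auto
  have "S * symp_mat g * transpose_mat S = four_block_mat (- (Q * transpose_mat P) + P * transpose_mat Q)
      (P * transpose_mat R) (- (R * transpose_mat P)) (0\<^sub>m g g)"
    unfolding SJ ST using PQR T2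
    by (subst mult_four_block_mat[of _ g g _ g _ g _ _ g _ g]) auto
  also have "\<dots> = ?p\<^sup>2 \<cdot>\<^sub>m symp_mat g"
    unfolding sym PRT RPT symp_mat_def using c
    by (intro eq_matI) (auto simp del: index_mult_mat(1))
  finally show ?thesis .
qed

lemma S_openE:
  assumes "S \<in> S_open p R1 R2 g i"
  obtains A C U where "S = S_mat p g i A C U" "A \<in> carrier_mat (g - i) i" "C \<in> carrier_mat (g - i) i"
    "U \<in> carrier_mat (g - i) (g - i)" "C * transpose_mat A - A * transpose_mat C = U - transpose_mat U"
  using assms unfolding S_open_def by (elim CollectE exE conjE) (rule that)

lemma S_open_carrier:
  assumes "i \<le> g" "S \<in> S_open p R1 R2 g i"
  shows "S \<in> carrier_mat (g + g) (g + g)"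
  using assms S_mat_carrier by (metis S_openE)

lemma S_open_symplectic:
  assumes "i \<le> g" "S \<in> S_open p R1 R2 g i"
  shows "S * symp_mat g * transpose_mat S = (int p)\<^sup>2 \<cdot>\<^sub>m symp_mat g"
  using assms S_mat_symplectic by (metis S_openE)

lemma S_open_row_dvd:
  assumes i: "i \<le> g" and S: "S \<in> S_open p R1 R2 g i" and r: "r < g + g" "t < g + g" "\<not> (i \<le> r \<and> r < g)"
  shows "int p dvd S $$ (r, t)"
proof -
  obtain A C U where "S = S_mat p g i A C U" and ACU: "A \<in> carrier_mat (g - i) i" "C \<in> carrier_mat (g - i) i"
    "U \<in> carrier_mat (g - i) (g - i)"
    using S by (rule S_openE)
  then show ?thesis
    using i r by (auto simp: S_mat_def power2_eq_square)
qed

lemma qconj_sig_sign [simp]: "qconj (sig_sign i t) = (sig_sign i t :: ('a::comm_ring_1, 'd) quad)"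
  by (auto simp: sig_sign_def intro: quad_eqI)

lemma mu_carrier [simp]:
  "i \<le> g \<Longrightarrow> mu1 g i S \<in> carrier_mat g g" "i \<le> g \<Longrightarrow> mu2 g i S \<in> carrier_mat g g"
  by (auto simp: mu1_def mu2_def Let_def A_block_def C_block_def U_block_def)

lemma mu2_bottom:
  assumes "i \<le> g" "r < g - i" "c < g"
  shows "mu2 g i S $$ (i + r, c) = mu1 g i S $$ (i + r, c)"
  using assms by (auto simp: mu1_def mu2_def Let_def A_block_def C_block_def U_block_def)

text \<open>
  The matrices \<open>\<mu>\<^sub>1\<close> and \<open>\<mu>\<^sub>2\<close> consist, up to conjugation and sign, of the rows of the representative,
  with a factor \<open>p\<close> removed from their upper blocks.
\<close>

lemma hermitian_rows_S_open:
  fixes S :: "int mat"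
  assumes i: "i \<le> g" and S: "S \<in> S_open p R1 R2 g i" and c: "c < g"
  defines "Z \<equiv> hermitian_rows g i (map_mat of_int S) :: ('a::comm_ring_1, 'd) quad mat"
  shows "r < g - i \<Longrightarrow> Z $$ (i + r, c) = - qconj (mu1 g i S $$ (i + r, c))"
    and "r < i \<Longrightarrow> Z $$ (r, c) = - of_nat p * qconj (mu1 g i S $$ (r, c))"
    and "r < i \<Longrightarrow> Z $$ (g + r, c) = - of_nat p * qconj (mu2 g i S $$ (r, c))"
proof -
  obtain A C U where S': "S = S_mat p g i A C U" and ACU: "A \<in> carrier_mat (g - i) i" "C \<in> carrier_mat (g - i) i"
    "U \<in> carrier_mat (g - i) (g - i)"
    using S by (rule S_openE)
  note blocks = blocks_S_mat[OF i ACU, of p]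
  show "r < g - i \<Longrightarrow> Z $$ (i + r, c) = - qconj (mu1 g i S $$ (i + r, c))"
    using i c ACU unfolding Z_def S' mu1_def Let_def blocks
    by (intro quad_eqI) (auto simp: hermitian_rows_index S_mat_def sig_sign_def)
  show "r < i \<Longrightarrow> Z $$ (r, c) = - of_nat p * qconj (mu1 g i S $$ (r, c))"
    using i c ACU unfolding Z_def S' mu1_def Let_def blocks
    by (intro quad_eqI) (auto simp: hermitian_rows_index S_mat_def sig_sign_def)
  show "r < i \<Longrightarrow> Z $$ (g + r, c) = - of_nat p * qconj (mu2 g i S $$ (r, c))"
    using i c ACU unfolding Z_def S' mu2_def Let_def blocks
    by (intro quad_eqI) (auto simp: hermitian_rows_index S_mat_def sig_sign_def)
qed

lemma map_of_int_symp_mat: "map_mat of_int (symp_mat g) = (symp_mat g :: 'a::comm_ring_1 mat)"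
  by (intro eq_matI) (auto simp: symp_mat_def)

lemma map_of_int_symplectic:
  fixes S :: "int mat"
  assumes S: "S \<in> carrier_mat (g + g) (g + g)" "S * symp_mat g * transpose_mat S = q \<cdot>\<^sub>m symp_mat g"
  shows "map_mat of_int S * symp_mat g * transpose_mat (map_mat of_int S) =
    of_int q \<cdot>\<^sub>m (symp_mat g :: 'a::comm_ring_1 mat)"
proof -
  have c: "S * symp_mat g \<in> carrier_mat (g + g) (g + g)"
    using S(1) symp_mat_carrier by (rule mult_carrier_mat)
  have "map_mat of_int S * symp_mat g * transpose_mat (map_mat of_int S) =
      (map_mat of_int (S * symp_mat g * transpose_mat S) :: 'a mat)"
    using S(1) by (simp add: of_int_hom.mat_hom_mult[OF c, of _ "g + g"]
        of_int_hom.mat_hom_mult[OF S(1) symp_mat_carrier] map_of_int_symp_mat map_mat_transpose)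
  also have "\<dots> = of_int q \<cdot>\<^sub>m symp_mat g"
    unfolding S(2) by (intro eq_matI) (auto simp: symp_mat_def)
  finally show ?thesis .
qed

lemma S_open_qim:
  fixes S :: "int mat"
  assumes i: "i \<le> g" and S: "S \<in> S_open p R1 R2 g i" and rs: "r < g + g" "s < g + g"
  defines "Z \<equiv> hermitian_rows g i (map_mat of_int S) :: ('a::comm_ring_1, 'd) quad mat"
  shows "qim ((Z * sig_mat g i * qconj.star Z) $$ (r, s)) = - ((of_nat p)\<^sup>2 * symp_mat g $$ (r, s))"
proof -
  note car = S_open_carrier[OF i S]
  have "- qim ((Z * sig_mat g i * qconj.star Z) $$ (r, s)) =
      (of_int ((int p)\<^sup>2) \<cdot>\<^sub>m (symp_mat g :: 'a mat)) $$ (r, s)"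
    unfolding Z_def map_of_int_symplectic[OF car S_open_symplectic[OF i S], symmetric]
    by (rule symp_form_eq_qim[OF i _ _ rs, symmetric]) (use car in auto)
  also have "\<dots> = (of_nat p)\<^sup>2 * symp_mat g $$ (r, s)"
    using rs by (simp add: symp_mat_def)
  finally show ?thesis
    by (metis minus_minus)
qed

definition second_block_rows :: "nat \<Rightarrow> nat \<Rightarrow> 'a mat \<Rightarrow> 'a mat" where
  "second_block_rows g i Z = mat (g - i) (dim_col Z) (\<lambda>(r, c). Z $$ (i + r, c))"

lemma second_block_rows_carrier [simp]: "Z \<in> carrier_mat k m \<Longrightarrow> second_block_rows g i Z \<in> carrier_mat (g - i) m"
  by (auto simp: second_block_rows_def)

lemma second_block_rows_index: "r < g - i \<Longrightarrow> c < dim_col Z \<Longrightarrow> second_block_rows g i Z $$ (r, c) = Z $$ (i + r, c)"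
  by (simp add: second_block_rows_def)

lemma second_block_rows_mult:
  assumes "Z \<in> carrier_mat (g + g) m" "X \<in> carrier_mat m k"
  shows "second_block_rows g i (Z * X) = second_block_rows g i Z * X"
  using assms by (intro eq_matI) (auto simp: second_block_rows_def scalar_prod_def)

lemma second_block_rows_form:
  fixes Z Y :: "('a::comm_ring_1, 'd) quad mat"
  assumes "i \<le> g" "Z \<in> carrier_mat (g + g) g" "Y \<in> carrier_mat b g" "r < g - i" "s < b"
  shows "(second_block_rows g i Z * sig_mat g i * qconj.star Y) $$ (r, s) =
    (Z * sig_mat g i * qconj.star Y) $$ (i + r, s)"
proof -
  have "i + r < g + g"
    using assms by simp
  then show ?thesis
    using assms hermitian_form_index[OF assms(1) second_block_rows_carrier[OF assms(2)] assms(3,4,5)]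
      hermitian_form_index[OF assms(1,2,3) _ assms(5), of "i + r"]
    by (simp add: second_block_rows_index del: index_mult_mat(1))
qed

lemma unitary_form_index:
  fixes X :: "('a::comm_ring_1, 'd) quad mat"
  assumes "i \<le> g" "X \<in> carrier_mat a g" "r < a" "s < a"
  shows "unitary_form g i X $$ (r, s) = (\<Sum>t = 0..<g. X $$ (r, t) * sig_sign i t * qconj (X $$ (s, t)))"
  unfolding unitary_form_def by (rule hermitian_form_index[OF assms(1,2,2,3,4)])

lemma unitary_form_carrier [simp]:
  "X \<in> carrier_mat a g \<Longrightarrow> unitary_form g i X \<in> carrier_mat a a"
  unfolding unitary_form_def carrier_mat_def by simp

lemma G22_quad_carrier [simp]: "G22_quad g i S \<in> carrier_mat (g - i) (g - i)"
  by (simp add: G22_quad_def Let_def)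

lemma G22_quad_dim [simp]: "dim_row (G22_quad g i S) = g - i" "dim_col (G22_quad g i S) = g - i"
  by (simp_all add: G22_quad_def Let_def)

lemma G22_quad_index:
  "r < g - i \<Longrightarrow> c < g - i \<Longrightarrow> G22_quad g i S $$ (r, c) = unitary_form g i (mu1 g i S) $$ (i + r, i + c)"
  by (simp add: G22_quad_def Let_def)

lemma G22_quad_real:
  assumes "i \<le> g" "S \<in> S_open p R1 R2 g i" "r < g - i" "c < g - i"
  shows "qim (G22_quad g i S $$ (r, c) :: ('a::comm_ring_1, 'd) quad) = 0"
proof -
  have "map_mat qim (G22_quad g i S :: ('a, 'd) quad mat) $$ (r, c) = 0"
    using assms(3,4) by (simp only: G22_base[OF assms(1,2)] index_zero_mat)
  then show ?thesis
    using assms(3,4) by simp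
qed

text \<open>
  Passing from the rows of \<open>\<mu>\<^sub>1\<close> to those of the representative conjugates the Gram matrix, and
  \<open>G\<^sub>2\<^sub>2\<close> is real.
\<close>

lemma second_block_rows_gram:
  fixes S :: "int mat"
  assumes i: "i \<le> g" and S: "S \<in> S_open p R1 R2 g i"
  defines "Z \<equiv> hermitian_rows g i (map_mat of_int S) :: ('a::comm_ring_1, 'd) quad mat"
  shows "unitary_form g i (second_block_rows g i Z) = map_mat qbase (map_mat qre (G22_quad g i S :: ('a, 'd) quad mat))"
proof (rule eq_matI)
  fix r s
  assume "r < dim_row (map_mat qbase (map_mat qre (G22_quad g i S :: ('a, 'd) quad mat)))"
    "s < dim_col (map_mat qbase (map_mat qre (G22_quad g i S :: ('a, 'd) quad mat)))"
  then have rs: "r < g - i" "s < g - i"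
    by (simp_all add: G22_quad_def Let_def)
  have Z: "Z \<in> carrier_mat (g + g) g"
    using S_open_carrier[OF i S] by (simp add: Z_def)
  have "unitary_form g i (second_block_rows g i Z) $$ (r, s) =
      (\<Sum>t = 0..<g. second_block_rows g i Z $$ (r, t) * sig_sign i t * qconj (second_block_rows g i Z $$ (s, t)))"
    by (rule unitary_form_index[OF i second_block_rows_carrier[OF Z] rs])
  also have "\<dots> = (\<Sum>t = 0..<g. qconj (mu1 g i S $$ (i + r, t) * sig_sign i t * qconj (mu1 g i S $$ (i + s, t))))"
    using rs Z hermitian_rows_S_open(1)[OF i S, where 'a='a and 'd='d]
    by (intro sum.cong) (auto simp: second_block_rows_index Z_def qconj.hom_mult qconj.hom_uminus)
  also have "\<dots> = qconj (unitary_form g i (mu1 g i S) $$ (i + r, i + s))"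
    using rs by (subst unitary_form_index[OF i mu_carrier(1)[OF i]]) (auto simp: qconj.hom_sum)
  also have "\<dots> = qconj (G22_quad g i S $$ (r, s))"
    using rs by (simp add: G22_quad_index)
  also have "\<dots> = qbase (qre (G22_quad g i S $$ (r, s) :: ('a, 'd) quad))"
    using G22_quad_real[OF i S rs, where 'a='a and 'd='d] by (intro quad_eqI) simp_all
  finally show "unitary_form g i (second_block_rows g i Z) $$ (r, s) =
      map_mat qbase (map_mat qre (G22_quad g i S :: ('a, 'd) quad mat)) $$ (r, s)"
    using rs by simp
qed (use S_open_carrier[OF i S] i in \<open>simp_all add: G22_quad_def Let_def Z_def unitary_form_def second_block_rows_def\<close>)

section \<open>Nondegeneracy\<close>

lemma zero_mat_mult_vec: "v \<in> carrier_vec n \<Longrightarrow> 0\<^sub>m m n *\<^sub>v v = (0\<^sub>v m :: 'a::comm_ring_1 vec)"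
  by (intro eq_vecI) (auto simp: scalar_prod_def)

lemma mat_mult_zero_vec: "A \<in> carrier_mat m n \<Longrightarrow> A *\<^sub>v 0\<^sub>v n = (0\<^sub>v m :: 'a::comm_ring_1 vec)"
  by (intro eq_vecI) (auto simp: scalar_prod_def)

lemma quad_kernel_trivial:
  fixes K :: "('p::prime_card mod_ring, 'd) quad mat"
  assumes inert: "inert_types TYPE('p) TYPE('d)" and K: "K \<in> carrier_mat g g" "det K \<noteq> 0"
    and x: "x \<in> carrier_vec g" "K *\<^sub>v x = 0\<^sub>v g"
  shows "x = 0\<^sub>v g"
proof -
  note adj = adj_mat[OF K(1)]
  have "det K \<cdot>\<^sub>v x = (adj_mat K * K) *\<^sub>v x"
    unfolding adj(3) using x(1) by (auto intro!: eq_vecI)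
  also have "\<dots> = adj_mat K *\<^sub>v (K *\<^sub>v x)"
    using adj(1) K(1) x(1) by (rule assoc_mult_mat_vec)
  also have "\<dots> = 0\<^sub>v g"
    unfolding x(2) using adj(1) by (auto intro!: eq_vecI)
  finally have 0: "det K \<cdot>\<^sub>v x = 0\<^sub>v g" .
  show ?thesis
  proof (rule eq_vecI)
    fix j
    assume "j < dim_vec (0\<^sub>v g :: ('p mod_ring, 'd) quad vec)"
    then have j: "j < g"
      by simp
    then have "det K * x $ j = 0"
      using arg_cong[OF 0, of "\<lambda>v. v $ j"] x(1) by simp
    then show "x $ j = 0\<^sub>v g $ j"
      using quad_field_mult_eq_0[OF inert _ K(2)] j by simp
  qed (use x in simp)
qed

text \<open>
  Taking imaginary parts of \<open>N E M\<^sup>* = (X\<^sub>1 X\<^sub>2; 0 1) H\<close> in the last columns, where both sides are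
  controlled by reality, gives \<open>Im X\<^sub>1 H\<^sub>1\<^sub>2 + Im X\<^sub>2 H\<^sub>2\<^sub>2 = 0\<close>.  If \<open>H\<^sub>2\<^sub>2 v = 0\<close> modulo \<open>p\<close>, then
  \<open>H\<^sub>1\<^sub>2 v = 0\<close> by invertibility of \<open>Im X\<^sub>1\<close>, so \<open>(0, v)\<close> lies in the kernel of the invertible
  matrix \<open>H\<close>.
\<close>

lemma nondegenerate_of_im_rank:
  fixes M N :: "('p::prime_card padic_int, 'd) quad mat"
  assumes inert: "inert_types TYPE('p) TYPE('d)" and i: "i \<le> g"
    and M: "M \<in> carrier_mat g g" and X: "X1 \<in> carrier_mat i i" "X2 \<in> carrier_mat i (g - i)"
    and N: "N = four_block_mat X1 X2 (0\<^sub>m (g - i) i) (1\<^sub>m (g - i)) * M"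
    and rank: "vec_space.rank i (map_mat qim (map_mat qred X1)) = i"
    and det: "det (map_mat qred M) \<noteq> 0"
    and realM: "\<And>r c. r < g \<Longrightarrow> c < g - i \<Longrightarrow> qim (unitary_form g i M $$ (r, i + c)) = 0"
    and realN: "\<And>r c. r < i \<Longrightarrow> c < g - i \<Longrightarrow> qim ((N * sig_mat g i * qconj.star M) $$ (r, i + c)) = 0"
  shows "det (mat (g - i) (g - i) (\<lambda>(r, c). padic_red (qre (unitary_form g i M $$ (i + r, i + c))))) \<noteq> 0"
proof
  define n where "n = g - i"
  have g: "g = i + n"
    using i by (simp add: n_def)
  define H where "H = unitary_form g i M"
  have H: "H \<in> carrier_mat g g"
    using M by (simp add: H_def)
  let ?h = "\<lambda>r c. padic_red (qre (H $$ (r, i + c)))"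
  define G12 where "G12 = mat i n (\<lambda>(r, c). ?h r c)"
  define G22 where "G22 = mat n n (\<lambda>(r, c). ?h (i + r) c)"
  define Y1 where "Y1 = map_mat qim (map_mat qred X1)"
  define Y2 where "Y2 = map_mat qim (map_mat qred X2)"
  have car: "G12 \<in> carrier_mat i n" "G22 \<in> carrier_mat n n" "Y1 \<in> carrier_mat i i" "Y2 \<in> carrier_mat i n"
    using X by (auto simp: G12_def G22_def Y1_def Y2_def n_def)
  define F where "F = four_block_mat X1 X2 (0\<^sub>m n i) (1\<^sub>m n)"
  have F: "F \<in> carrier_mat g g"
    using X by (auto simp: F_def g)
  have E: "(sig_mat g i :: ('p padic_int, 'd) quad mat) \<in> carrier_mat g g" "qconj.star M \<in> carrier_mat g g"
    "M * sig_mat g i \<in> carrier_mat g g"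
    using i M by (auto intro: mult_carrier_mat)
  have "N * sig_mat g i * qconj.star M = F * (M * sig_mat g i) * qconj.star M"
    unfolding N n_def[symmetric] F_def[symmetric] using F M E by (simp add: assoc_mult_mat[of F g g M g _ g])
  also have "\<dots> = F * H"
    unfolding H_def unitary_form_def using F E(3,2) by (rule assoc_mult_mat)
  finally have NF: "N * sig_mat g i * qconj.star M = F * H" .
  have rel: "Y1 * G12 + Y2 * G22 = 0\<^sub>m i n"
  proof (rule eq_matI)
    fix r c
    assume "r < dim_row (0\<^sub>m i n :: 'p mod_ring mat)" "c < dim_col (0\<^sub>m i n :: 'p mod_ring mat)"
    then have rc: "r < i" "c < n"
      by auto
    have "(F * H) $$ (r, i + c) = (\<Sum>t = 0..<i + n. F $$ (r, t) * H $$ (t, i + c))"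
      using mat_mult_index_sum[OF F H, of r "i + c"] rc by (simp add: g del: index_mult_mat(1))
    also have "\<dots> = (\<Sum>t = 0..<i. X1 $$ (r, t) * H $$ (t, i + c)) +
        (\<Sum>t = 0..<n. X2 $$ (r, t) * H $$ (i + t, i + c))"
      unfolding sum_two_blocks using rc X by (simp add: F_def n_def)
    finally have FH: "(F * H) $$ (r, i + c) = \<dots>" .
    have 0: "qim ((F * H) $$ (r, i + c)) = 0"
      using realN[of r c] rc unfolding NF n_def by simp
    have "qim ((F * H) $$ (r, i + c)) =
        (\<Sum>t = 0..<i. qim (X1 $$ (r, t)) * qre (H $$ (t, i + c))) +
        (\<Sum>t = 0..<n. qim (X2 $$ (r, t)) * qre (H $$ (i + t, i + c)))"
      unfolding FH using realM rc by (simp add: qim_sum H_def g)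
    then have "padic_red \<dots> = 0"
      using 0 by simp
    moreover have "(Y1 * G12 + Y2 * G22) $$ (r, c) = (\<Sum>t = 0..<i. Y1 $$ (r, t) * G12 $$ (t, c)) +
        (\<Sum>t = 0..<n. Y2 $$ (r, t) * G22 $$ (t, c))"
      unfolding mat_mult_index_sum[OF car(3,1) rc, symmetric] mat_mult_index_sum[OF car(4,2) rc, symmetric]
      using car rc by (intro index_add_mat(1)) auto
    ultimately show "(Y1 * G12 + Y2 * G22) $$ (r, c) = 0\<^sub>m i n $$ (r, c)"
      using rc X by (simp add: hom_distribs Y1_def Y2_def G12_def G22_def n_def)
  qed (use car in auto)
  assume "det (mat (g - i) (g - i) (\<lambda>(r, c). padic_red (qre (unitary_form g i M $$ (i + r, i + c))))) = 0"
  then have "det G22 = 0"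
    by (simp add: G22_def H_def n_def)
  then obtain v where v: "v \<in> carrier_vec n" "v \<noteq> 0\<^sub>v n" "G22 *\<^sub>v v = 0\<^sub>v n"
    using det_0_iff_vec_prod_zero[OF car(2)] by blast
  have Gv: "G12 *\<^sub>v v \<in> carrier_vec i"
    using car v by auto
  have "(Y1 * G12 + Y2 * G22) *\<^sub>v v = Y1 *\<^sub>v (G12 *\<^sub>v v) + Y2 *\<^sub>v (G22 *\<^sub>v v)"
    using car v(1) by (subst add_mult_distrib_mat_vec[of _ i n]) (auto simp: assoc_mult_mat_vec)
  then have "0\<^sub>v i = Y1 *\<^sub>v (G12 *\<^sub>v v) + Y2 *\<^sub>v 0\<^sub>v n"
    unfolding rel v(3) using v(1) by (metis zero_mat_mult_vec)
  then have Y0: "Y1 *\<^sub>v (G12 *\<^sub>v v) = 0\<^sub>v i"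
    using car Gv mat_mult_zero_vec[OF car(4)] by simp
  have "det Y1 \<noteq> 0"
    using vec_space.det_rank_iff[OF car(3)] rank by (simp add: Y1_def)
  then have G12v: "G12 *\<^sub>v v = 0\<^sub>v i"
    using det_0_iff_vec_prod_zero[OF car(3)] Gv Y0 by blast
  \<comment> \<open>The vector \<open>(0, v)\<close>.\<close>
  define x :: "('p mod_ring, 'd) quad vec" where "x = vec g (\<lambda>t. if t < i then 0 else qbase (v $ (t - i)))"
  have Hx: "map_mat qred H *\<^sub>v x = 0\<^sub>v g"
  proof (rule eq_vecI)
    fix r
    assume "r < dim_vec (0\<^sub>v g :: ('p mod_ring, 'd) quad vec)"
    then have r: "r < g"
      by simp
    have "(map_mat qred H *\<^sub>v x) $ r = (\<Sum>t = 0..<i + n. qred (H $$ (r, t)) * x $ t)"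
      using r H by (simp add: scalar_prod_def x_def g)
    also have "\<dots> = (\<Sum>t = 0..<n. qbase (?h r t * v $ t))"
    proof -
      have "qred (H $$ (r, i + t)) = qbase (?h r t)" if "t < n" for t
        using realM[OF r, of t] that by (intro quad_eqI) (simp_all add: H_def n_def)
      then show ?thesis
        unfolding sum_two_blocks by (simp add: x_def g qbase.hom_mult)
    qed
    also have "\<dots> = qbase (\<Sum>t = 0..<n. ?h r t * v $ t)"
      by (simp add: qbase.hom_sum)
    also have "(\<Sum>t = 0..<n. ?h r t * v $ t) = 0"
    proof (cases "r < i")
      case True
      then show ?thesis
        using arg_cong[OF G12v, of "\<lambda>w. w $ r"] v(1) by (simp add: scalar_prod_def G12_def)
    next
      case False
      then show ?thesis
        using arg_cong[OF v(3), of "\<lambda>w. w $ (r - i)"] v(1) r by (simp add: scalar_prod_def G22_def g)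
    qed
    finally show "(map_mat qred H *\<^sub>v x) $ r = 0\<^sub>v g $ r"
      using r by simp
  qed (use H in simp)
  have dH: "det (map_mat qred H) \<noteq> 0"
  proof -
    have "det M dvd 1"
      using det by (simp add: quad_unit_iff[OF inert])
    moreover have "det (qconj.star M) = qconj (det M)"
      using M by (subst det_transpose[of _ g]) (auto simp: qconj.hom_det)
    moreover have "det H = det M * det (sig_mat g i) * det (qconj.star M)"
      unfolding H_def unitary_form_def det_mult[OF E(3,2)] det_mult[OF M E(1)] ..
    ultimately have "det H dvd 1"
      using sig_mat_det_unit[OF i] qconj.unit_cj by (simp add: is_unit_mult_iff)
    then show ?thesis
      by (simp add: quad_unit_iff[OF inert])
  qed
  have "map_mat qred H \<in> carrier_mat g g" "x \<in> carrier_vec g"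
    using H by (simp_all add: x_def)
  then have x0: "x = 0\<^sub>v g"
    using quad_kernel_trivial[OF inert _ dH _ Hx] by blast
  have "v = 0\<^sub>v n"
  proof (rule eq_vecI)
    fix t
    assume "t < dim_vec (0\<^sub>v n :: 'p mod_ring vec)"
    then have t: "t < n"
      by simp
    then have "qbase (v $ t) = (0 :: ('p mod_ring, 'd) quad)"
      using arg_cong[OF x0, of "\<lambda>w. w $ (i + t)"] by (simp add: x_def g)
    then show "v $ t = 0\<^sub>v n $ t"
      using t by simp
  qed (use v in simp)
  then show False
    using v(2) by simp
qed

lemma G22_carrier [simp]: "G22 p d g i S \<in> carrier_mat (g - i) (g - i)"
  by (simp add: G22_def G22_quad_def Let_def)

text \<open>
  The matrices \<open>\<mu>\<^sub>1\<close> and \<open>\<mu>\<^sub>2\<close> share their lower rows \<open>b\<close>, and the symplectic relations of the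
  representative make the products of \<open>b\<close> with \<open>b\<close> and with the upper rows of both matrices real.
  Hence the situation is symmetric in \<open>\<mu>\<^sub>1\<close> and \<open>\<mu>\<^sub>2\<close>, and \<open>G\<^sub>2\<^sub>2\<close> may be computed from either.
\<close>

lemma D_set_nondegenerate:
  fixes S :: "int mat"
  assumes inert: "inert_types TYPE('p::prime_card) TYPE('d)" and i: "i \<le> g"
    and D: "S \<in> D_set TYPE('p) TYPE('d) R1 R2 g i i"
  shows "det (map_mat padic_red (G22 TYPE('p) TYPE('d) g i S)) \<noteq> 0"
proof -
  have S: "S \<in> S_open CARD('p) R1 R2 g i"
    using D by (simp add: D_set_def)
  let ?m1 = "mu1 g i S :: ('p padic_int, 'd) quad mat"
  let ?m2 = "mu2 g i S :: ('p padic_int, 'd) quad mat"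
  let ?Z = "hermitian_rows g i (map_mat of_int S) :: ('p padic_int, 'd) quad mat"
  have m [simp]: "?m1 \<in> carrier_mat g g" "?m2 \<in> carrier_mat g g"
    by (rule mu_carrier[OF i])+
  have Z: "?Z \<in> carrier_mat (g + g) g"
    using S_open_carrier[OF i S] by simp
  let ?f = "\<lambda>a c. \<Sum>t = 0..<g. a t * sig_sign i t * qconj (?m1 $$ (i + c, t))"
  have top: "qim (?f a c) = 0"
    if a: "\<And>t. t < g \<Longrightarrow> ?Z $$ (r, t) = - of_nat CARD('p) * qconj (a t)"
      and r: "r < i \<or> g \<le> r \<and> r < g + i" and c: "c < g - i" for a r c
  proof -
    have rc: "r < g + g" "i + c < g + g"
      using r c i by auto
    have "(?Z * sig_mat g i * qconj.star ?Z) $$ (r, i + c) =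
        (\<Sum>t = 0..<g. ?Z $$ (r, t) * sig_sign i t * qconj (?Z $$ (i + c, t)))"
      by (rule hermitian_form_index[OF i Z Z rc])
    also have "\<dots> = (\<Sum>t = 0..<g. of_nat CARD('p) * qconj (a t * sig_sign i t * qconj (?m1 $$ (i + c, t))))"
      using a c hermitian_rows_S_open(1)[OF i S _ c, where 'a="'p padic_int" and 'd='d]
      by (intro sum.cong) (auto simp: qconj.hom_mult qconj.hom_uminus)
    also have "\<dots> = of_nat CARD('p) * qconj (?f a c)"
      by (simp add: sum_distrib_left qconj.hom_sum)
    finally have "qim (of_nat CARD('p) * qconj (?f a c)) = - ((of_nat CARD('p))\<^sup>2 * symp_mat g $$ (r, i + c))"
      using S_open_qim[OF i S rc, where 'a="'p padic_int" and 'd='d] by simp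
    also have "symp_mat g $$ (r, i + c) = (0 :: 'p padic_int)"
      using rc r c by (auto simp: symp_mat_index)
    finally show ?thesis
      using padic_prime_neq_0[where 'p='p] by simp
  qed
  have real1: "qim (?f (\<lambda>t. ?m1 $$ (r, t)) c) = 0" if "r < i" "c < g - i" for r c
    using hermitian_rows_S_open(2)[OF i S _ that(1), where 'a="'p padic_int" and 'd='d] that by (intro top) auto
  have real2: "qim (?f (\<lambda>t. ?m2 $$ (r, t)) c) = 0" if "r < i" "c < g - i" for r c
    using hermitian_rows_S_open(3)[OF i S _ that(1), where 'a="'p padic_int" and 'd='d] that
    by (intro top[of "g + r"]) auto
  have uf1: "unitary_form g i ?m1 $$ (r, i + c) = ?f (\<lambda>t. ?m1 $$ (r, t)) c" if "r < g" "c < g - i" for r c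
    using that by (intro unitary_form_index[OF i m(1)]) auto
  have uf2: "unitary_form g i ?m2 $$ (r, i + c) = ?f (\<lambda>t. ?m2 $$ (r, t)) c" if "r < g" "c < g - i" for r c
    using that by (subst unitary_form_index[OF i m(2)]) (auto simp: mu2_bottom[OF i])
  have bottom: "?f (\<lambda>t. ?m2 $$ (i + r, t)) c = ?f (\<lambda>t. ?m1 $$ (i + r, t)) c" if "r < g - i" for r c
    using that by (auto simp: mu2_bottom[OF i])
  have real3: "qim (?f (\<lambda>t. ?m1 $$ (i + r, t)) c) = 0" if "r < g - i" "c < g - i" for r c
    using G22_quad_real[OF i S that, where 'a="'p padic_int" and 'd='d] that
    by (simp add: G22_quad_index uf1)
  have realM1: "qim (unitary_form g i ?m1 $$ (r, i + c)) = 0" if "r < g" "c < g - i" for r c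
    using real1[of r c] real3[of "r - i" c] that by (cases "r < i") (auto simp: uf1)
  have realM2: "qim (unitary_form g i ?m2 $$ (r, i + c)) = 0" if "r < g" "c < g - i" for r c
    using real2[of r c] real3[of "r - i" c] bottom[of "r - i" c] that by (cases "r < i") (auto simp: uf2)
  have realN12: "qim ((?m2 * sig_mat g i * qconj.star ?m1) $$ (r, i + c)) = 0" if "r < i" "c < g - i" for r c
    using that i real2[OF that] by (subst hermitian_form_index[OF i m(2,1)]) auto
  have realN21: "qim ((?m1 * sig_mat g i * qconj.star ?m2) $$ (r, i + c)) = 0" if "r < i" "c < g - i" for r c
    using that i real1[OF that] by (subst hermitian_form_index[OF i m(1,2)]) (auto simp: mu2_bottom[OF i])
  have G1: "map_mat padic_red (G22 TYPE('p) TYPE('d) g i S) =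
      mat (g - i) (g - i) (\<lambda>(r, c). padic_red (qre (unitary_form g i ?m1 $$ (i + r, i + c))))"
    by (intro eq_matI) (auto simp: G22_def G22_quad_def Let_def)
  have G2: "\<dots> = mat (g - i) (g - i) (\<lambda>(r, c). padic_red (qre (unitary_form g i ?m2 $$ (i + r, i + c))))"
    by (intro eq_matI) (auto simp: uf1 uf2 bottom)
  from D consider "det (map_mat qred ?m1) \<noteq> 0" "X1_im_rank g i ?m1 ?m2 i"
    | "det (map_mat qred ?m2) \<noteq> 0" "X1_im_rank g i ?m2 ?m1 i"
    by (auto simp: D_set_def Let_def)
  then show ?thesis
  proof cases
    case 1
    then obtain X1 X2 where X: "X1 \<in> carrier_mat i i" "X2 \<in> carrier_mat i (g - i)"
      "?m2 = four_block_mat X1 X2 (0\<^sub>m (g - i) i) (1\<^sub>m (g - i)) * ?m1"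
      "vec_space.rank i (map_mat qim (map_mat qred X1)) = i"
      unfolding X1_im_rank_def by blast
    show ?thesis
      unfolding G1 by (rule nondegenerate_of_im_rank[OF inert i m(1) X 1(1) realM1 realN12])
  next
    case 2
    then obtain X1 X2 where X: "X1 \<in> carrier_mat i i" "X2 \<in> carrier_mat i (g - i)"
      "?m1 = four_block_mat X1 X2 (0\<^sub>m (g - i) i) (1\<^sub>m (g - i)) * ?m2"
      "vec_space.rank i (map_mat qim (map_mat qred X1)) = i"
      unfolding X1_im_rank_def by blast
    show ?thesis
      unfolding G1 G2 by (rule nondegenerate_of_im_rank[OF inert i m(2) X 2(1) realM2 realN21])
  qed
qed

section \<open>D-equivalence as a divisibility condition\<close>

interpretation to_fract: inj_comm_ring_hom "to_fract :: 'a::idom \<Rightarrow> 'a fract"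
  by unfold_locales auto

lemma map_to_fract_of_int:
  "map_mat to_fract (map_mat of_int S) = (map_mat of_int S :: 'a::idom fract mat)"
  by (intro eq_matI) (auto simp: to_fract.hom_of_int)

lemma elements_mat_subset_rangeD:
  assumes "elements_mat X \<subseteq> range f" "X \<in> carrier_mat n m"
  obtains N where "N \<in> carrier_mat n m" "X = map_mat f N"
proof
  let ?N = "mat n m (\<lambda>rc. inv_into UNIV f (X $$ rc))"
  show "?N \<in> carrier_mat n m"
    by simp
  show "X = map_mat f ?N"
  proof (rule eq_matI)
    fix r c
    assume "r < dim_row (map_mat f ?N)" "c < dim_col (map_mat f ?N)"
    then have rc: "r < n" "c < m"
      by auto
    then have "X $$ (r, c) \<in> range f"
      using assms elements_matI[of X n m r c] by auto
    then show "X $$ (r, c) = map_mat f ?N $$ (r, c)"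
      using rc by (simp add: f_inv_into_f)
  qed (use assms in auto)
qed

text \<open>
  The relation \<open>S J S\<^sup>t = q J\<close> provides the inverse of \<open>S\<close> without denominators other than \<open>q\<close>.
\<close>

lemma symplectic_similitude_inverse:
  fixes S :: "'a::field mat"
  assumes S: "S \<in> carrier_mat (g + g) (g + g)" "S * symp_mat g * transpose_mat S = q \<cdot>\<^sub>m symp_mat g"
    and q: "q \<noteq> 0"
  defines "V \<equiv> the (mat_inverse S)"
  shows "V \<in> carrier_mat (g + g) (g + g)" "S * V = 1\<^sub>m (g + g)" "V * S = 1\<^sub>m (g + g)"
    and "q \<cdot>\<^sub>m V = symp_mat g * transpose_mat S * - symp_mat g"
proof -
  let ?J = "symp_mat g :: 'a mat"
  let ?n = "g + g"
  note J = symp_mat_carrier[of g, where 'a='a]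
  have ST: "transpose_mat S \<in> carrier_mat ?n ?n" "- ?J \<in> carrier_mat ?n ?n"
    using S(1) J by auto
  define Q where "Q = ?J * transpose_mat S * - ?J"
  have c: "?J * transpose_mat S \<in> carrier_mat ?n ?n" "S * ?J \<in> carrier_mat ?n ?n"
    "S * (?J * transpose_mat S) \<in> carrier_mat ?n ?n"
    using S(1) J ST by (auto intro!: mult_carrier_mat)
  have Q: "Q \<in> carrier_mat ?n ?n"
    unfolding Q_def using c(1) ST(2) by (rule mult_carrier_mat)
  have "S * Q = S * (?J * transpose_mat S) * - ?J"
    unfolding Q_def using S(1) c(1) ST(2) by (rule assoc_mult_mat[symmetric])
  also have "S * (?J * transpose_mat S) = S * ?J * transpose_mat S"
    using S(1) J ST(1) by (rule assoc_mult_mat[symmetric])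
  also have "\<dots> * - ?J = q \<cdot>\<^sub>m (?J * - ?J)"
    unfolding S(2) using J ST(2) by (rule mult_smult_assoc_mat)
  also have "?J * - ?J = 1\<^sub>m ?n"
  proof -
    have "?J * - ?J = - (?J * ?J)"
      by (rule uminus_mult_right_mat) simp
    then show ?thesis
      unfolding symp_mat_square by (intro eq_matI) auto
  qed
  finally have SQ: "S * Q = q \<cdot>\<^sub>m 1\<^sub>m ?n" .
  have R: "S * ((1 / q) \<cdot>\<^sub>m Q) = 1\<^sub>m ?n"
    unfolding mult_smult_distrib[OF S(1) Q] SQ using q by (intro eq_matI) auto
  have qQ: "(1 / q) \<cdot>\<^sub>m Q \<in> carrier_mat ?n ?n"
    using Q by simp
  have "S \<in> Units (ring_mat TYPE('a) ?n ())"
    using S(1) qQ R mat_mult_left_right_inverse[OF S(1) qQ R]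
    unfolding Units_def ring_mat_def by auto
  then have "mat_inverse S \<noteq> None"
    using mat_inverse(1)[OF S(1), of "()"] by blast
  then have "mat_inverse S = Some V"
    by (auto simp: V_def)
  from mat_inverse(2)[OF S(1) this]
  show V: "V \<in> carrier_mat ?n ?n" "S * V = 1\<^sub>m ?n" "V * S = 1\<^sub>m ?n"
    by auto
  have "q \<cdot>\<^sub>m V = V * (q \<cdot>\<^sub>m 1\<^sub>m ?n)"
    using V(1) by (subst mult_smult_distrib[of V ?n ?n]) auto
  also have "\<dots> = V * S * Q"
    unfolding SQ[symmetric] using V(1) S(1) Q by (rule assoc_mult_mat[symmetric])
  finally show "q \<cdot>\<^sub>m V = ?J * transpose_mat S * - ?J"
    using V(3) Q by (simp add: Q_def)
qed

lemma prime_square_fract_neq_0: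
  "(of_int ((int CARD('p::prime_card))\<^sup>2) :: 'p padic_int fract) \<noteq> 0"
proof -
  have "(of_int ((int CARD('p))\<^sup>2) :: 'p padic_int fract) = to_fract ((of_nat CARD('p))\<^sup>2)"
    by (simp add: to_fract.hom_power to_fract.hom_of_nat)
  then show ?thesis
    using padic_prime_neq_0[where 'p='p] by simp
qed

lemma D_equivalentD:
  fixes S1 S2 :: "int mat"
  assumes i: "i \<le> g" and S1: "S1 \<in> carrier_mat (g + g) (g + g)" and S2: "S2 \<in> carrier_mat (g + g) (g + g)"
    and symp: "S2 * symp_mat g * transpose_mat S2 = (int CARD('p::prime_card))\<^sup>2 \<cdot>\<^sub>m symp_mat g"
    and D: "D_equivalent TYPE('p::prime_card) TYPE('d) g i S1 S2"
  obtains M :: "('p::prime_card padic_int, 'd) quad mat" and N where "M \<in> unitary_similitudes g i"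
    "N \<in> carrier_mat (g + g) (g + g)" "map_mat of_int S1 * alpha g i M = N * map_mat of_int S2"
proof -
  let ?F = "map_mat to_fract :: 'p padic_int mat \<Rightarrow> _"
  let ?S1 = "map_mat of_int S1 :: 'p padic_int mat"
  let ?S2 = "map_mat of_int S2 :: 'p padic_int mat"
  obtain M :: "('p padic_int, 'd) quad mat" where M: "M \<in> unitary_similitudes g i"
    and el: "elements_mat (map_mat of_int S1 * ?F (alpha g i M) * the (mat_inverse (map_mat of_int S2)))
      \<subseteq> range (to_fract :: 'p padic_int \<Rightarrow> _)"
    using D unfolding D_equivalent_def by blast
  have Mc: "M \<in> carrier_mat g g"
    using M by (simp add: unitary_similitudes_def)
  have car: "?S1 \<in> carrier_mat (g + g) (g + g)" "?S2 \<in> carrier_mat (g + g) (g + g)"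
    "?F ?S2 \<in> carrier_mat (g + g) (g + g)"
    using S1 S2 by auto
  note al = alpha_carrier[OF i Mc]
  define V where "V = the (mat_inverse (?F ?S2))"
  have symp2: "?F ?S2 * symp_mat g * transpose_mat (?F ?S2) = of_int ((int CARD('p))\<^sup>2) \<cdot>\<^sub>m symp_mat g"
    unfolding map_to_fract_of_int by (rule map_of_int_symplectic[OF S2 symp])
  note V = symplectic_similitude_inverse[OF car(3) symp2 prime_square_fract_neq_0, folded V_def]
  have A: "?F (?S1 * alpha g i M) \<in> carrier_mat (g + g) (g + g)"
    using mult_carrier_mat[OF car(1) al] by simp
  have "elements_mat (?F (?S1 * alpha g i M) * V) \<subseteq> range (to_fract :: 'p padic_int \<Rightarrow> _)"
    using el unfolding V_def to_fract.mat_hom_mult[OF car(1) al] map_to_fract_of_int .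
  then obtain N where N: "N \<in> carrier_mat (g + g) (g + g)" "?F (?S1 * alpha g i M) * V = ?F N"
    using elements_mat_subset_rangeD[OF _ mult_carrier_mat[OF A V(1)]] by metis
  have "?F (?S1 * alpha g i M) = ?F (?S1 * alpha g i M) * (V * ?F ?S2)"
    unfolding V(3) using right_mult_one_mat[OF A] by (rule sym)
  also have "\<dots> = ?F N * ?F ?S2"
    unfolding N(2)[symmetric] using A V(1) car(3) by (rule assoc_mult_mat[symmetric])
  also have "\<dots> = ?F (N * ?S2)"
    by (rule to_fract.mat_hom_mult[OF N(1) car(2), symmetric])
  finally have "?S1 * alpha g i M = N * ?S2"
    by (rule to_fract.mat_hom_inj)
  then show thesis
    using that M N(1) by blast
qed

lemma D_equivalentI:
  fixes S1 S2 :: "int mat" and M :: "('p::prime_card padic_int, 'd) quad mat"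
  assumes i: "i \<le> g" and S1: "S1 \<in> carrier_mat (g + g) (g + g)" and S2: "S2 \<in> carrier_mat (g + g) (g + g)"
    and symp: "S2 * symp_mat g * transpose_mat S2 = (int CARD('p))\<^sup>2 \<cdot>\<^sub>m symp_mat g"
    and M: "M \<in> unitary_similitudes g i"
    and dvd: "\<And>r s. r < g + g \<Longrightarrow> s < g + g \<Longrightarrow> (of_nat CARD('p))\<^sup>2 dvd
      (map_mat of_int S1 * alpha g i M * symp_mat g * transpose_mat (map_mat of_int S2)) $$ (r, s)"
  shows "D_equivalent TYPE('p) TYPE('d) g i S1 S2"
proof -
  let ?F = "map_mat to_fract :: 'p padic_int mat \<Rightarrow> _"
  let ?S1 = "map_mat of_int S1 :: 'p padic_int mat"
  let ?S2 = "map_mat of_int S2 :: 'p padic_int mat"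
  let ?J = "symp_mat g :: 'p padic_int mat"
  let ?n = "g + g"
  let ?q = "(of_nat CARD('p))\<^sup>2 :: 'p padic_int"
  have Mc: "M \<in> carrier_mat g g"
    using M by (simp add: unitary_similitudes_def)
  note al = alpha_carrier[OF i Mc]
  have car: "?S1 \<in> carrier_mat ?n ?n" "?S2 \<in> carrier_mat ?n ?n" "?F ?S2 \<in> carrier_mat ?n ?n"
    "transpose_mat ?S2 \<in> carrier_mat ?n ?n" "- ?J \<in> carrier_mat ?n ?n"
    using S1 S2 symp_mat_carrier[of g, where 'a="'p padic_int"] by auto
  note J = symp_mat_carrier[of g, where 'a="'p padic_int"]
  define X where "X = ?S1 * alpha g i M"
  have X: "X \<in> carrier_mat ?n ?n"
    unfolding X_def using car(1) al by (rule mult_carrier_mat)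
  note XJ = mult_carrier_mat[OF X J]
  have "\<exists>y. (X * ?J * transpose_mat ?S2) $$ (r, s) = ?q * y" if "r < ?n" "s < ?n" for r s
    using dvd[OF that] unfolding X_def by (elim dvdE) blast
  then obtain y where y: "\<And>r s. r < ?n \<Longrightarrow> s < ?n \<Longrightarrow> (X * ?J * transpose_mat ?S2) $$ (r, s) = ?q * y r s"
    by metis
  define N where "N = mat ?n ?n (\<lambda>(r, s). y r s)"
  have N: "N \<in> carrier_mat ?n ?n"
    by (simp add: N_def)
  have XN: "X * ?J * transpose_mat ?S2 = ?q \<cdot>\<^sub>m N"
    by (rule eq_matI) (use y X S2 in \<open>auto simp: N_def simp del: index_mult_mat(1)\<close>)
  define V where "V = the (mat_inverse (?F ?S2))"
  define q where "q = (of_int ((int CARD('p))\<^sup>2) :: 'p padic_int fract)"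
  have q0: "q \<noteq> 0"
    unfolding q_def by (rule prime_square_fract_neq_0)
  have qq: "to_fract ?q = q"
    by (simp add: q_def to_fract.hom_power to_fract.hom_of_nat)
  have symp2: "?F ?S2 * symp_mat g * transpose_mat (?F ?S2) = q \<cdot>\<^sub>m symp_mat g"
    unfolding map_to_fract_of_int q_def by (rule map_of_int_symplectic[OF S2 symp])
  note V = symplectic_similitude_inverse[OF car(3) symp2 q0, folded V_def]
  have FX: "?F X \<in> carrier_mat ?n ?n"
    using X by simp
  have FJ: "?F ?J = symp_mat g"
    by (intro eq_matI) (auto simp: symp_mat_def)
  have FJ': "?F (- ?J) = - symp_mat g"
    unfolding FJ[symmetric] by (intro eq_matI) (auto simp: to_fract.hom_uminus)
  have JT: "?J * transpose_mat ?S2 \<in> carrier_mat ?n ?n"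
    using J car(4) by (rule mult_carrier_mat)
  have "q \<cdot>\<^sub>m (?F X * V) = ?F X * (q \<cdot>\<^sub>m V)"
    using FX V(1) by (rule mult_smult_distrib[symmetric])
  also have "q \<cdot>\<^sub>m V = ?F (?J * transpose_mat ?S2 * - ?J)"
    unfolding V(4) to_fract.mat_hom_mult[OF JT car(5)] to_fract.mat_hom_mult[OF J car(4)] FJ FJ'
    by (simp add: map_mat_transpose)
  also have "?F X * \<dots> = ?F (X * (?J * transpose_mat ?S2 * - ?J))"
    by (rule to_fract.mat_hom_mult[OF X mult_carrier_mat[OF JT car(5)], symmetric])
  also have "X * (?J * transpose_mat ?S2 * - ?J) = X * (?J * transpose_mat ?S2) * - ?J"
    using X JT car(5) by (rule assoc_mult_mat[symmetric])
  also have "X * (?J * transpose_mat ?S2) = X * ?J * transpose_mat ?S2"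
    using X J car(4) by (rule assoc_mult_mat[symmetric])
  also have "\<dots> * - ?J = ?q \<cdot>\<^sub>m (N * - ?J)"
    unfolding XN using N car(5) by (rule mult_smult_assoc_mat)
  also have "?F \<dots> = q \<cdot>\<^sub>m ?F (N * - ?J)"
    using qq by (intro eq_matI) (auto simp: to_fract.hom_mult simp del: index_mult_mat(1))
  finally have eq: "q \<cdot>\<^sub>m (?F X * V) = q \<cdot>\<^sub>m ?F (N * - ?J)" .
  have FXV: "?F X * V = ?F (N * - ?J)"
  proof (rule eq_matI)
    have c: "?F X * V \<in> carrier_mat ?n ?n" "?F (N * - ?J) \<in> carrier_mat ?n ?n"
      using mult_carrier_mat[OF FX V(1)] mult_carrier_mat[OF N car(5)] by simp_all
    fix r s
    assume "r < dim_row (?F (N * - ?J))" "s < dim_col (?F (N * - ?J))"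
    then have "q * (?F X * V) $$ (r, s) = q * ?F (N * - ?J) $$ (r, s)"
      using arg_cong[OF eq, of "\<lambda>A. A $$ (r, s)"] c carrier_matD[OF c(1)] carrier_matD[OF c(2)]
      by (simp only: index_smult_mat)
    then show "(?F X * V) $$ (r, s) = ?F (N * - ?J) $$ (r, s)"
      using q0 by simp
  qed (use X V(1) N J in auto)
  have "elements_mat (map_mat of_int S1 * ?F (alpha g i M) * the (mat_inverse (map_mat of_int S2)))
      \<subseteq> range (to_fract :: 'p padic_int \<Rightarrow> _)"
  proof -
    have "map_mat of_int S1 * ?F (alpha g i M) = ?F X"
      unfolding X_def to_fract.mat_hom_mult[OF car(1) al] map_to_fract_of_int ..
    then have "map_mat of_int S1 * ?F (alpha g i M) * the (mat_inverse (map_mat of_int S2)) = ?F (N * - ?J)"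
      using FXV unfolding V_def map_to_fract_of_int by simp
    then show ?thesis
      by (auto simp: elements_mat_def simp del: index_mult_mat(1))
  qed
  then show ?thesis
    using M unfolding D_equivalent_def by blast
qed

section \<open>D-equivalence and the lower right block\<close>

lemma qbase_mult_sel:
  "qre (qbase a * z :: ('a::comm_ring_1, 'd) quad) = a * qre z" "qim (qbase a * z) = a * qim z"
  by simp_all

text \<open>
  Real coefficients commute with taking imaginary parts.
\<close>

lemma dvd_qim_combination:
  fixes W Y :: "('a::comm_ring_1, 'd) quad mat"
  assumes i: "i \<le> g" and A: "A \<in> carrier_mat a b" and W: "W \<in> carrier_mat b g" and Y: "Y \<in> carrier_mat e g"
    and rs: "r < a" "s < e"
    and dvd: "\<And>k. k < b \<Longrightarrow> q dvd qim ((W * sig_mat g i * qconj.star Y) $$ (k, s))"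
  shows "q dvd qim ((map_mat qbase A * W * sig_mat g i * qconj.star Y) $$ (r, s))"
proof -
  have A': "map_mat qbase A \<in> carrier_mat a b"
    using A by simp
  note E = sig_mat_carrier[OF i, where 'a="('a, 'd) quad"]
  have Y': "qconj.star Y \<in> carrier_mat g e"
    using Y by simp
  note WE = mult_carrier_mat[OF W E]
  have "map_mat qbase A * W * sig_mat g i * qconj.star Y = map_mat qbase A * (W * sig_mat g i * qconj.star Y)"
    unfolding assoc_mult_mat[OF A' W E] using A' WE Y' by (rule assoc_mult_mat)
  then have "(map_mat qbase A * W * sig_mat g i * qconj.star Y) $$ (r, s) =
      (\<Sum>k = 0..<b. map_mat qbase A $$ (r, k) * (W * sig_mat g i * qconj.star Y) $$ (k, s))"
    by (simp only: mat_mult_index_sum[OF A' mult_carrier_mat[OF WE Y'] rs])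
  then have "qim ((map_mat qbase A * W * sig_mat g i * qconj.star Y) $$ (r, s)) =
      (\<Sum>k = 0..<b. A $$ (r, k) * qim ((W * sig_mat g i * qconj.star Y) $$ (k, s)))"
    using A rs by (simp only: qim_sum) (intro sum.cong refl, simp add: qbase_mult_sel del: index_mult_mat(1))
  then show ?thesis
    using dvd by (auto intro!: dvd_sum)
qed

lemma of_int_nat_dvd:
  assumes "int k dvd x"
  shows "(of_nat k :: 'a::comm_ring_1) dvd of_int x"
  using assms by (auto elim!: dvdE)

text \<open>
  Divisibility by \<open>p\<^sup>2\<close> is clear for a pair of rows that are both outside the second block row.
  If the row of \<open>\<sigma>\<^sub>1\<close> belongs to it, \<open>B\<^sub>1 M = T B\<^sub>2\<close> reduces the claim to products of two rows of \<open>\<sigma>\<^sub>2\<close>;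
  if the row of \<open>\<sigma>\<^sub>2\<close> does, \<open>B\<^sub>2 = T\<^sup>-\<^sup>1 B\<^sub>1 M\<close> reduces it to two rows of \<open>\<sigma>\<^sub>1\<close>, whose products \<open>M\<close>
  multiplies by \<open>l\<close>.
\<close>

lemma D_equivalent_of_similar_G22:
  fixes S1 S2 :: "int mat"
  assumes inert: "inert_types TYPE('p::prime_card) TYPE('d)" and i: "i \<le> g"
    and S1: "S1 \<in> S_open CARD('p) R1 R2 g i" and S2: "S2 \<in> S_open CARD('p) R1 R2 g i"
    and G1: "det (G22 TYPE('p) TYPE('d) g i S1) dvd 1"
    and T: "T \<in> carrier_mat (g - i) (g - i)" "det T dvd 1" and l: "l dvd 1"
    and TG: "T * G22 TYPE('p) TYPE('d) g i S2 * transpose_mat T = l \<cdot>\<^sub>m G22 TYPE('p) TYPE('d) g i S1"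
  shows "D_equivalent TYPE('p) TYPE('d) g i S1 S2"
proof -
  let ?Z1 = "hermitian_rows g i (map_mat of_int S1) :: ('p padic_int, 'd) quad mat"
  let ?Z2 = "hermitian_rows g i (map_mat of_int S2) :: ('p padic_int, 'd) quad mat"
  let ?E = "sig_mat g i :: ('p padic_int, 'd) quad mat"
  let ?n = "g + g"
  let ?q = "(of_nat CARD('p))\<^sup>2 :: 'p padic_int"
  note Sc = S_open_carrier[OF i S1] S_open_carrier[OF i S2]
  have Z: "?Z1 \<in> carrier_mat ?n g" "?Z2 \<in> carrier_mat ?n g"
    using Sc by auto
  define B1 where "B1 = second_block_rows g i ?Z1"
  define B2 where "B2 = second_block_rows g i ?Z2"
  have B: "B1 \<in> carrier_mat (g - i) g" "B2 \<in> carrier_mat (g - i) g"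
    using Z by (simp_all add: B1_def B2_def)
  have gram: "unitary_form g i B1 = map_mat qbase (G22 TYPE('p) TYPE('d) g i S1)"
    "unitary_form g i B2 = map_mat qbase (G22 TYPE('p) TYPE('d) g i S2)"
    unfolding B1_def B2_def G22_def by (rule second_block_rows_gram[OF i S1] second_block_rows_gram[OF i S2])+
  obtain M where M: "M \<in> unitary_similitudes g i" "unitary_form g i M = qbase l \<cdot>\<^sub>m ?E"
    "B1 * M = map_mat qbase T * B2"
    by (rule similitude_carrying[OF inert i diff_le_self B G22_carrier G1 G22_carrier gram l T(1) TG])
  have Mc: "M \<in> carrier_mat g g"
    using M by (simp add: unitary_similitudes_def)
  obtain T' where T': "T' \<in> carrier_mat (g - i) (g - i)" "T' * T = 1\<^sub>m (g - i)"
    using unit_det_imp_inverse[OF T] by metis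
  define W where "W = ?Z1 * M"
  have W: "W \<in> carrier_mat ?n g"
    unfolding W_def using Z(1) Mc by (rule mult_carrier_mat)
  have second_block_W: "second_block_rows g i W = map_mat qbase T * B2"
    unfolding W_def second_block_rows_mult[OF Z(1) Mc] B1_def[symmetric] by (rule M(3))
  have TB: "map_mat qbase T * B2 \<in> carrier_mat (g - i) g"
    using T(1) B(2) by (intro mult_carrier_mat[of _ "g - i" "g - i"]) auto
  have B2W: "B2 = map_mat qbase T' * second_block_rows g i W"
  proof -
    have "map_mat qbase T' * second_block_rows g i W = map_mat qbase T' * map_mat qbase T * B2"
      unfolding second_block_W using T' T(1) B(2)
      by (intro assoc_mult_mat[symmetric, of _ "g - i" "g - i" _ "g - i" _ g]) auto
    also have "map_mat qbase T' * map_mat qbase T = (1\<^sub>m (g - i) :: ('p padic_int, 'd) quad mat)"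
      unfolding qbase.mat_hom_mult[OF T'(1) T(1), symmetric] T'(2) by (rule qbase.mat_hom_one)
    finally show ?thesis
      using B(2) by simp
  qed
  have formW: "W * ?E * qconj.star W = qbase l \<cdot>\<^sub>m (?Z1 * ?E * qconj.star ?Z1)"
  proof -
    have "W * ?E * qconj.star W = ?Z1 * (qbase l \<cdot>\<^sub>m ?E) * qconj.star ?Z1"
      using unitary_form_mult[OF i Z(1) Mc] unfolding unitary_form_def[symmetric] W_def[symmetric] M(2) .
    also have "?Z1 * (qbase l \<cdot>\<^sub>m ?E) = qbase l \<cdot>\<^sub>m (?Z1 * ?E)"
      using Z(1) sig_mat_carrier[OF i] by (rule mult_smult_distrib)
    also have "\<dots> * qconj.star ?Z1 = qbase l \<cdot>\<^sub>m (?Z1 * ?E * qconj.star ?Z1)"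
      using mult_carrier_mat[OF Z(1) sig_mat_carrier[OF i]] Z(1)
      by (intro mult_smult_assoc_mat[of _ ?n g _ ?n]) auto
    finally show ?thesis .
  qed
  have real_mod_q: "?q dvd qim ((Z * ?E * qconj.star Z) $$ (r, s))"
    if "Z = ?Z1 \<or> Z = ?Z2" "r < ?n" "s < ?n" for Z r s
    using that S_open_qim[OF i S1 that(2,3), where 'a="'p padic_int" and 'd='d]
      S_open_qim[OF i S2 that(2,3), where 'a="'p padic_int" and 'd='d] by (auto simp del: index_mult_mat(1))
  have second_block_left: "?q dvd qim ((W * ?E * qconj.star ?Z2) $$ (i + r, s))" if "r < g - i" "s < ?n" for r s
  proof -
    have "?q dvd qim ((map_mat qbase T * B2 * ?E * qconj.star ?Z2) $$ (r, s))"
    proof (rule dvd_qim_combination[OF i T(1) B(2) Z(2) that])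
      fix k
      assume k: "k < g - i"
      then have "i + k < ?n"
        by simp
      then show "?q dvd qim ((B2 * ?E * qconj.star ?Z2) $$ (k, s))"
        unfolding B2_def second_block_rows_form[OF i Z(2,2) k that(2)] by (intro real_mod_q that(2)) auto
    qed
    then show ?thesis
      unfolding second_block_W[symmetric] second_block_rows_form[OF i W Z(2) that] .
  qed
  have second_block_right: "?q dvd qim ((W * ?E * qconj.star ?Z2) $$ (r, i + s))" if "r < ?n" "s < g - i" for r s
  proof -
    have "?q dvd qim ((map_mat qbase T' * second_block_rows g i W * ?E * qconj.star W) $$ (s, r))"
    proof (rule dvd_qim_combination[OF i T'(1) second_block_rows_carrier[OF W] W that(2,1)])
      fix k
      assume k: "k < g - i"
      then have ik: "i + k < ?n"
        by simp
      have "(second_block_rows g i W * ?E * qconj.star W) $$ (k, r) = qbase l * (?Z1 * ?E * qconj.star ?Z1) $$ (i + k, r)"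
        unfolding second_block_rows_form[OF i W W k that(1)] formW using ik that(1) Z(1)
        by (intro index_smult_mat(1)) auto
      then show "?q dvd qim ((second_block_rows g i W * ?E * qconj.star W) $$ (k, r))"
        using real_mod_q[of ?Z1, OF _ ik that(1)] by (simp only: qbase_mult_sel dvd_mult simp_thms)
    qed
    then have "?q dvd qim ((?Z2 * ?E * qconj.star W) $$ (i + s, r))"
      unfolding B2W[symmetric] unfolding B2_def second_block_rows_form[OF i Z(2) W that(2,1)] .
    moreover have "qconj.star (?Z2 * ?E * qconj.star W) = W * ?E * qconj.star ?Z2"
      by (rule qconj.gram_star[OF sig_mat_carrier[OF i] star_sig_mat[OF i] Z(2) W])
    then have "(W * ?E * qconj.star ?Z2) $$ (r, i + s) = qconj.star (?Z2 * ?E * qconj.star W) $$ (r, i + s)"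
      by (simp only:)
    moreover have "\<dots> = qconj ((?Z2 * ?E * qconj.star W) $$ (i + s, r))"
    proof -
      have "?Z2 * ?E * qconj.star W \<in> carrier_mat ?n ?n"
        by (rule mult_carrier_mat[OF mult_carrier_mat[OF Z(2) sig_mat_carrier[OF i]]]) (use W in simp)
      then show ?thesis
        using that by (simp del: index_mult_mat)
    qed
    ultimately show ?thesis
      by (simp only: quad_sel dvd_minus_iff)
  qed
  show ?thesis
  proof (rule D_equivalentI[OF i Sc S_open_symplectic[OF i S2] M(1)])
    fix r s
    assume rs: "r < ?n" "s < ?n"
    let ?K = "map_mat of_int S1 * alpha g i M * symp_mat g * transpose_mat (map_mat of_int S2) :: 'p padic_int mat"
    have c: "map_mat of_int S1 \<in> carrier_mat ?n ?n" "map_mat of_int S2 \<in> carrier_mat ?n ?n"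
      using Sc by auto
    have eq: "?K $$ (r, s) = - qim ((W * ?E * qconj.star ?Z2) $$ (r, s))"
      unfolding W_def hermitian_rows_mult_alpha[OF i c(1) Mc, symmetric]
      using mult_carrier_mat[OF c(1) alpha_carrier[OF i Mc]] c(2) rs by (intro symp_form_eq_qim[OF i])
    show "?q dvd ?K $$ (r, s)"
    proof (cases "(i \<le> r \<and> r < g) \<or> (i \<le> s \<and> s < g)")
      case True
      then show ?thesis
        unfolding eq dvd_minus_iff using second_block_left[of "r - i" s] second_block_right[of r "s - i"] rs by auto
    next
      case False
      let ?H = "alpha g i M * symp_mat g"
      have H: "?H \<in> carrier_mat ?n ?n"
        using alpha_carrier[OF i Mc] symp_mat_carrier by (rule mult_carrier_mat)
      have "?K = map_mat of_int S1 * ?H * transpose_mat (map_mat of_int S2)"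
        using assoc_mult_mat[OF c(1) alpha_carrier[OF i Mc] symp_mat_carrier] by simp
      moreover have "transpose_mat (map_mat of_int S2) \<in> carrier_mat ?n ?n"
        using c(2) by simp
      ultimately have "?K $$ (r, s) = (\<Sum>t = 0..<?n. (\<Sum>u = 0..<?n. of_int (S1 $$ (r, u)) * ?H $$ (u, t)) *
          of_int (S2 $$ (s, t)))"
        using mat_mult_index_sum[OF mult_carrier_mat[OF c(1) H], of "transpose_mat (map_mat of_int S2)" ?n r s]
          rs Sc by (simp add: mat_mult_index_sum[OF c(1) H] del: index_mult_mat(1))
      moreover have "of_nat CARD('p) dvd (of_int (S1 $$ (r, u)) :: 'p padic_int)" if "u < ?n" for u
        using S_open_row_dvd[OF i S1 rs(1) that] False by (auto dest!: of_int_nat_dvd)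
      moreover have "of_nat CARD('p) dvd (of_int (S2 $$ (s, t)) :: 'p padic_int)" if "t < ?n" for t
        using S_open_row_dvd[OF i S2 rs(2) that] False by (auto dest!: of_int_nat_dvd)
      ultimately show ?thesis
        unfolding power2_eq_square by (simp only:) (intro dvd_sum mult_dvd_mono dvd_mult2, auto)
    qed
  qed
qed

lemma qred_unitary_form:
  fixes X :: "('p::prime_card padic_int, 'd) quad mat"
  assumes i: "i \<le> g" and X: "X \<in> carrier_mat a g"
  shows "map_mat qred (unitary_form g i X) = unitary_form g i (map_mat qred X)"
proof (rule eq_matI)
  have X': "map_mat qred X \<in> carrier_mat a g"
    using X by simp
  have sgn: "qred (sig_sign i t :: ('p padic_int, 'd) quad) = sig_sign i t" for t
    by (simp add: sig_sign_def qred.hom_uminus)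
  have cj: "qred (qconj x) = qconj (qred x)" for x :: "('p padic_int, 'd) quad"
    by (intro quad_eqI) (simp_all add: padic_red.hom_uminus)
  fix r s
  assume "r < dim_row (unitary_form g i (map_mat qred X))" "s < dim_col (unitary_form g i (map_mat qred X))"
  then have rs: "r < a" "s < a"
    using unitary_form_carrier[OF X', of i] by auto
  have "map_mat qred (unitary_form g i X) $$ (r, s) = qred (unitary_form g i X $$ (r, s))"
    using rs carrier_matD[OF unitary_form_carrier[OF X, of i]] by simp
  also have "\<dots> = (\<Sum>t = 0..<g. map_mat qred X $$ (r, t) * sig_sign i t * qconj (map_mat qred X $$ (s, t)))"
    unfolding unitary_form_index[OF i X rs] qred.hom_sum
    using rs X by (intro sum.cong refl) (simp add: qred.hom_mult sgn cj)
  also have "\<dots> = unitary_form g i (map_mat qred X) $$ (r, s)"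
    by (rule unitary_form_index[OF i X' rs, symmetric])
  finally show "map_mat qred (unitary_form g i X) $$ (r, s) = unitary_form g i (map_mat qred X) $$ (r, s)" .
qed (simp_all add: unitary_form_def)

lemma transpose_smult_mat: "transpose_mat (a \<cdot>\<^sub>m A) = a \<cdot>\<^sub>m transpose_mat (A :: 'a::comm_ring_1 mat)"
  by (intro eq_matI) auto

lemma map_qred_qbase: "map_mat qred (map_mat qbase G) = map_mat qbase (map_mat padic_red G)"
  by (intro eq_matI) (auto intro: quad_eqI)

lemma G22_symmetric:
  assumes i: "i \<le> g" and S: "S \<in> S_open CARD('p::prime_card) R1 R2 g i"
  shows "transpose_mat (G22 TYPE('p) TYPE('d) g i S) = G22 TYPE('p) TYPE('d) g i S"
proof -
  let ?B = "second_block_rows g i (hermitian_rows g i (map_mat of_int S)) :: ('p padic_int, 'd) quad mat"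
  have B: "?B \<in> carrier_mat (g - i) g"
    using S_open_carrier[OF i S] by (intro second_block_rows_carrier[of _ "g + g"]) simp
  have gram: "unitary_form g i ?B = map_mat qbase (G22 TYPE('p) TYPE('d) g i S)"
    unfolding G22_def by (rule second_block_rows_gram[OF i S])
  have "qconj.star (unitary_form g i ?B) = unitary_form g i ?B"
    unfolding unitary_form_def by (rule qconj.gram_star[OF sig_mat_carrier[OF i] star_sig_mat[OF i] B B])
  then have "map_mat qbase (transpose_mat (G22 TYPE('p) TYPE('d) g i S)) =
      (map_mat qbase (G22 TYPE('p) TYPE('d) g i S) :: ('p padic_int, 'd) quad mat)"
    unfolding gram star_map_qbase .
  then show ?thesis
    by (rule qbase.mat_hom_inj)
qed

text \<open>
  Integrality says \<open>\<sigma>\<^sub>1 \<alpha>(M) = N \<sigma>\<^sub>2\<close> with \<open>N\<close> integral.  Modulo \<open>p\<close> all rows of \<open>\<sigma>\<^sub>2\<close> vanish except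
  those of the second block row, so \<open>B\<^sub>1 M = T B\<^sub>2\<close> where \<open>T\<close> is the middle block of \<open>N\<close>.
\<close>

lemma similar_G22_of_D_equivalent:
  fixes S1 S2 :: "int mat"
  assumes i: "i \<le> g" and S1: "S1 \<in> S_open CARD('p::prime_card) R1 R2 g i"
    and S2: "S2 \<in> S_open CARD('p) R1 R2 g i"
    and D: "D_equivalent TYPE('p) TYPE('d) g i S1 S2"
  obtains T l where "T \<in> carrier_mat (g - i) (g - i)" "l \<noteq> 0"
    "T * map_mat padic_red (G22 TYPE('p) TYPE('d) g i S2) * transpose_mat T =
      l \<cdot>\<^sub>m map_mat padic_red (G22 TYPE('p) TYPE('d) g i S1)"
proof -
  let ?n = "g + g"
  let ?Z1 = "hermitian_rows g i (map_mat of_int S1) :: ('p padic_int, 'd) quad mat"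
  let ?Z2 = "hermitian_rows g i (map_mat of_int S2) :: ('p padic_int, 'd) quad mat"
  let ?G1 = "G22 TYPE('p) TYPE('d) g i S1"
  let ?G2 = "G22 TYPE('p) TYPE('d) g i S2"
  note Sc = S_open_carrier[OF i S1] S_open_carrier[OF i S2]
  have c: "(map_mat of_int S1 :: 'p padic_int mat) \<in> carrier_mat ?n ?n"
    "(map_mat of_int S2 :: 'p padic_int mat) \<in> carrier_mat ?n ?n"
    using Sc by auto
  have Z: "?Z1 \<in> carrier_mat ?n g" "?Z2 \<in> carrier_mat ?n g"
    by (rule hermitian_rows_carrier[OF c(1)] hermitian_rows_carrier[OF c(2)])+
  obtain M :: "('p padic_int, 'd) quad mat" and N where M: "M \<in> unitary_similitudes g i"
    and N: "N \<in> carrier_mat ?n ?n" "map_mat of_int S1 * alpha g i M = N * map_mat of_int S2"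
    by (rule D_equivalentD[OF i Sc S_open_symplectic[OF i S2] D])
  obtain l where l: "l dvd 1" "unitary_form g i M = qbase l \<cdot>\<^sub>m sig_mat g i" and Mc: "M \<in> carrier_mat g g"
    using M by (auto simp: unitary_similitudes_def)
  define B1 where "B1 = second_block_rows g i ?Z1"
  define B2 where "B2 = second_block_rows g i ?Z2"
  have B: "B1 \<in> carrier_mat (g - i) g" "B2 \<in> carrier_mat (g - i) g"
    unfolding B1_def B2_def using Z by (simp_all only: second_block_rows_carrier)
  have gram: "unitary_form g i B1 = map_mat qbase ?G1" "unitary_form g i B2 = map_mat qbase ?G2"
    unfolding B1_def B2_def G22_def by (rule second_block_rows_gram[OF i S1] second_block_rows_gram[OF i S2])+
  let ?N = "map_mat qbase N :: ('p padic_int, 'd) quad mat"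
  have ZM: "?Z1 * M = ?N * ?Z2"
    unfolding hermitian_rows_mult_alpha[OF i c(1) Mc, symmetric] N(2) by (rule hermitian_rows_mult_left[OF N(1) c(2)])
  have BM: "B1 * M = second_block_rows g i (?N * ?Z2)"
    unfolding B1_def second_block_rows_mult[OF Z(1) Mc, symmetric] ZM ..
  \<comment> \<open>The middle block of \<open>N\<close> modulo \<open>p\<close>.\<close>
  define T where "T = mat (g - i) (g - i) (\<lambda>(r, k). padic_red (N $$ (i + r, i + k)))"
  let ?T = "map_mat qbase T :: ('p mod_ring, 'd) quad mat"
  have T: "T \<in> carrier_mat (g - i) (g - i)"
    by (simp add: T_def)
  have Nq: "?N \<in> carrier_mat ?n ?n"
    using N(1) by simp
  have redZ: "qred (?Z2 $$ (t, c)) = 0" if "t < ?n" "c < g" "\<not> (i \<le> t \<and> t < g)" for t c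
  proof -
    have "of_nat CARD('p) dvd (of_int (S2 $$ (t, u)) :: 'p padic_int)" if "u < ?n" for u
      using S_open_row_dvd[OF i S2 \<open>t < ?n\<close> that] \<open>\<not> _\<close> by (intro of_int_nat_dvd) blast
    then have "padic_red (of_int (S2 $$ (t, u)) :: 'p padic_int) = 0" if "u < ?n" for u
      using that by (intro padic_red_prime_dvd) blast
    moreover have "?Z2 $$ (t, c) = Quad (of_int (S2 $$ (t, c))) (sig_sign i c * of_int (S2 $$ (t, g + c)))"
      using that Sc(2) by (simp add: hermitian_rows_index)
    ultimately show ?thesis
      using that by (intro quad_eqI) (simp_all add: padic_red.hom_mult)
  qed
  have red: "map_mat qred (B1 * M) = ?T * map_mat qred B2"
  proof (rule eq_matI)
    fix r c
    assume "r < dim_row (?T * map_mat qred B2)" "c < dim_col (?T * map_mat qred B2)"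
    then have rc: "r < g - i" "c < g"
      using T B by auto
    then have ir: "i + r < ?n"
      by simp
    have "map_mat qred (B1 * M) $$ (r, c) = qred ((B1 * M) $$ (r, c))"
      using rc B Mc by (simp del: index_mult_mat(1))
    also have "(B1 * M) $$ (r, c) = (?N * ?Z2) $$ (i + r, c)"
      unfolding BM using rc Z(2) by (intro second_block_rows_index) auto
    also have "\<dots> = (\<Sum>t = 0..<?n. ?N $$ (i + r, t) * ?Z2 $$ (t, c))"
      by (rule mat_mult_index_sum[OF Nq Z(2) ir rc(2)])
    also have "qred \<dots> = (\<Sum>t = 0..<?n. qred (?N $$ (i + r, t)) * qred (?Z2 $$ (t, c)))"
      by (simp only: qred.hom_sum qred.hom_mult)
    also have "\<dots> = (\<Sum>t = i..<g. qred (?N $$ (i + r, t)) * qred (?Z2 $$ (t, c)))"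
      using rc redZ i by (intro sum.mono_neutral_right) auto
    also have "\<dots> = (\<Sum>k = 0..<g - i. qred (?N $$ (i + r, k + i)) * qred (?Z2 $$ (k + i, c)))"
      using sum.shift_bounds_nat_ivl[of "\<lambda>t. qred (?N $$ (i + r, t)) * qred (?Z2 $$ (t, c))" 0 i "g - i"] i
      by simp
    also have "\<dots> = (\<Sum>k = 0..<g - i. ?T $$ (r, k) * map_mat qred B2 $$ (k, c))"
    proof (intro sum.cong refl)
      fix k
      assume "k \<in> {0..<g - i}"
      then have k: "k < g - i" "i + k < ?n"
        by auto
      have "qred (?N $$ (i + r, k + i)) = ?T $$ (r, k)"
        using k ir N(1) T rc by (intro quad_eqI) (simp_all add: T_def add.commute)
      moreover have "?Z2 $$ (k + i, c) = B2 $$ (k, c)"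
        unfolding B2_def using second_block_rows_index[of k g i c ?Z2] k rc Z(2) by (simp add: add.commute)
      ultimately show "qred (?N $$ (i + r, k + i)) * qred (?Z2 $$ (k + i, c)) =
          ?T $$ (r, k) * map_mat qred B2 $$ (k, c)"
        using k rc B by simp
    qed
    also have "\<dots> = (?T * map_mat qred B2) $$ (r, c)"
      using T B rc by (intro mat_mult_index_sum[symmetric]) auto
    finally show "map_mat qred (B1 * M) $$ (r, c) = (?T * map_mat qred B2) $$ (r, c)" .
  qed (use B Mc T in auto)
  have B1E: "B1 * sig_mat g i \<in> carrier_mat (g - i) g"
    using B(1) sig_mat_carrier[OF i] by (rule mult_carrier_mat)
  have "unitary_form g i (B1 * M) = B1 * (qbase l \<cdot>\<^sub>m sig_mat g i) * qconj.star B1"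
    using unitary_form_mult[OF i B(1) Mc] unfolding l(2) .
  also have "\<dots> = qbase l \<cdot>\<^sub>m unitary_form g i B1"
    unfolding unitary_form_def mult_smult_distrib[OF B(1) sig_mat_carrier[OF i]]
    using B1E B(1) by (intro mult_smult_assoc_mat) auto
  also have "\<dots> = map_mat qbase (l \<cdot>\<^sub>m ?G1)"
    unfolding gram by (intro eq_matI) (auto simp: qbase.hom_mult)
  finally have "map_mat qred (unitary_form g i (B1 * M)) = map_mat qbase (map_mat padic_red (l \<cdot>\<^sub>m ?G1))"
    by (simp only: map_qred_qbase)
  moreover have "map_mat qred (unitary_form g i (B1 * M)) = map_mat qbase (T * map_mat padic_red ?G2 * transpose_mat T)"
  proof -
    have B2': "map_mat qred B2 \<in> carrier_mat (g - i) g"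
      using B by simp
    have T': "?T \<in> carrier_mat (g - i) (g - i)"
      using T by simp
    have G2: "map_mat padic_red ?G2 \<in> carrier_mat (g - i) (g - i)"
      by simp
    have "map_mat qred (unitary_form g i (B1 * M)) = unitary_form g i (?T * map_mat qred B2)"
      unfolding qred_unitary_form[OF i mult_carrier_mat[OF B(1) Mc]] red ..
    also have "\<dots> = ?T * unitary_form g i (map_mat qred B2) * qconj.star (?T)"
      by (rule unitary_form_mult[OF i T' B2'])
    also have "unitary_form g i (map_mat qred B2) = map_mat qbase (map_mat padic_red ?G2)"
      unfolding qred_unitary_form[OF i B(2), symmetric] gram map_qred_qbase ..
    also have "?T * \<dots> * qconj.star (?T) =
        map_mat qbase (T * map_mat padic_red ?G2 * transpose_mat T)"
      unfolding star_map_qbase qbase.mat_hom_mult[OF T G2, symmetric]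
      by (rule qbase.mat_hom_mult[OF mult_carrier_mat[OF T G2], symmetric]) (use T in simp)
    finally show ?thesis .
  qed
  ultimately have "map_mat qbase (T * map_mat padic_red ?G2 * transpose_mat T) =
      (map_mat qbase (map_mat padic_red (l \<cdot>\<^sub>m ?G1)) :: ('p mod_ring, 'd) quad mat)"
    by simp
  then have "T * map_mat padic_red ?G2 * transpose_mat T = map_mat padic_red (l \<cdot>\<^sub>m ?G1)"
    by (rule qbase.mat_hom_inj)
  also have "\<dots> = padic_red l \<cdot>\<^sub>m map_mat padic_red ?G1"
    by (intro eq_matI) (auto simp: padic_red.hom_mult)
  finally show thesis
    using that[OF T] l(1) by (simp add: padic_unit_iff)
qed

theorem theorem4p2p15:
  fixes g i :: nat and R1 R2 :: "int set" and \<sigma>1 \<sigma>2 :: "int mat"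
  assumes "odd CARD('p::prime_card)"
    and "squarefree CARD('d::finite)"
    and "inert_prime CARD('p) CARD('d)"
    and "i \<le> g"
    and "residue_system CARD('p) R1"
    and "residue_system (CARD('p)\<^sup>2) R2"
    and "\<sigma>1 \<in> D_set TYPE('p) TYPE('d) R1 R2 g i i"
    and "\<sigma>2 \<in> D_set TYPE('p) TYPE('d) R1 R2 g i i"
  shows "(odd (g - i) \<longrightarrow> D_equivalent TYPE('p) TYPE('d) g i \<sigma>1 \<sigma>2) \<and>
    (even (g - i) \<longrightarrow>
      (D_equivalent TYPE('p) TYPE('d) g i \<sigma>1 \<sigma>2 \<longleftrightarrow>
        (\<exists>c. c \<noteq> 0 \<and>
           det (map_mat padic_red (G22 TYPE('p) TYPE('d) g i \<sigma>1)) /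
           det (map_mat padic_red (G22 TYPE('p) TYPE('d) g i \<sigma>2)) = c\<^sup>2)))"
proof -
  let ?n = "g - i"
  let ?G1 = "G22 TYPE('p) TYPE('d) g i \<sigma>1"
  let ?G2 = "G22 TYPE('p) TYPE('d) g i \<sigma>2"
  note i = assms(4)
  have inert: "inert_types TYPE('p) TYPE('d)"
    using assms(3,2,1) by (rule inert_types_of_inert_prime)
  have S: "\<sigma>1 \<in> S_open CARD('p) R1 R2 g i" "\<sigma>2 \<in> S_open CARD('p) R1 R2 g i"
    using assms(7,8) by (simp_all add: D_set_def)
  define d1 where "d1 = det (map_mat padic_red ?G1)"
  define d2 where "d2 = det (map_mat padic_red ?G2)"
  have d0: "d1 \<noteq> 0" "d2 \<noteq> 0"
    unfolding d1_def d2_def using D_set_nondegenerate[OF inert i] assms(7,8) by blast+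
  have red: "padic_red (det ?G1) = d1" "padic_red (det ?G2) = d2"
    by (simp_all add: d1_def d2_def)
  have unit: "det ?G1 dvd 1" "det ?G2 dvd 1"
    unfolding padic_unit_iff red by (rule d0)+
  have sufficient: "D_equivalent TYPE('p) TYPE('d) g i \<sigma>1 \<sigma>2"
    if l: "l dvd 1" and c: "(padic_red l) ^ ?n * d1 = c\<^sup>2 * d2" for l c
  proof -
    have det: "det (l \<cdot>\<^sub>m ?G1) = l ^ ?n * det ?G1"
      using carrier_matD(2)[OF G22_carrier[of "TYPE('p)" "TYPE('d)" g i \<sigma>1]] by simp
    have sym: "transpose_mat (l \<cdot>\<^sub>m ?G1) = l \<cdot>\<^sub>m ?G1"
      unfolding transpose_smult_mat G22_symmetric[OF i S(1)] ..
    obtain T where T: "T \<in> carrier_mat ?n ?n" "det T dvd 1" "T * ?G2 * transpose_mat T = l \<cdot>\<^sub>m ?G1"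
    proof (rule padic_symmetric_forms_equivalent[OF assms(1)])
      show "l \<cdot>\<^sub>m ?G1 \<in> carrier_mat ?n ?n" "?G2 \<in> carrier_mat ?n ?n"
        by simp_all
      show "det (l \<cdot>\<^sub>m ?G1) dvd 1"
        unfolding det using l unit(1) dvd_power_same[OF l, of ?n] by (simp add: is_unit_mult_iff)
      show "padic_red (det (l \<cdot>\<^sub>m ?G1)) = c\<^sup>2 * padic_red (det ?G2)"
        unfolding det padic_red.hom_mult padic_red.hom_power red by (rule c)
    qed (rule sym G22_symmetric[OF i S(2)] unit(2) that | assumption)+
    show ?thesis
      by (rule D_equivalent_of_similar_G22[OF inert i S unit(1) T(1,2) l T(3)])
  qed
  show ?thesis
  proof (intro conjI impI)
    assume "odd ?n"
    then obtain k where k: "?n = 2 * k + 1"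
      by (elim oddE)
    show "D_equivalent TYPE('p) TYPE('d) g i \<sigma>1 \<sigma>2"
    proof (rule sufficient)
      \<comment> \<open>For odd rank, scaling by \<open>\<lambda>\<close> changes the determinant class by \<open>\<lambda>\<close>; this choice makes the two classes equal.\<close>
      show "det ?G1 * det ?G2 dvd 1"
        using unit by (simp add: is_unit_mult_iff)
      show "(padic_red (det ?G1 * det ?G2)) ^ ?n * d1 = ((d1 * d2) ^ k * d1)\<^sup>2 * d2"
        unfolding padic_red.hom_mult red k
        by (simp add: power_add power_mult power2_eq_square power_mult_distrib ac_simps)
    qed
  next
    assume "even ?n"
    then obtain k where k: "?n = 2 * k"
      by (elim evenE)
    show "D_equivalent TYPE('p) TYPE('d) g i \<sigma>1 \<sigma>2 \<longleftrightarrow>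
      (\<exists>c. c \<noteq> 0 \<and> det (map_mat padic_red ?G1) / det (map_mat padic_red ?G2) = c\<^sup>2)"
      unfolding d1_def[symmetric] d2_def[symmetric]
    proof
      assume "D_equivalent TYPE('p) TYPE('d) g i \<sigma>1 \<sigma>2"
      then obtain T l where T: "T \<in> carrier_mat ?n ?n" and l: "l \<noteq> 0"
        and TG: "T * map_mat padic_red ?G2 * transpose_mat T = l \<cdot>\<^sub>m map_mat padic_red ?G1"
        by (rule similar_G22_of_D_equivalent[OF i S])
      have "(det T)\<^sup>2 * d2 = det (l \<cdot>\<^sub>m map_mat padic_red ?G1)"
        unfolding TG[symmetric] d2_def using T by (intro congruence_det[symmetric, of _ ?n]) auto
      also have "\<dots> = (l ^ k)\<^sup>2 * d1"
        using carrier_matD(2)[OF G22_carrier[of "TYPE('p)" "TYPE('d)" g i \<sigma>1]]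
        by (simp add: d1_def k power_mult[symmetric] mult.commute)
      finally have eq: "(det T)\<^sup>2 * d2 = (l ^ k)\<^sup>2 * d1" .
      then have "det T \<noteq> 0"
        using l d0 by auto
      moreover have "d1 / d2 = (det T / l ^ k)\<^sup>2"
        using eq l d0 by (simp add: power_divide divide_eq_eq eq_divide_eq field_simps)
      ultimately show "\<exists>c. c \<noteq> 0 \<and> d1 / d2 = c\<^sup>2"
        using l by (intro exI[of _ "det T / l ^ k"]) simp
    next
      assume "\<exists>c. c \<noteq> 0 \<and> d1 / d2 = c\<^sup>2"
      then obtain c where "d1 / d2 = c\<^sup>2"
        by blast
      then have "d1 = c\<^sup>2 * d2"
        using d0(2) by (simp add: divide_eq_eq)
      then show "D_equivalent TYPE('p) TYPE('d) g i \<sigma>1 \<sigma>2"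
        by (intro sufficient[of 1 c]) simp_all
    qed
  qed
qed

end
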